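(* Let $X$ be a proper CAT(0) space with $\operatorname{radius}_T(\partial X) > 3\pi$, and let $h$ be a parabolic isometry of $X$. Then there exists a fixed point $m \in \partial X$ of $h$ such that $\Omega = \partial X - \bar B_T(m,\pi)$ is an open subset of $\partial X$ on which $\langle h \rangle$ acts properly discontinuously, and such that if $\bar B_T(m,\pi) \subset \Lambda X$ then $\Omega$ is dense in $\partial X$.
   Context: A metric space is proper if its closed balls are compact. $\partial X$ is the visual boundary of $X$ (asymptotic classes of geodesic rays) with the cone topology; "open", "dense" and "compact" refer to this topology, and $\bar X = X\cup\partial X$ also carries the cone topology. For $u,v\in\partial X$, $\angle(u,v)=\sup_{p\in X}\angle_p(u,v)$, and the Tits metric $d_T$ (with values in $[0,\infty]$) is the path (length) metric on $\partial X$ induced by $\angle$. $B_T(u,r)=\{v\in\partial X: d_T(u,v)<r\}$ and $\bar B_T(u,r)=\{v\in\partial X: d_T(u,v)\le r\}$. For $A\subset\partial X$, $\operatorname{radius}_T(A)=\inf\{r: A\subset B_T(u,r)\text{ for some }u\in\partial X\}$ (infinite if there is no such $r$). An isometry is parabolic if its displacement function $x\mapsto d(x,h(x))$ does not attain its infimum. The limit set $\Lambda X\subset\partial X$ is the set of $p\in\partial X$ for which there exist a sequence $(g_i)$ of isometries of $X$ and a point $n\in\partial X$ such that $g_i(x)\to p$ and $g_i^{-1}(x)\to n$ in $\bar X$ for all $x\in X$. The action of $\langle h\rangle$ on $\Omega$ is properly discontinuous if for every compact $K\subset\Omega$ the set $\{i\in\mathbb Z: h^i(K)\cap K\ne\emptyset\}$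 is finite. *)

theory Defs
  imports "HOL-Analysis.Analysis"
begin

text \<open>The metric space X is the universe of a type of class \<open>metric_space\<close>; in particular it is
  nonempty. Properness and the CAT(0) condition are explicit hypotheses.\<close>

definition proper_space :: "'a::metric_space itself \<Rightarrow> bool" where
  "proper_space _ \<longleftrightarrow> (\<forall>(x::'a) r. compact (cball x r))"

definition geodesic :: "(real \<Rightarrow> 'a::metric_space) \<Rightarrow> 'a \<Rightarrow> 'a \<Rightarrow> bool" where
  "geodesic g x y \<longleftrightarrow> g 0 = x \<and> g (dist x y) = y \<and>
     (\<forall>s\<in>{0..dist x y}. \<forall>t\<in>{0..dist x y}. dist (g s) (g t) = \<bar>s - t\<bar>)"

text \<open>Points \<open>x'\<close> of the side \<open>[p', q']\<close> of a Euclidean comparison triangle are the comparison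
  points of \<open>g (dist p' x')\<close>. It is enough to treat two sides with common vertex \<open>p\<close>: the vertices
  may be relabelled, and for two points on the same side the inequality is an equality.\<close>

definition CAT0_space :: "'a::metric_space itself \<Rightarrow> bool" where
  "CAT0_space _ \<longleftrightarrow>
     (\<forall>(x::'a) y. \<exists>g. geodesic g x y) \<and>
     (\<forall>(p::'a) q r g k (p'::real^2) q' r'.
        geodesic g p q \<and> geodesic k p r \<and>
        dist p' q' = dist p q \<and> dist p' r' = dist p r \<and> dist q' r' = dist q r \<longrightarrow>
        (\<forall>x'\<in>closed_segment p' q'. \<forall>y'\<in>closed_segment p' r'.
           dist (g (dist p' x')) (k (dist p' y')) \<le> dist x' y'))"

text \<open>Rays are total functions of which only the values on \<open>{0..}\<close> matter: an asymptotic class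
  contains, with each ray, all functions agreeing with it on \<open>{0..}\<close>.\<close>

definition geodesic_ray :: "(real \<Rightarrow> 'a::metric_space) \<Rightarrow> bool" where
  "geodesic_ray c \<longleftrightarrow> (\<forall>s\<ge>0. \<forall>t\<ge>0. dist (c s) (c t) = \<bar>s - t\<bar>)"

definition asymptotic :: "((real \<Rightarrow> 'a::metric_space) \<times> (real \<Rightarrow> 'a)) set" where
  "asymptotic = {(c, c'). geodesic_ray c \<and> geodesic_ray c' \<and> (\<exists>K. \<forall>t\<ge>0. dist (c t) (c' t) \<le> K)}"

type_synonym 'a ideal_point = "(real \<Rightarrow> 'a) set"

definition visual_boundary :: "'a::metric_space ideal_point set" where
  "visual_boundary = {c. geodesic_ray c} // asymptotic"

text \<open>The bordification \<open>X \<union> \<partial>X\<close> is a set of elements of the sum type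
  \<open>'a + 'a ideal_point\<close>. The set \<open>cone_nbhd c r e\<close> consists of the points outside the closed
  \<open>r\<close>-ball about \<open>c 0\<close> whose projection to that ball is at distance less than \<open>e\<close>
  from \<open>c r\<close>; the projection is the point at distance \<open>r\<close> on the geodesic or ray from \<open>c 0\<close>.\<close>

definition cone_nbhd ::
    "(real \<Rightarrow> 'a::metric_space) \<Rightarrow> real \<Rightarrow> real \<Rightarrow> ('a + 'a ideal_point) set" where
  "cone_nbhd c r e =
     Inl ` {x. dist (c 0) x > r \<and> (\<exists>g. geodesic g (c 0) x \<and> dist (g r) (c r) < e)} \<union>
     Inr ` {u \<in> visual_boundary. \<exists>c'\<in>u. c' 0 = c 0 \<and> dist (c' r) (c r) < e}"

text \<open>All base points \<open>c 0\<close> are used, so that no base point has to be chosen; in a complete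
  CAT(0) space each of them gives the same topology.\<close>

definition cone_topology :: "('a::metric_space + 'a ideal_point) topology" where
  "cone_topology = topology_generated_by
     ({Inl ` ball x r | x r. r > 0} \<union>
      {cone_nbhd c r e | c r e. geodesic_ray c \<and> r > 0 \<and> e > 0})"

definition boundary_topology :: "'a::metric_space ideal_point topology" where
  "boundary_topology = pullback_topology visual_boundary Inr cone_topology"

text \<open>The angle at the vertex corresponding to \<open>p\<close> of a Euclidean comparison triangle for
  \<open>p\<close>, \<open>x\<close>, \<open>y\<close>, by the law of cosines; it is used only for \<open>x \<noteq> p\<close> and \<open>y \<noteq> p\<close>.\<close>

definition comparison_angle :: "'a::metric_space \<Rightarrow> 'a \<Rightarrow> 'a \<Rightarrow> real" where
  "comparison_angle p x y =
     arccos (((dist p x)\<^sup>2 + (dist p y)\<^sup>2 - (dist x y)\<^sup>2) / (2 * dist p x * dist p y))"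

text \<open>This is meant for geodesics with \<open>c 0 = c' 0\<close>.\<close>

definition Alexandrov_angle :: "(real \<Rightarrow> 'a::metric_space) \<Rightarrow> (real \<Rightarrow> 'a) \<Rightarrow> ereal" where
  "Alexandrov_angle c c' =
     Limsup (at_right 0 \<times>\<^sub>F at_right 0) (\<lambda>(s, t). ereal (comparison_angle (c 0) (c s) (c' t)))"

text \<open>In a complete CAT(0) space there is a ray from \<open>p\<close> in each asymptotic class, and it is unique
  on \<open>{0..}\<close>.\<close>

definition ray_from :: "'a::metric_space \<Rightarrow> 'a ideal_point \<Rightarrow> real \<Rightarrow> 'a" where
  "ray_from p u = (SOME c. c \<in> u \<and> c 0 = p)"

definition angle_at :: "'a::metric_space \<Rightarrow> 'a ideal_point \<Rightarrow> 'a ideal_point \<Rightarrow> ereal" where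
  "angle_at p u v = Alexandrov_angle (ray_from p u) (ray_from p v)"

definition angular_dist :: "'a::metric_space ideal_point \<Rightarrow> 'a ideal_point \<Rightarrow> ereal" where
  "angular_dist u v = (SUP p. angle_at p u v)"

definition angular_path ::
    "(real \<Rightarrow> 'a::metric_space ideal_point) \<Rightarrow> 'a ideal_point \<Rightarrow> 'a ideal_point \<Rightarrow> bool" where
  "angular_path \<gamma> u v \<longleftrightarrow> \<gamma> ` {0..1} \<subseteq> visual_boundary \<and> \<gamma> 0 = u \<and> \<gamma> 1 = v \<and>
     (\<forall>t\<in>{0..1}. \<forall>e>0. \<exists>d>0. \<forall>s\<in>{0..1}. \<bar>s - t\<bar> < d \<longrightarrow> angular_dist (\<gamma> s) (\<gamma> t) < ereal e)"

definition angular_length :: "(real \<Rightarrow> 'a::metric_space ideal_point) \<Rightarrow> ereal" where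
  "angular_length \<gamma> =
     Sup {\<Sum>i<n. angular_dist (\<gamma> (t i)) (\<gamma> (t (Suc i))) | (n::nat) t.
            t 0 = 0 \<and> t n = 1 \<and> mono_on {..n} t}"

text \<open>The infimum is \<open>\<infinity>\<close> if there is no path from \<open>u\<close> to \<open>v\<close>.\<close>

definition Tits_dist :: "'a::metric_space ideal_point \<Rightarrow> 'a ideal_point \<Rightarrow> ereal" where
  "Tits_dist u v = (INF \<gamma>\<in>{\<gamma>. angular_path \<gamma> u v}. angular_length \<gamma>)"

definition Tits_ball :: "'a::metric_space ideal_point \<Rightarrow> ereal \<Rightarrow> 'a ideal_point set" where
  "Tits_ball u r = {v \<in> visual_boundary. Tits_dist u v < r}"

definition Tits_cball :: "'a::metric_space ideal_point \<Rightarrow> ereal \<Rightarrow> 'a ideal_point set" where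
  "Tits_cball u r = {v \<in> visual_boundary. Tits_dist u v \<le> r}"

definition Tits_radius :: "'a::metric_space ideal_point set \<Rightarrow> ereal" where
  "Tits_radius A = Inf {r. \<exists>u\<in>visual_boundary. A \<subseteq> Tits_ball u r}"

definition isometry :: "('a::metric_space \<Rightarrow> 'a) \<Rightarrow> bool" where
  "isometry h \<longleftrightarrow> surj h \<and> (\<forall>x y. dist (h x) (h y) = dist x y)"

definition parabolic :: "('a::metric_space \<Rightarrow> 'a) \<Rightarrow> bool" where
  "parabolic h \<longleftrightarrow> isometry h \<and> \<not> (\<exists>x. dist x (h x) = (INF y. dist y (h y)))"

definition boundary_map :: "('a::metric_space \<Rightarrow> 'a) \<Rightarrow> 'a ideal_point \<Rightarrow> 'a ideal_point" where
  "boundary_map h u = (\<lambda>c. h \<circ> c) ` u"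

definition limit_set :: "'a::metric_space ideal_point set" where
  "limit_set = {p \<in> visual_boundary.
     \<exists>(g :: nat \<Rightarrow> 'a \<Rightarrow> 'a). \<exists>n\<in>visual_boundary. (\<forall>i. isometry (g i)) \<and>
       (\<forall>x. limitin cone_topology (\<lambda>i. Inl (g i x)) (Inr p) sequentially \<and>
            limitin cone_topology (\<lambda>i. Inl (inv (g i) x)) (Inr n) sequentially)}"

definition int_funpow :: "('a \<Rightarrow> 'a) \<Rightarrow> int \<Rightarrow> 'a \<Rightarrow> 'a" where
  "int_funpow h i = (if i \<ge> 0 then h ^^ nat i else inv h ^^ nat (- i))"

text \<open>The first conjunct says that the cyclic group generated by \<open>h\<close> acts on \<open>\<Omega>\<close> at all.\<close>

definition acts_properly_discontinuously ::
    "('a::metric_space \<Rightarrow> 'a) \<Rightarrow> 'a ideal_point set \<Rightarrow> bool" where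
  "acts_properly_discontinuously h \<Omega> \<longleftrightarrow>
     (\<forall>i. boundary_map (int_funpow h i) ` \<Omega> = \<Omega>) \<and>
     (\<forall>K. compactin boundary_topology K \<and> K \<subseteq> \<Omega> \<longrightarrow>
        finite {i. boundary_map (int_funpow h i) ` K \<inter> K \<noteq> {}})"

end

theory Submission
  imports Defs "HOL-Library.Diagonal_Subsequence"
begin

text \<open>The angle between ideal points is the limit of Euclidean comparison angles along rays from a
  common origin. Between ideal points at angle less than \<open>\<pi>\<close> repeated bisection gives a path of that
  angular length, so an angle of at most \<open>\<pi> / 2\<close> bounds the Tits distance, and a Tits distance larger
  than \<open>\<pi>\<close> forces the angle \<open>\<pi>\<close>. Bisecting nearly shortest paths at angle \<open>\<pi> / 2\<close> shows that the closed
  Tits ball of radius \<open>\<pi>\<close> is closed for the cone topology.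

  The point \<open>m\<close> is the limit of the points closest to an origin in the sublevel sets of the displacement
  function; the orbits of \<open>h\<close> stay in horospheres at \<open>m\<close>, so their limit points \<open>P\<close> and \<open>N\<close> are at Tits
  distance at most \<open>\<pi> / 2\<close> from \<open>m\<close>. If \<open>g i\<close> maps the origin towards \<open>q\<close> and \<open>inv (g i)\<close> maps it
  towards \<open>n\<close>, then limits \<open>w\<close> of \<open>g i (u i)\<close> with \<open>u i\<close> tending to \<open>u\<close> satisfy
  \<open>angle w q \<le> \<pi> - angle u n\<close>. Applied to powers of \<open>h\<close> this is proper discontinuity.

  For density, suppose that an open \<open>U\<close> lies in the ball about \<open>m\<close> and let \<open>g i\<close> contract towards a point
  of \<open>U\<close>, with repelling point \<open>n\<close>. Moving a point far from \<open>n\<close> into \<open>U\<close> shows that some translate \<open>\<gamma> P\<close>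
  is farther than \<open>\<pi>\<close> from \<open>n\<close>, so \<open>\<eta> P \<in> U\<close> for some \<open>\<eta> = g i \<circ> \<gamma>\<close>. But \<open>P\<close> is a limit of points
  \<open>h^j z\<close> at distance more than \<open>3 \<pi>\<close> from \<open>m\<close>, whereas \<open>\<eta> m\<close> is within \<open>\<pi> / 2 + \<pi> + \<pi>\<close> of every
  point of \<open>U\<close>.\<close>

section \<open>CAT(0) inequalities\<close>

text \<open>Lengths of paths do not pass to limits in the cone topology, whereas the angle does,
  from one side: its cosine is an infimum of comparison cosines, each depending continuously on the
  rays. Angles bound Tits distances only below \<pi>, so the recurrent form of an estimate is
  \<open>0 \<le> ideal_cos u v\<close>, which survives limits and costs \<pi>/2; the distance \<pi>
  appears as two such steps.

  In the density argument the obstacle is that the repelling point \<open>n\<close> is arbitrary: it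
  may lie within \<pi> of \<open>P\<close>, and then nothing forces \<open>g i\<close> to move
  \<open>P\<close> into \<open>U\<close>. The remedy is an isometry \<gamma> taking some point of
  \<open>U\<close> to a point \<open>z0\<close> at distance more than 3\<pi> from \<open>n\<close>.
  Points of \<open>U\<close> are within \<pi> of \<open>m\<close>, and \<open>P\<close> is within
  \<pi>/2 of \<open>m\<close>, so \<gamma> carries \<open>P\<close> to within 3\<pi>/2 of
  \<open>z0\<close>, hence farther than \<pi> from \<open>n\<close>. The points \<open>P\<close> and
  \<open>N\<close> exist because a parabolic orbit leaves every ball; otherwise there would be a
  fixed point and the displacement would attain 0.\<close>

definition unit_speed :: "(real \<Rightarrow> 'a::metric_space) \<Rightarrow> real \<Rightarrow> bool" where
  "unit_speed g L \<longleftrightarrow> (\<forall>s\<in>{0..L}. \<forall>t\<in>{0..L}. dist (g s) (g t) = \<bar>s - t\<bar>)"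

lemma unit_speedD: "unit_speed g L \<Longrightarrow> 0 \<le> s \<Longrightarrow> s \<le> L \<Longrightarrow> 0 \<le> t \<Longrightarrow> t \<le> L \<Longrightarrow> dist (g s) (g t) = \<bar>s - t\<bar>"
  by (simp add: unit_speed_def)

lemma unit_speed_mono: "unit_speed g L \<Longrightarrow> M \<le> L \<Longrightarrow> unit_speed g M"
  by (simp add: unit_speed_def)

lemma unit_speed_dist0: "unit_speed g L \<Longrightarrow> 0 \<le> t \<Longrightarrow> t \<le> L \<Longrightarrow> dist (g 0) (g t) = t"
  by (simp add: unit_speedD)

lemma geodesic_ray_unit_speed: "geodesic_ray c \<Longrightarrow> unit_speed c L"
  by (simp add: unit_speed_def geodesic_ray_def)

lemma geodesic_rayD: "geodesic_ray c \<Longrightarrow> 0 \<le> s \<Longrightarrow> 0 \<le> t \<Longrightarrow> dist (c s) (c t) = \<bar>s - t\<bar>"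
  by (simp add: geodesic_ray_def)

lemma geodesic_ray_dist0: "geodesic_ray c \<Longrightarrow> 0 \<le> t \<Longrightarrow> dist (c 0) (c t) = t"
  by (simp add: geodesic_ray_def)

lemma geodesic_ray_shift: "geodesic_ray c \<Longrightarrow> 0 \<le> a \<Longrightarrow> geodesic_ray (\<lambda>t. c (a + t))"
  by (simp add: geodesic_ray_def)

lemma geodesic_iff: "geodesic g x y \<longleftrightarrow> unit_speed g (dist x y) \<and> g 0 = x \<and> g (dist x y) = y"
  by (auto simp: geodesic_def unit_speed_def)

lemma unit_speed_geodesic: "unit_speed g L \<Longrightarrow> 0 \<le> L \<Longrightarrow> geodesic g (g 0) (g L)"
  by (simp add: geodesic_iff unit_speed_dist0)

lemma geodesicD:
  assumes "geodesic g x y"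
  shows "unit_speed g (dist x y)" "g 0 = x" "g (dist x y) = y"
  using assms by (auto simp: geodesic_iff)

lemma unit_speed_reverse: "unit_speed g L \<Longrightarrow> unit_speed (\<lambda>t. g (L - t)) L"
  by (simp add: unit_speed_def abs_minus_commute)

text \<open>\<open>q\<close> is put on the first axis, and the law of cosines gives the first
  coordinate of \<open>r\<close>; as this divides by \<open>a\<close>, the degenerate case is
  separate.\<close>

lemma comparison_triangle:
  fixes a b c :: real
  assumes "0 \<le> a" "0 \<le> b" "a \<le> b + c" "b \<le> a + c" "c \<le> a + b"
  obtains q r :: "real^2" where "norm q = a" "norm r = b" "dist q r = c"
proof (cases "a = 0")
  case True
  with assms have "c = b" by simp
  show ?thesis
  proof (rule that)
    show "norm (0::real^2) = a" using True by simp
    show "norm (axis 1 b :: real^2) = b" using assms by (simp add: norm_eq_sqrt_inner inner_axis_axis flip: power2_eq_square)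
    show "dist 0 (axis 1 b :: real^2) = c" using assms \<open>c = b\<close> by (simp add: norm_eq_sqrt_inner inner_axis_axis flip: power2_eq_square)
  qed
next
  case False
  with assms have a: "a > 0" by simp
  define x where "x = (a\<^sup>2 + b\<^sup>2 - c\<^sup>2) / (2 * a)"
  have x: "2 * a * x = a\<^sup>2 + b\<^sup>2 - c\<^sup>2" using a by (simp add: x_def)
  have c0: "c \<ge> 0" using assms by linarith
  have le: "x\<^sup>2 \<le> b\<^sup>2"
  proof -
    have "c\<^sup>2 \<le> (a + b)\<^sup>2" using assms c0 by (intro power_mono) auto
    moreover have "(a - b)\<^sup>2 \<le> c\<^sup>2"
      using assms by (intro abs_le_square_iff[THEN iffD1]) auto
    ultimately have "\<bar>2 * a * x\<bar> \<le> 2 * a * b"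
      unfolding x by (simp add: power2_eq_square algebra_simps abs_le_iff)
    hence "\<bar>x\<bar> \<le> b" using a by (simp add: abs_mult)
    thus ?thesis by (metis abs_le_square_iff abs_of_nonneg assms(2))
  qed
  define r :: "real^2" where "r = vector [x, sqrt (b\<^sup>2 - x\<^sup>2)]"
  define q :: "real^2" where "q = vector [a, 0]"
  show ?thesis
  proof (rule that)
    show "norm q = a" using a by (simp add: q_def norm_eq_sqrt_inner inner_vec_def sum_2)
    show "norm r = b" using assms le
      by (simp add: r_def norm_eq_sqrt_inner inner_vec_def sum_2 flip: power2_eq_square)
    have "(a - x)\<^sup>2 + (b\<^sup>2 - x\<^sup>2) = c\<^sup>2"
      using x by (simp add: power2_eq_square algebra_simps)
    thus "dist q r = c" using le c0
      by (simp add: r_def q_def dist_norm norm_eq_sqrt_inner inner_vec_def sum_2 flip: power2_eq_square)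
  qed
qed

locale proper_CAT0 =
  fixes X :: "'a::metric_space itself"
  assumes proper: "proper_space X"
    and CAT0: "CAT0_space X"
begin

lemma compact_cball: "compact (cball (x::'a) r)"
  using proper by (simp add: proper_space_def)

lemma geodesic_exists: "\<exists>g. geodesic g (x::'a) y"
  using CAT0 by (simp add: CAT0_space_def)

lemma bounded_subseq:
  fixes f :: "nat \<Rightarrow> 'a"
  assumes "\<And>n. dist x (f n) \<le> R"
  obtains l r where "strict_mono (r :: nat \<Rightarrow> nat)" "(f \<circ> r) \<longlonglongrightarrow> l"
proof -
  have "seq_compact (cball x R)" using compact_cball compact_imp_seq_compact by blast
  with assms that show ?thesis unfolding seq_compact_def by (metis mem_cball)
qed

lemma Cauchy_convergent:
  fixes f :: "nat \<Rightarrow> 'a"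
  assumes "Cauchy f"
  obtains l where "f \<longlonglongrightarrow> l"
proof -
  obtain x R where "\<And>n. dist x (f n) \<le> R"
    using cauchy_imp_bounded[OF assms] unfolding bounded_def by blast
  with bounded_subseq obtain l r where "strict_mono (r :: nat \<Rightarrow> nat)" "(f \<circ> r) \<longlonglongrightarrow> l" by metis
  with assms that show ?thesis by (metis Cauchy_converges_subseq)
qed

text \<open>The right-hand side is the squared Euclidean distance of the comparison points, with the
  inner product eliminated by the law of cosines. The comparison condition enters all later
  arguments through this algebraic form.\<close>

lemma hinge:
  fixes g k :: "real \<Rightarrow> 'a"
  assumes g: "unit_speed g S" and k: "unit_speed k T" and gk: "g 0 = k 0"
    and S: "0 \<le> S" and T: "0 \<le> T"
    and l: "0 \<le> l" "l \<le> 1" and m: "0 \<le> m" "m \<le> 1"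
  shows "(dist (g (l * S)) (k (m * T)))\<^sup>2
    \<le> l\<^sup>2 * S\<^sup>2 + m\<^sup>2 * T\<^sup>2 - l * m * (S\<^sup>2 + T\<^sup>2 - (dist (g S) (k T))\<^sup>2)"
proof -
  have gS: "dist (g 0) (g S) = S" and kT: "dist (g 0) (k T) = T"
    using unit_speed_dist0[OF g S] unit_speed_dist0[OF k T] gk by auto
  let ?D = "dist (g S) (k T)"
  have "S \<le> T + ?D" "T \<le> S + ?D" "?D \<le> S + T"
    using dist_triangle[of "g 0" "g S" "k T"] dist_triangle[of "g 0" "k T" "g S"]
      dist_triangle[of "g S" "k T" "g 0"] gS kT by (auto simp: dist_commute)
  then obtain q r :: "real^2" where q: "norm q = S" and r: "norm r = T" and qr: "dist q r = ?D"
    using comparison_triangle S T by metis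
  have "dist (g (dist 0 (l *\<^sub>R q))) (k (dist 0 (m *\<^sub>R r))) \<le> dist (l *\<^sub>R q) (m *\<^sub>R r)"
  proof -
    have "geodesic g (g 0) (g S)" "geodesic k (g 0) (k T)"
      using unit_speed_geodesic g k S T gk by metis+
    moreover have "l *\<^sub>R q \<in> closed_segment 0 q" "m *\<^sub>R r \<in> closed_segment 0 r"
      using l m by (auto simp: in_segment)
    moreover have "dist 0 q = dist (g 0) (g S)" "dist 0 r = dist (g 0) (k T)"
      using q r gS kT by auto
    ultimately show ?thesis using CAT0 qr unfolding CAT0_space_def by blast
  qed
  hence "dist (g (l * S)) (k (m * T)) \<le> dist (l *\<^sub>R q) (m *\<^sub>R r)"
    using q r l m by simp
  hence "(dist (g (l * S)) (k (m * T)))\<^sup>2 \<le> (dist (l *\<^sub>R q) (m *\<^sub>R r))\<^sup>2"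
    by (intro power_mono) auto
  also have "\<dots> = l\<^sup>2 * S\<^sup>2 + m\<^sup>2 * T\<^sup>2 - 2 * l * m * (q \<bullet> r)"
  proof -
    have "q \<bullet> q = S\<^sup>2" "r \<bullet> r = T\<^sup>2" using q r by (auto simp flip: power2_norm_eq_inner)
    thus ?thesis unfolding dist_norm power2_norm_eq_inner
      by (simp add: algebra_simps inner_commute power2_eq_square)
  qed
  also have "2 * (q \<bullet> r) = S\<^sup>2 + T\<^sup>2 - ?D\<^sup>2"
  proof -
    have "q \<bullet> q = S\<^sup>2" "r \<bullet> r = T\<^sup>2" using q r by (auto simp flip: power2_norm_eq_inner)
    moreover have "?D\<^sup>2 = q \<bullet> q + r \<bullet> r - 2 * (q \<bullet> r)"
      unfolding qr[symmetric] dist_norm power2_norm_eq_inner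
      by (simp add: algebra_simps inner_commute)
    ultimately show ?thesis by simp
  qed
  hence "2 * l * m * (q \<bullet> r) = l * m * (S\<^sup>2 + T\<^sup>2 - ?D\<^sup>2)" by (metis mult.assoc mult.commute)
  finally show ?thesis .
qed


text \<open>The hinge inequality with \<open>l = m\<close>: shrinking two sides by the same factor
  shrinks the third side at least as much.\<close>

lemma same_origin_contraction:
  fixes g k :: "real \<Rightarrow> 'a"
  assumes g: "unit_speed g L" and k: "unit_speed k L" and "g 0 = k 0" "0 \<le> t" "t \<le> L" "0 < L"
  shows "dist (g t) (k t) \<le> t / L * dist (g L) (k L)"
proof -
  have "(dist (g (t / L * L)) (k (t / L * L)))\<^sup>2 \<le> (t / L)\<^sup>2 * L\<^sup>2 + (t / L)\<^sup>2 * L\<^sup>2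
      - t / L * (t / L) * (L\<^sup>2 + L\<^sup>2 - (dist (g L) (k L))\<^sup>2)"
    using assms by (intro hinge) auto
  also have "\<dots> = (t / L * dist (g L) (k L))\<^sup>2"
    by (simp add: power2_eq_square algebra_simps)
  finally show ?thesis using assms by (simp add: power2_le_iff_abs_le)
qed

lemma geodesic_unique:
  fixes g k :: "real \<Rightarrow> 'a"
  assumes "geodesic g x y" "geodesic k x y" "0 \<le> t" "t \<le> dist x y"
  shows "g t = k t"
proof (cases "dist x y = 0")
  case True
  with assms show ?thesis by (auto simp: geodesic_iff)
next
  case False
  with same_origin_contraction[of g "dist x y" k t] assms show ?thesis
    by (auto simp: geodesic_iff)
qed

text \<open>The hinge inequality at the vertex \<open>g 0\<close>, with the second side running all
  the way to \<open>x\<close>; in the plane this is Stewart's theorem.\<close>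

lemma CN_inequality:
  fixes g :: "real \<Rightarrow> 'a"
  assumes g: "unit_speed g L" and "0 \<le> L" "0 \<le> l" "l \<le> 1"
  shows "(dist x (g (l * L)))\<^sup>2 \<le> (1 - l) * (dist x (g 0))\<^sup>2 + l * (dist x (g L))\<^sup>2 - l * (1 - l) * L\<^sup>2"
proof -
  obtain k where "geodesic k (g 0) x" using geodesic_exists by blast
  note k = geodesicD[OF this]
  have "(dist (g (l * L)) (k (1 * dist (g 0) x)))\<^sup>2 \<le> l\<^sup>2 * L\<^sup>2 + 1\<^sup>2 * (dist (g 0) x)\<^sup>2
      - l * 1 * (L\<^sup>2 + (dist (g 0) x)\<^sup>2 - (dist (g L) (k (dist (g 0) x)))\<^sup>2)"
    using assms k by (intro hinge) auto
  thus ?thesis using k by (simp add: dist_commute power2_eq_square algebra_simps)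
qed

lemma CN_midpoint:
  fixes g :: "real \<Rightarrow> 'a"
  assumes g: "unit_speed g L" and "0 \<le> L"
  shows "(dist x (g (L / 2)))\<^sup>2 \<le> ((dist x (g 0))\<^sup>2 + (dist x (g L))\<^sup>2) / 2 - L\<^sup>2 / 4"
  using CN_inequality[OF assms, of "1/2" x] by (simp add: algebra_simps)

text \<open>Both \<open>a\<close> and \<open>c\<close> are compared with the midpoint of
  \<open>b\<close> and \<open>d\<close>; the triangle inequality through it recovers the other
  diagonal.\<close>

lemma quadrilateral:
  fixes a b c d :: 'a
  shows "(dist a c)\<^sup>2 + (dist b d)\<^sup>2 \<le> (dist a b)\<^sup>2 + (dist b c)\<^sup>2 + (dist c d)\<^sup>2 + (dist d a)\<^sup>2"
proof -
  obtain g where "geodesic g b d" using geodesic_exists by blast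
  note g = geodesicD[OF this]
  define m where "m = g (dist b d / 2)"
  have am: "(dist a m)\<^sup>2 \<le> ((dist a b)\<^sup>2 + (dist d a)\<^sup>2) / 2 - (dist b d)\<^sup>2 / 4"
    and cm: "(dist c m)\<^sup>2 \<le> ((dist b c)\<^sup>2 + (dist c d)\<^sup>2) / 2 - (dist b d)\<^sup>2 / 4"
    using CN_midpoint[OF g(1), of a] CN_midpoint[OF g(1), of c] g by (simp_all add: dist_commute m_def)
  have "(dist a c)\<^sup>2 \<le> (dist a m + dist c m)\<^sup>2"
    by (intro power_mono dist_triangle2) auto
  also have "\<dots> \<le> 2 * (dist a m)\<^sup>2 + 2 * (dist c m)\<^sup>2"
    using sum_squares_bound[of "dist a m" "dist c m"] by (simp add: power2_sum)
  finally show ?thesis using am cm by (simp add: field_simps)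
qed

text \<open>A diagonal splits the quadrilateral into two triangles, and each is shrunk by the hinge
  inequality; the second one is traversed backwards, so that its common vertex is
  \<open>k M\<close>.\<close>

lemma convex_dist:
  fixes g k :: "real \<Rightarrow> 'a"
  assumes g: "unit_speed g L" and k: "unit_speed k M" and "0 \<le> L" "0 \<le> M" "0 \<le> l" "l \<le> 1"
  shows "dist (g (l * L)) (k (l * M)) \<le> (1 - l) * dist (g 0) (k 0) + l * dist (g L) (k M)"
proof -
  obtain e where "geodesic e (g 0) (k M)" using geodesic_exists by blast
  note e = geodesicD[OF this]
  let ?E = "dist (g 0) (k M)"
  have "(dist (g (l * L)) (e (l * ?E)))\<^sup>2 \<le> l\<^sup>2 * L\<^sup>2 + l\<^sup>2 * ?E\<^sup>2 - l * l * (L\<^sup>2 + ?E\<^sup>2 - (dist (g L) (e ?E))\<^sup>2)"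
    using assms e by (intro hinge) auto
  hence "(dist (g (l * L)) (e (l * ?E)))\<^sup>2 \<le> (l * dist (g L) (e ?E))\<^sup>2"
    by (simp add: power2_eq_square algebra_simps)
  hence 1: "dist (g (l * L)) (e (l * ?E)) \<le> l * dist (g L) (k M)"
    using assms e by (simp add: power2_le_iff_abs_le)
  let ?e = "\<lambda>t. e (?E - t)" and ?k = "\<lambda>t. k (M - t)"
  have "(dist (?e ((1 - l) * ?E)) (?k ((1 - l) * M)))\<^sup>2 \<le> (1 - l)\<^sup>2 * ?E\<^sup>2 + (1 - l)\<^sup>2 * M\<^sup>2
     - (1 - l) * (1 - l) * (?E\<^sup>2 + M\<^sup>2 - (dist (?e ?E) (?k M))\<^sup>2)"
    using assms e by (intro hinge unit_speed_reverse) auto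
  also have "\<dots> = ((1 - l) * dist (g 0) (k 0))\<^sup>2"
    using e by (simp add: power2_eq_square algebra_simps)
  finally have "(dist (e (l * ?E)) (k (l * M)))\<^sup>2 \<le> ((1 - l) * dist (g 0) (k 0))\<^sup>2"
    by (simp add: algebra_simps)
  hence 2: "dist (e (l * ?E)) (k (l * M)) \<le> (1 - l) * dist (g 0) (k 0)"
    using assms by (simp add: power2_le_iff_abs_le)
  show ?thesis using 1 2 dist_triangle[of "g (l * L)" "k (l * M)" "e (l * ?E)"] by linarith
qed

text \<open>A bounded convex function on a half-line is nonincreasing: in the convexity estimate on
  an interval of length \<open>L\<close> the bound \<open>K\<close> has weight \<open>t / L\<close>,
  which tends to 0.\<close>

lemma asymptotic_dist_le:
  fixes c c' :: "real \<Rightarrow> 'a"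
  assumes "geodesic_ray c" "geodesic_ray c'" and K: "\<And>t. t \<ge> 0 \<Longrightarrow> dist (c t) (c' t) \<le> K" and t: "t \<ge> 0"
  shows "dist (c t) (c' t) \<le> dist (c 0) (c' 0)"
proof -
  have "eventually (\<lambda>L. dist (c t) (c' t) \<le> (1 - t / L) * dist (c 0) (c' 0) + t / L * K) at_top"
    using eventually_ge_at_top[of "max t 1"]
  proof eventually_elim
    case (elim L)
    have "dist (c (t / L * L)) (c' (t / L * L)) \<le> (1 - t / L) * dist (c 0) (c' 0) + t / L * dist (c L) (c' L)"
      using assms elim by (intro convex_dist geodesic_ray_unit_speed) auto
    also have "t / L * dist (c L) (c' L) \<le> t / L * K"
      using elim t by (intro mult_left_mono K) auto
    finally show ?case using elim by simp
  qed
  moreover have "((\<lambda>L. (1 - t / L) * dist (c 0) (c' 0) + t / L * K) \<longlongrightarrow> (1 - 0) * dist (c 0) (c' 0) + 0 * K) at_top"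
    by (intro tendsto_intros tendsto_divide_0[OF tendsto_const] filterlim_at_top_imp_at_infinity filterlim_ident)
  ultimately show ?thesis by (intro tendsto_lowerbound) auto
qed

end

section \<open>Rays and ideal points\<close>

lemma LIMSEQ_subsubseq:
  fixes f :: "nat \<Rightarrow> 'b::topological_space"
  assumes "\<And>r. strict_mono (r :: nat \<Rightarrow> nat) \<Longrightarrow> \<exists>r'. strict_mono (r' :: nat \<Rightarrow> nat) \<and> (f \<circ> r \<circ> r') \<longlonglongrightarrow> l"
  shows "f \<longlonglongrightarrow> l"
proof (rule ccontr)
  assume "\<not> f \<longlonglongrightarrow> l"
  then obtain S where S: "open S" "l \<in> S" "\<not> eventually (\<lambda>n. f n \<in> S) sequentially"
    unfolding tendsto_def by blast
  hence inf: "infinite {n. f n \<notin> S}"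
    by (simp add: INFM_iff_infinite[symmetric] not_eventually cofinite_eq_sequentially)
  define r where "r = enumerate {n. f n \<notin> S}"
  have r: "strict_mono r" unfolding r_def using strict_mono_enumerate inf by blast
  have "f (r n) \<notin> S" for n using enumerate_in_set[OF inf] by (auto simp: r_def)
  moreover obtain r' where "strict_mono (r' :: nat \<Rightarrow> nat)" "(f \<circ> r \<circ> r') \<longlonglongrightarrow> l" using assms r by blast
  hence "eventually (\<lambda>n. (f \<circ> r \<circ> r') n \<in> S) sequentially"
    using S tendsto_def by blast
  ultimately show False by (simp add: eventually_sequentially)
qed

lemma filterlim_comp_strict_mono:
  "filterlim f F sequentially \<Longrightarrow> strict_mono (r :: nat \<Rightarrow> nat) \<Longrightarrow> filterlim (\<lambda>i. f (r i)) F sequentially"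
  using filterlim_compose filterlim_subseq by blast

context proper_CAT0
begin

text \<open>Arzela-Ascoli by hand: a diagonal subsequence converges at all integer times, and
  contraction towards the common origin transfers the Cauchy property to earlier times.\<close>

lemma limit_ray:
  fixes g :: "nat \<Rightarrow> real \<Rightarrow> 'a"
  assumes g0: "\<And>n. g n 0 = p" and g: "\<And>n. unit_speed (g n) (L n)"
    and L: "filterlim L at_top sequentially"
  obtains r c where "strict_mono (r :: nat \<Rightarrow> nat)" "geodesic_ray c" "c 0 = p"
    "\<And>t. t \<ge> 0 \<Longrightarrow> (\<lambda>i. g (r i) t) \<longlonglongrightarrow> c t"
proof -
  \<comment> \<open>The default \<open>p\<close> keeps the sequence bounded where \<open>g i\<close>
    is not controlled; for fixed \<open>n\<close> it occurs only finitely often, as \<open>L\<close>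
    tends to infinity.\<close>
  define f where "f n i = (if real n \<le> L i then g i (real n) else p)" for n i
  have f: "dist p (f n i) \<le> real n" for n i
    using unit_speed_dist0[OF g[of i], of "real n"] g0 by (auto simp: f_def)
  interpret subseqs "\<lambda>n s. convergent (\<lambda>i. f n (s i))"
  proof
    fix n and s :: "nat \<Rightarrow> nat"
    assume "strict_mono s"
    obtain l r' where "strict_mono (r' :: nat \<Rightarrow> nat)" "((\<lambda>i. f n (s i)) \<circ> r') \<longlonglongrightarrow> l"
      by (rule bounded_subseq[of p "\<lambda>i. f n (s i)" "real n"]) (use f in \<open>auto simp: o_def\<close>)
    thus "\<exists>r'. strict_mono r' \<and> convergent (\<lambda>i. f n ((s \<circ> r') i))"
      by (auto simp: o_def convergent_def)
  qed
  have "convergent (\<lambda>i. f n ((diagseq \<circ> (+) (Suc n)) i))" for n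
  proof (rule diagseq_holds)
    fix r s :: "nat \<Rightarrow> nat" and n
    assume "strict_mono r" "convergent (\<lambda>i. f n (s i))"
    thus "convergent (\<lambda>i. f n ((s \<circ> r) i))"
      using convergent_subseq_convergent[of "\<lambda>i. f n (s i)" r] by (simp add: o_def)
  qed
  \<comment> \<open>The diagonal argument controls only the tail from index \<open>Suc n\<close> on,
    and convergence ignores the terms before it.\<close>
  hence conv: "convergent (\<lambda>i. f n (diagseq i))" for n
    using convergent_ignore_initial_segment[of "\<lambda>i. f n (diagseq i)" "Suc n"]
    by (simp add: o_def add.commute[of _ n])
  have Ld: "filterlim (\<lambda>i. L (diagseq i)) at_top sequentially"
    using L subseq_diagseq by (rule filterlim_comp_strict_mono)
  have "convergent (\<lambda>i. g (diagseq i) t)" if t: "t \<ge> 0" for t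
  proof -
    obtain n :: nat where n: "t \<le> real n" "0 < real n"
      by (metis gt_ex less_le_trans max.bounded_iff order_less_imp_le real_arch_simple)
    have "Cauchy (\<lambda>i. g (diagseq i) t)"
    proof (rule metric_CauchyI)
      fix e :: real assume "e > 0"
      then obtain M where M: "\<And>i j. i \<ge> M \<Longrightarrow> j \<ge> M \<Longrightarrow> dist (f n (diagseq i)) (f n (diagseq j)) < e"
        using convergent_Cauchy[OF conv[of n]] metric_CauchyD by blast
      obtain M' where M': "\<And>i. i \<ge> M' \<Longrightarrow> L (diagseq i) \<ge> real n"
        using Ld unfolding filterlim_at_top eventually_sequentially by meson
      show "\<exists>M. \<forall>i\<ge>M. \<forall>j\<ge>M. dist (g (diagseq i) t) (g (diagseq j) t) < e"
      proof (intro exI allI impI)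
        fix i j assume ij: "i \<ge> max M M'" "j \<ge> max M M'"
        have "dist (g (diagseq i) t) (g (diagseq j) t)
          \<le> t / real n * dist (g (diagseq i) (real n)) (g (diagseq j) (real n))"
          using n t M' ij g0 by (intro same_origin_contraction unit_speed_mono[OF g]) auto
        also have "\<dots> \<le> 1 * dist (g (diagseq i) (real n)) (g (diagseq j) (real n))"
          using n t by (intro mult_right_mono) auto
        also have "\<dots> = dist (f n (diagseq i)) (f n (diagseq j))"
          using M' ij by (simp add: f_def)
        also have "\<dots> < e" using M ij by simp
        finally show "dist (g (diagseq i) t) (g (diagseq j) t) < e" .
      qed
    qed
    thus ?thesis by (rule Cauchy_convergent) (rule convergentI)
  qed
  moreover define c where "c t = lim (\<lambda>i. g (diagseq i) t)" for t
  ultimately have c: "(\<lambda>i. g (diagseq i) t) \<longlonglongrightarrow> c t" if "t \<ge> 0" for t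
    using that by (simp add: convergent_LIMSEQ_iff)
  show ?thesis
  proof (rule that[OF subseq_diagseq _ _ c])
    show "geodesic_ray c" unfolding geodesic_ray_def
    proof (intro allI impI)
      fix s t :: real assume st: "0 \<le> s" "0 \<le> t"
      have "eventually (\<lambda>i. dist (g (diagseq i) s) (g (diagseq i) t) = \<bar>s - t\<bar>) sequentially"
        using filterlim_at_top[THEN iffD1, OF Ld, rule_format, of "max s t"]
        by eventually_elim (use g st in \<open>auto intro!: unit_speedD\<close>)
      moreover have "(\<lambda>i. dist (g (diagseq i) s) (g (diagseq i) t)) \<longlonglongrightarrow> dist (c s) (c t)"
        using c st by (intro tendsto_intros) auto
      ultimately show "dist (c s) (c t) = \<bar>s - t\<bar>"
        by (rule LIMSEQ_unique[OF _ tendsto_eventually, rotated])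
    qed
    have "(\<lambda>i. g (diagseq i) 0) \<longlonglongrightarrow> p" using g0 by simp
    thus "c 0 = p" using c[of 0] LIMSEQ_unique by auto
  qed
qed

end

section \<open>Asymptotic classes and their rays\<close>

lemma equiv_asymptotic: "equiv {c :: real \<Rightarrow> 'a::metric_space. geodesic_ray c} asymptotic"
proof (rule equivI)
  show "refl_on {c :: real \<Rightarrow> 'a. geodesic_ray c} asymptotic"
    by (auto simp: refl_on_def asymptotic_def intro!: exI[of _ 0])
  show "sym (asymptotic :: ((real \<Rightarrow> 'a) \<times> _) set)"
    by (auto simp: sym_def asymptotic_def dist_commute)
  show "trans (asymptotic :: ((real \<Rightarrow> 'a) \<times> _) set)"
  proof (rule transI)
    fix x y z :: "real \<Rightarrow> 'a" assume "(x, y) \<in> asymptotic" "(y, z) \<in> asymptotic"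
    then obtain K K' where "geodesic_ray x" "geodesic_ray z"
      and K: "\<And>t. t \<ge> 0 \<Longrightarrow> dist (x t) (y t) \<le> K" and K': "\<And>t. t \<ge> 0 \<Longrightarrow> dist (y t) (z t) \<le> K'"
      by (auto simp: asymptotic_def)
    moreover have "dist (x t) (z t) \<le> K + K'" if "t \<ge> 0" for t
      using dist_triangle[of "x t" "z t" "y t"] K[OF that] K'[OF that] by linarith
    ultimately show "(x, z) \<in> asymptotic" by (auto simp: asymptotic_def)
  qed
qed (auto simp: asymptotic_def)

lemma boundary_ray: "u \<in> visual_boundary \<Longrightarrow> c \<in> u \<Longrightarrow> geodesic_ray c"
  using in_quotient_imp_subset[OF equiv_asymptotic] by (auto simp: visual_boundary_def)

lemma boundary_asymptotic:
  assumes "u \<in> visual_boundary" "c \<in> u" "c' \<in> u"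
  shows "(c, c') \<in> asymptotic"
  using assms quotient_eq_iff[OF equiv_asymptotic, of u u c c'] by (auto simp: visual_boundary_def)

lemma boundary_closed: "u \<in> visual_boundary \<Longrightarrow> c \<in> u \<Longrightarrow> (c, c') \<in> asymptotic \<Longrightarrow> c' \<in> u"
  using in_quotient_imp_closed[OF equiv_asymptotic] by (auto simp: visual_boundary_def)

lemma boundary_nonempty: "u \<in> visual_boundary \<Longrightarrow> \<exists>c. c \<in> u"
  using in_quotient_imp_non_empty[OF equiv_asymptotic] by (auto simp: visual_boundary_def)

lemma boundary_class:
  assumes "geodesic_ray c"
  shows "asymptotic `` {c} \<in> visual_boundary" "c \<in> asymptotic `` {c}"
  using assms equiv_class_self[OF equiv_asymptotic] by (auto simp: visual_boundary_def quotientI)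

lemma boundary_eqI:
  assumes "u \<in> visual_boundary" "v \<in> visual_boundary" "c \<in> u" "c' \<in> v" "(c, c') \<in> asymptotic"
  shows "u = v"
  using assms quotient_eqI[OF equiv_asymptotic] by (auto simp: visual_boundary_def)

context proper_CAT0
begin

lemma boundary_dist_le:
  fixes u :: "'a ideal_point"
  assumes "u \<in> visual_boundary" "c \<in> u" "c' \<in> u" "t \<ge> 0"
  shows "dist (c t) (c' t) \<le> dist (c 0) (c' 0)"
  using boundary_asymptotic[OF assms(1-3)] asymptotic_dist_le assms(4)
  by (auto simp: asymptotic_def)

lemma boundary_ray_unique:
  fixes u :: "'a ideal_point"
  assumes "u \<in> visual_boundary" "c \<in> u" "c' \<in> u" "c 0 = c' 0" "t \<ge> 0"
  shows "c t = c' t"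
  using boundary_dist_le[OF assms(1-3,5)] assms(4) by simp

text \<open>The ray is a limit of geodesics from \<open>p\<close> to points far out on
  \<open>c\<close>; convexity of the distance keeps these within \<open>2 * D\<close> of
  \<open>c\<close>, so the limit is asymptotic to \<open>c\<close>.\<close>

lemma ray_from_exists:
  fixes u :: "'a ideal_point"
  assumes u: "u \<in> visual_boundary"
  shows "\<exists>c. c \<in> u \<and> c 0 = p"
proof -
  obtain c where cu: "c \<in> u" using boundary_nonempty u by blast
  hence c: "geodesic_ray c" using boundary_ray u by blast
  define g where "g n = (SOME g. geodesic g p (c (real n)))" for n
  have "geodesic (g n) p (c (real n))" for n
    unfolding g_def using geodesic_exists by (rule someI_ex)
  note g = geodesicD[OF this]
  define D where "D = dist p (c 0)"
  have L: "\<bar>dist p (c (real n)) - real n\<bar> \<le> D" for n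
    using dist_triangle[of p "c (real n)" "c 0"] dist_triangle[of "c 0" "c (real n)" p]
      geodesic_ray_dist0[OF c, of "real n"] by (simp add: D_def dist_commute)
  hence "filterlim (\<lambda>n. dist p (c (real n))) at_top sequentially"
  proof -
    have "filterlim (\<lambda>n. - D + real n) at_top sequentially"
      by (intro filterlim_tendsto_add_at_top[OF tendsto_const] filterlim_real_sequentially)
    moreover have "- D + real n \<le> dist p (c (real n))" for n using L[of n] by linarith
    ultimately show ?thesis by (rule filterlim_at_top_mono[OF _ always_eventually[OF allI]])
  qed
  then obtain r c' where r: "strict_mono (r :: nat \<Rightarrow> nat)" and c': "geodesic_ray c'" "c' 0 = p"
    and lim: "\<And>t. t \<ge> 0 \<Longrightarrow> (\<lambda>i. g (r i) t) \<longlonglongrightarrow> c' t"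
    using limit_ray[of g p "\<lambda>n. dist p (c (real n))"] g by metis
  \<comment> \<open>Convexity compares points at proportional parameters. The two lengths differ by
    at most \<open>D\<close>, so passing to equal parameters costs a second
    \<open>D\<close>.\<close>
  have near: "dist (g n t) (c t) \<le> 2 * D" if t: "t \<ge> 0" "t \<le> dist p (c (real n))" "0 < real n" for n t
  proof -
    define E where "E = dist p (c (real n))"
    show ?thesis
    proof (cases "E = 0")
      case True
      with t have "t = 0" by (simp add: E_def)
      thus ?thesis using g by (simp add: D_def)
    next
      case False
      hence E: "E > 0" by (simp add: E_def)
      define l where "l = t / E"
      have l: "0 \<le> l" "l \<le> 1" "l * E = t" using E t by (auto simp: l_def E_def)
      have "dist (g n (l * E)) (c (l * real n)) \<le> (1 - l) * dist (g n 0) (c 0) + l * dist (g n E) (c (real n))"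
        using E l g(1)[of n] geodesic_ray_unit_speed[OF c] by (intro convex_dist) (auto simp: E_def)
      also have "\<dots> \<le> 1 * D"
        using g l by (simp add: D_def E_def mult_left_le_one_le)
      finally have 1: "dist (g n t) (c (l * real n)) \<le> D" using l by simp
      have "dist (c (l * real n)) (c t) = \<bar>l * real n - l * E\<bar>"
        using geodesic_rayD[OF c] l t by simp
      also have "\<dots> = \<bar>l * (real n - E)\<bar>" by (simp only: right_diff_distrib)
      also have "\<dots> = l * \<bar>E - real n\<bar>" using l by (simp add: abs_mult abs_minus_commute)
      also have "\<dots> \<le> 1 * D" using L[of n] l by (intro mult_mono) (auto simp: E_def)
      finally show ?thesis using 1 dist_triangle[of "g n t" "c t" "c (l * real n)"] by linarith
    qed
  qed
  have "dist (c t) (c' t) \<le> 2 * D" if t: "t \<ge> 0" for t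
  proof -
    have "eventually (\<lambda>i. dist p (c (real (r i))) \<ge> t) sequentially"
      using filterlim_comp_strict_mono[OF \<open>filterlim (\<lambda>n. dist p (c (real n))) at_top sequentially\<close> r]
      unfolding filterlim_at_top by blast
    moreover have "eventually (\<lambda>i. i > (0::nat)) sequentially" by (rule eventually_gt_at_top)
    ultimately have "eventually (\<lambda>i. dist (g (r i) t) (c t) \<le> 2 * D) sequentially"
    proof eventually_elim
      case (elim i)
      moreover have "i \<le> r i" using r by (rule strict_mono_imp_increasing)
      ultimately show ?case using near t by simp
    qed
    moreover have "(\<lambda>i. dist (g (r i) t) (c t)) \<longlonglongrightarrow> dist (c' t) (c t)"
      using lim t by (intro tendsto_intros) auto
    ultimately show ?thesis by (simp add: tendsto_upperbound dist_commute)
  qed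
  hence "(c, c') \<in> asymptotic" using c c' by (auto simp: asymptotic_def)
  thus ?thesis using boundary_closed u cu c' by blast
qed

lemma ray_from:
  fixes u :: "'a ideal_point"
  assumes "u \<in> visual_boundary"
  shows ray_from_in: "ray_from p u \<in> u" and ray_from_0: "ray_from p u 0 = p"
    and ray_from_ray: "geodesic_ray (ray_from p u)"
proof -
  show "ray_from p u \<in> u" and "ray_from p u 0 = p"
    using someI_ex[OF ray_from_exists[OF assms, of p]] by (auto simp: ray_from_def)
  thus "geodesic_ray (ray_from p u)" using boundary_ray assms by blast
qed

lemma ray_from_eq:
  fixes u :: "'a ideal_point"
  assumes "u \<in> visual_boundary" "c \<in> u" "t \<ge> 0"
  shows "ray_from (c 0) u t = c t"
  by (rule boundary_ray_unique[OF assms(1) ray_from_in[OF assms(1)] assms(2) ray_from_0[OF assms(1)] assms(3)])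

lemma ray_from_dist_le:
  fixes u :: "'a ideal_point"
  assumes "u \<in> visual_boundary" "t \<ge> 0"
  shows "dist (ray_from p u t) (ray_from q u t) \<le> dist p q"
  using boundary_dist_le[of u "ray_from p u" "ray_from q u" t] assms ray_from by auto

text \<open>Sequential convergence in the cone topology of the boundary. Demanding it for every
  origin makes changes of base point immediate; by \<open>ideal_tendstoI\<close> one origin
  suffices.\<close>

definition ideal_tendsto :: "(nat \<Rightarrow> 'a ideal_point) \<Rightarrow> 'a ideal_point \<Rightarrow> bool" where
  "ideal_tendsto w u \<longleftrightarrow> range w \<subseteq> visual_boundary \<and> u \<in> visual_boundary \<and>
     (\<forall>p. \<forall>t\<ge>0. (\<lambda>i. ray_from p (w i) t) \<longlonglongrightarrow> ray_from p u t)"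

lemma ideal_tendstoD:
  assumes "ideal_tendsto w u"
  shows "w i \<in> visual_boundary" "u \<in> visual_boundary"
    "t \<ge> 0 \<Longrightarrow> (\<lambda>i. ray_from p (w i) t) \<longlonglongrightarrow> ray_from p u t"
  using assms by (auto simp: ideal_tendsto_def)

lemma rays_subseq:
  fixes w :: "nat \<Rightarrow> 'a ideal_point"
  assumes "\<And>i. w i \<in> visual_boundary"
  obtains r u where "strict_mono (r :: nat \<Rightarrow> nat)" "u \<in> visual_boundary"
    "\<And>t. t \<ge> 0 \<Longrightarrow> (\<lambda>i. ray_from p (w (r i)) t) \<longlonglongrightarrow> ray_from p u t"
proof -
  obtain r c where r: "strict_mono (r :: nat \<Rightarrow> nat)" and c: "geodesic_ray c" "c 0 = p"
    and lim: "\<And>t. t \<ge> 0 \<Longrightarrow> (\<lambda>i. ray_from p (w (r i)) t) \<longlonglongrightarrow> c t"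
    by (rule limit_ray[of "\<lambda>i. ray_from p (w i)" p real])
      (use assms ray_from filterlim_real_sequentially in \<open>auto intro: geodesic_ray_unit_speed\<close>)
  have "ray_from p (asymptotic `` {c}) t = c t" if "t \<ge> 0" for t
    using ray_from_eq[OF boundary_class[OF c(1)] that] c by simp
  thus ?thesis
    using that[OF r boundary_class(1)[OF c(1)]] lim by simp
qed

lemma ideal_tendstoI:
  fixes w :: "nat \<Rightarrow> 'a ideal_point"
  assumes w: "\<And>i. w i \<in> visual_boundary" and u: "u \<in> visual_boundary"
    and lim: "\<And>t. t \<ge> 0 \<Longrightarrow> (\<lambda>i. ray_from p (w i) t) \<longlonglongrightarrow> ray_from p u t"
  shows "ideal_tendsto w u"
  unfolding ideal_tendsto_def
proof (intro conjI allI impI)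
  fix q :: 'a and t :: real assume t: "t \<ge> 0"
  show "(\<lambda>i. ray_from q (w i) t) \<longlonglongrightarrow> ray_from q u t"
  proof (rule LIMSEQ_subsubseq)
    fix r :: "nat \<Rightarrow> nat" assume r: "strict_mono r"
    obtain r' v where r': "strict_mono (r' :: nat \<Rightarrow> nat)" and v: "v \<in> visual_boundary"
      and lim': "\<And>t. t \<ge> 0 \<Longrightarrow> (\<lambda>i. ray_from q (w (r (r' i))) t) \<longlonglongrightarrow> ray_from q v t"
      using rays_subseq[of "\<lambda>i. w (r i)" q] w by metis
    \<comment> \<open>The limit from \<open>q\<close> along a further subsequence stays within
      \<open>dist p q\<close> of the ray from \<open>p\<close> to \<open>u\<close>, so it represents
      \<open>u\<close> again.\<close>
    have "dist (ray_from p u s) (ray_from q v s) \<le> dist p q" if s: "s \<ge> 0" for s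
    proof (rule tendsto_upperbound)
      show "(\<lambda>i. dist (ray_from p (w (r (r' i))) s) (ray_from q (w (r (r' i))) s)) \<longlonglongrightarrow> dist (ray_from p u s) (ray_from q v s)"
        using filterlim_comp_strict_mono[OF filterlim_comp_strict_mono[OF lim r] r'] lim' s
        by (intro tendsto_intros) auto
      show "eventually (\<lambda>i. dist (ray_from p (w (r (r' i))) s) (ray_from q (w (r (r' i))) s) \<le> dist p q) sequentially"
        using ray_from_dist_le w s by (intro always_eventually allI) auto
    qed simp
    hence "(ray_from p u, ray_from q v) \<in> asymptotic"
      using u v ray_from by (auto simp: asymptotic_def)
    hence "u = v" using boundary_eqI u v ray_from_in by blast
    thus "\<exists>r'. strict_mono r' \<and> ((\<lambda>i. ray_from q (w i) t) \<circ> r \<circ> r') \<longlonglongrightarrow> ray_from q u t"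
      using r' lim'[OF t] by (auto simp: o_def)
  qed
qed (use w u in auto)

lemma ideal_subseq:
  fixes w :: "nat \<Rightarrow> 'a ideal_point"
  assumes "\<And>i. w i \<in> visual_boundary"
  obtains r u where "strict_mono (r :: nat \<Rightarrow> nat)" "ideal_tendsto (w \<circ> r) u"
proof -
  obtain r u where "strict_mono (r :: nat \<Rightarrow> nat)" "u \<in> visual_boundary"
    "\<And>t. t \<ge> 0 \<Longrightarrow> (\<lambda>i. ray_from undefined (w (r i)) t) \<longlonglongrightarrow> ray_from undefined u t"
    using rays_subseq[of w undefined] assms by blast
  thus ?thesis using assms by (intro that[of r u] ideal_tendstoI[of _ _ undefined]) auto
qed

lemma ideal_tendsto_subseq: "ideal_tendsto w u \<Longrightarrow> strict_mono (r :: nat \<Rightarrow> nat) \<Longrightarrow> ideal_tendsto (w \<circ> r) u"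
  unfolding ideal_tendsto_def o_def by (auto intro: filterlim_comp_strict_mono)

lemma ideal_tendsto_subsubseq:
  fixes w :: "nat \<Rightarrow> 'a ideal_point"
  assumes w: "\<And>i. w i \<in> visual_boundary" and u: "u \<in> visual_boundary"
    and "\<And>r v. strict_mono (r :: nat \<Rightarrow> nat) \<Longrightarrow> ideal_tendsto (w \<circ> r) v \<Longrightarrow> v = u"
  shows "ideal_tendsto w u"
proof (rule ideal_tendstoI[OF w u])
  fix t :: real assume t: "t \<ge> 0"
  show "(\<lambda>i. ray_from p (w i) t) \<longlonglongrightarrow> ray_from p u t" for p
  proof (rule LIMSEQ_subsubseq)
    fix r :: "nat \<Rightarrow> nat" assume r: "strict_mono r"
    obtain r' v where r': "strict_mono (r' :: nat \<Rightarrow> nat)" and lim: "ideal_tendsto (w \<circ> r \<circ> r') v"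
      using ideal_subseq[of "w \<circ> r"] w by auto
    hence "v = u" using assms(3)[of "r \<circ> r'" v] r by (simp add: strict_mono_o comp_assoc)
    thus "\<exists>r'. strict_mono r' \<and> ((\<lambda>i. ray_from p (w i) t) \<circ> r \<circ> r') \<longlonglongrightarrow> ray_from p u t"
      using r' ideal_tendstoD(3)[OF lim t, of p] by (auto simp: o_def)
  qed
qed

end

section \<open>Comparison angles and the angle at infinity\<close>

text \<open>Cosine of the comparison angle for sides of length \<open>s\<close> and
  \<open>t\<close>. Being rational in the distances, it turns angle bounds into polynomial
  inequalities and passes to limits directly.\<close>

definition comp_cos :: "(real \<Rightarrow> 'a::metric_space) \<Rightarrow> (real \<Rightarrow> 'a) \<Rightarrow> real \<Rightarrow> real \<Rightarrow> real" where
  "comp_cos g k s t = (s\<^sup>2 + t\<^sup>2 - (dist (g s) (k t))\<^sup>2) / (2 * s * t)"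

lemma comp_cos_le_iff: "s > 0 \<Longrightarrow> t > 0 \<Longrightarrow> comp_cos g k s t \<le> a \<longleftrightarrow> s\<^sup>2 + t\<^sup>2 - 2 * s * t * a \<le> (dist (g s) (k t))\<^sup>2"
  by (auto simp: comp_cos_def field_simps)

lemma comp_cos_less_iff: "s > 0 \<Longrightarrow> t > 0 \<Longrightarrow> comp_cos g k s t < a \<longleftrightarrow> s\<^sup>2 + t\<^sup>2 - 2 * s * t * a < (dist (g s) (k t))\<^sup>2"
  by (auto simp: comp_cos_def field_simps)

lemma comp_cos_ge_iff: "s > 0 \<Longrightarrow> t > 0 \<Longrightarrow> a \<le> comp_cos g k s t \<longleftrightarrow> (dist (g s) (k t))\<^sup>2 \<le> s\<^sup>2 + t\<^sup>2 - 2 * s * t * a"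
  by (auto simp: comp_cos_def field_simps)

lemma comp_cos_commute: "comp_cos g k s t = comp_cos k g t s"
  by (simp add: comp_cos_def dist_commute add.commute mult.commute mult.left_commute)

lemma comp_cos_bounds:
  assumes "unit_speed g s" "unit_speed k t" "g 0 = k 0" "s > 0" "t > 0"
  shows "- 1 \<le> comp_cos g k s t" "comp_cos g k s t \<le> 1"
proof -
  have s: "dist (g 0) (g s) = s" and t: "dist (g 0) (k t) = t"
    using assms unit_speed_dist0[of g s s] unit_speed_dist0[of k t t] by auto
  have "(dist (g s) (k t))\<^sup>2 \<le> (s + t)\<^sup>2"
    using s t dist_triangle3[of "g s" "k t" "g 0"] by (intro power_mono) auto
  thus "- 1 \<le> comp_cos g k s t" using assms by (simp add: comp_cos_ge_iff power2_sum)
  have "\<bar>s - t\<bar> \<le> dist (g s) (k t)"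
    using s t dist_triangle[of "g 0" "g s" "k t"] dist_triangle[of "g 0" "k t" "g s"]
    by (auto simp: dist_commute)
  hence "(s - t)\<^sup>2 \<le> (dist (g s) (k t))\<^sup>2"
    by (metis abs_le_square_iff abs_of_nonneg zero_le_dist)
  thus "comp_cos g k s t \<le> 1" using assms by (simp add: comp_cos_le_iff power2_diff)
qed

lemma tendsto_comp_cos:
  assumes "(\<lambda>i. g i s) \<longlonglongrightarrow> c s" "(\<lambda>i. k i t) \<longlonglongrightarrow> c' t" "s > 0" "t > 0"
  shows "(\<lambda>i. comp_cos (g i) (k i) s t) \<longlonglongrightarrow> comp_cos c c' s t"
  unfolding comp_cos_def using assms by (intro tendsto_intros) auto

lemma comparison_angle_comp_cos:
  assumes "dist p (g s) = s" "dist p (k t) = t"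
  shows "comparison_angle p (g s) (k t) = arccos (comp_cos g k s t)"
  using assms by (simp add: comparison_angle_def comp_cos_def)

text \<open>Cosine of the angle at infinity. The origin \<open>undefined\<close> is just some point;
  \<open>ideal_cos_tendsto\<close> shows that neither it nor the choice of rays matters.\<close>

definition ideal_cos :: "'a::metric_space ideal_point \<Rightarrow> 'a ideal_point \<Rightarrow> real" where
  "ideal_cos u v = Lim at_top (\<lambda>t. comp_cos (ray_from undefined u) (ray_from undefined v) t t)"

context proper_CAT0
begin

text \<open>Comparison angles grow with the sides: this is the hinge inequality with factors
  \<open>s / S\<close> and \<open>t / T\<close>, rewritten for cosines.\<close>

lemma comp_cos_antimono:
  fixes g k :: "real \<Rightarrow> 'a"
  assumes g: "unit_speed g S" and k: "unit_speed k T" and gk: "g 0 = k 0"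
    and s: "0 < s" "s \<le> S" and t: "0 < t" "t \<le> T"
  shows "comp_cos g k S T \<le> comp_cos g k s t"
proof -
  let ?q = "comp_cos g k S T"
  have "S\<^sup>2 + T\<^sup>2 - (dist (g S) (k T))\<^sup>2 = 2 * S * T * ?q"
    using s t by (simp add: comp_cos_def)
  hence "(dist (g (s / S * S)) (k (t / T * T)))\<^sup>2
      \<le> (s / S)\<^sup>2 * S\<^sup>2 + (t / T)\<^sup>2 * T\<^sup>2 - s / S * (t / T) * (2 * S * T * ?q)"
    using hinge[OF g k gk, of "s / S" "t / T"] s t by simp
  also have "\<dots> = s\<^sup>2 + t\<^sup>2 - 2 * s * t * ?q" using s t by (simp add: power_divide)
  finally show ?thesis using s t by (simp add: comp_cos_ge_iff)
qed

lemma comp_cos_ray_antimono: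
  fixes c c' :: "real \<Rightarrow> 'a"
  assumes "geodesic_ray c" "geodesic_ray c'" "c 0 = c' 0" "0 < s" "s \<le> S" "0 < t" "t \<le> T"
  shows "comp_cos c c' S T \<le> comp_cos c c' s t"
  using assms by (intro comp_cos_antimono geodesic_ray_unit_speed) auto

lemma comp_cos_ray_bounds:
  fixes c c' :: "real \<Rightarrow> 'a"
  assumes "geodesic_ray c" "geodesic_ray c'" "c 0 = c' 0" "0 < s" "0 < t"
  shows "- 1 \<le> comp_cos c c' s t" "comp_cos c c' s t \<le> 1"
  using assms by (intro comp_cos_bounds geodesic_ray_unit_speed; simp)+

lemma comp_cos_ray_convergent:
  fixes c c' :: "real \<Rightarrow> 'a"
  assumes "geodesic_ray c" "geodesic_ray c'" "c 0 = c' 0"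
  shows "\<exists>l. ((\<lambda>t. comp_cos c c' t t) \<longlongrightarrow> l) at_top"
proof (intro exI decreasing_tendsto)
  let ?l = "INF t\<in>{0<..}. comp_cos c c' t t"
  have bdd: "bdd_below ((\<lambda>t. comp_cos c c' t t) ` {0<..})"
    using comp_cos_ray_bounds[OF assms] by (intro bdd_belowI2[of _ "-1"]) auto
  show "eventually (\<lambda>t. ?l \<le> comp_cos c c' t t) at_top"
    using eventually_gt_at_top[of 0] by eventually_elim (use bdd in \<open>auto intro: cINF_lower\<close>)
  fix x assume "?l < x"
  then obtain T where T: "T > 0" "comp_cos c c' T T < x"
    using bdd by (subst (asm) cINF_less_iff) auto
  show "eventually (\<lambda>t. comp_cos c c' t t < x) at_top"
    using eventually_ge_at_top[of T]
  proof eventually_elim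
    case (elim t)
    with T show ?case using comp_cos_ray_antimono[OF assms T(1) elim T(1) elim] by linarith
  qed
qed

text \<open>Other rays in the same classes change the distance at time \<open>t\<close> by at most
  the constant \<open>K\<close>. As distances are O(t) and the denominator is
  \<open>2 * t * t\<close>, the cosines differ by O(1/t).\<close>

lemma ideal_cos_tendsto:
  fixes u v :: "'a ideal_point"
  assumes u: "u \<in> visual_boundary" "c \<in> u" and v: "v \<in> visual_boundary" "c' \<in> v"
  shows "((\<lambda>t. comp_cos c c' t t) \<longlongrightarrow> ideal_cos u v) at_top"
proof -
  define e e' where "e = ray_from undefined u" and "e' = ray_from undefined v"
  have e: "e \<in> u" "geodesic_ray e" "e' \<in> v" "geodesic_ray e'" "e 0 = e' 0"
    using ray_from u v by (auto simp: e_def e'_def)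
  obtain l where l: "((\<lambda>t. comp_cos e e' t t) \<longlongrightarrow> l) at_top"
    using comp_cos_ray_convergent e by blast
  hence [simp]: "ideal_cos u v = l"
    unfolding ideal_cos_def e_def[symmetric] e'_def[symmetric] by (intro tendsto_Lim) auto
  define K where "K = dist (c 0) (e 0) + dist (c' 0) (e' 0)"
  have K0: "K \<ge> 0" by (simp add: K_def)
  have lim0: "((\<lambda>t. 2 * K / t + K\<^sup>2 / 2 / t / t) \<longlongrightarrow> 0 + 0) at_top"
    by (intro tendsto_add tendsto_divide_0[OF tendsto_const] filterlim_at_top_imp_at_infinity filterlim_ident
        tendsto_divide_0[where c = 0 and f = "\<lambda>t. K\<^sup>2 / 2 / t"])
  have "((\<lambda>t. comp_cos c c' t t - comp_cos e e' t t) \<longlongrightarrow> 0) at_top"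
  proof (rule Lim_null_comparison)
    show "eventually (\<lambda>t. norm (comp_cos c c' t t - comp_cos e e' t t) \<le> 2 * K / t + K\<^sup>2 / 2 / t / t) at_top"
      using eventually_gt_at_top[of 0]
    proof eventually_elim
      case (elim t)
      define d d' where "d = dist (c t) (c' t)" and "d' = dist (e t) (e' t)"
      have "dist (c t) (e t) \<le> dist (c 0) (e 0)" "dist (c' t) (e' t) \<le> dist (c' 0) (e' 0)"
        using boundary_dist_le[OF u(1) u(2) e(1)] boundary_dist_le[OF v(1) v(2) e(3)] elim by auto
      hence dd: "\<bar>d - d'\<bar> \<le> K"
        using dist_triangle[of "c t" "c' t" "e t"] dist_triangle[of "e t" "c' t" "e' t"]
          dist_triangle[of "e t" "e' t" "c t"] dist_triangle[of "c t" "e' t" "c' t"]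
        by (auto simp: d_def d'_def K_def abs_le_iff dist_commute)
      have d': "d' \<le> 2 * t"
        using dist_triangle3[of "e t" "e' t" "e 0"] geodesic_ray_dist0[OF e(2), of t]
          geodesic_ray_dist0[OF e(4), of t] e(5) elim by (simp add: d'_def)
      have "\<bar>d'\<^sup>2 - d\<^sup>2\<bar> = \<bar>d - d'\<bar> * \<bar>d + d'\<bar>"
        by (simp add: square_diff_square_factored abs_mult abs_minus_commute power2_eq_square
            mult.commute add.commute)
      also have "\<dots> \<le> K * (4 * t + K)"
        using dd d' by (intro mult_mono) (auto simp: d_def d'_def)
      finally have *: "\<bar>d'\<^sup>2 - d\<^sup>2\<bar> \<le> K * (4 * t + K)" .
      have "comp_cos c c' t t - comp_cos e e' t t = (d'\<^sup>2 - d\<^sup>2) / (2 * t * t)"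
        by (simp add: comp_cos_def d_def d'_def diff_divide_distrib)
      hence "norm (comp_cos c c' t t - comp_cos e e' t t) = \<bar>d'\<^sup>2 - d\<^sup>2\<bar> / (2 * t * t)"
        using elim by (simp add: abs_divide)
      also have "\<dots> \<le> K * (4 * t + K) / (2 * t * t)"
        using * elim by (intro divide_right_mono) auto
      also have "\<dots> = 2 * K / t + K\<^sup>2 / 2 / t / t"
        using elim by (simp add: field_simps power2_eq_square)
      finally show ?case .
    qed
  qed (use lim0 in simp)
  from tendsto_add[OF this l] show ?thesis by simp
qed

text \<open>For a common origin the limit is an infimum; monotonicity in both sides extends the
  bound to unequal parameters.\<close>

lemma ideal_cos_le:
  fixes u v :: "'a ideal_point"
  assumes "u \<in> visual_boundary" "c \<in> u" "v \<in> visual_boundary" "c' \<in> v"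
    and "c 0 = c' 0" "0 < s" "0 < t"
  shows "ideal_cos u v \<le> comp_cos c c' s t"
proof (rule tendsto_upperbound[OF ideal_cos_tendsto[OF assms(1-4)]])
  show "eventually (\<lambda>T. comp_cos c c' T T \<le> comp_cos c c' s t) at_top"
    using eventually_ge_at_top[of "max s t"]
  proof eventually_elim
    case (elim T)
    thus ?case using assms boundary_ray by (intro comp_cos_ray_antimono) auto
  qed
qed simp

lemma ideal_cos_ge:
  fixes u v :: "'a ideal_point"
  assumes "u \<in> visual_boundary" "c \<in> u" "v \<in> visual_boundary" "c' \<in> v"
    and "\<And>t. t > 0 \<Longrightarrow> a \<le> comp_cos c c' t t"
  shows "a \<le> ideal_cos u v"
proof (rule tendsto_lowerbound[OF ideal_cos_tendsto[OF assms(1-4)]])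
  show "eventually (\<lambda>t. a \<le> comp_cos c c' t t) at_top"
    using eventually_gt_at_top[of 0] by eventually_elim (rule assms(5))
qed simp

lemma ideal_cos_lessE:
  fixes u v :: "'a ideal_point"
  assumes "u \<in> visual_boundary" "c \<in> u" "v \<in> visual_boundary" "c' \<in> v" "c 0 = c' 0" "ideal_cos u v < a"
  obtains T where "T > 0" "\<And>s t. s \<ge> T \<Longrightarrow> t \<ge> T \<Longrightarrow> comp_cos c c' s t < a"
proof -
  obtain T where T: "\<And>t. t \<ge> T \<Longrightarrow> comp_cos c c' t t < a"
    using order_tendstoD(2)[OF ideal_cos_tendsto[OF assms(1-4)] assms(6)]
    unfolding eventually_at_top_linorder by blast
  show ?thesis
  proof (rule that[of "max T 1"])
    fix s t assume st: "s \<ge> max T 1" "t \<ge> max T 1"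
    have "comp_cos c c' s t \<le> comp_cos c c' (max T 1) (max T 1)"
      using assms st boundary_ray by (intro comp_cos_ray_antimono) auto
    also have "\<dots> < a" using T[of "max T 1"] by simp
    finally show "comp_cos c c' s t < a" .
  qed simp
qed

lemma ideal_cos_bounds:
  fixes u v :: "'a ideal_point"
  assumes "u \<in> visual_boundary" "v \<in> visual_boundary"
  shows "- 1 \<le> ideal_cos u v" "ideal_cos u v \<le> 1"
proof -
  note r = ray_from[OF assms(1), of undefined] ray_from[OF assms(2), of undefined]
  have b: "- 1 \<le> comp_cos (ray_from undefined u) (ray_from undefined v) t t"
    "comp_cos (ray_from undefined u) (ray_from undefined v) t t \<le> 1" if "t > 0" for t
    using comp_cos_ray_bounds[OF r(3,6)] r that by auto
  show "- 1 \<le> ideal_cos u v" by (rule ideal_cos_ge[OF assms(1) r(1) assms(2) r(4)]) (rule b(1))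
  have "ideal_cos u v \<le> comp_cos (ray_from undefined u) (ray_from undefined v) 1 1"
    using r by (intro ideal_cos_le[OF assms(1) r(1) assms(2) r(4)]) auto
  with b(2)[of 1] show "ideal_cos u v \<le> 1" by simp
qed

lemma ideal_cos_commute: "ideal_cos (u :: 'a ideal_point) v = ideal_cos v u"
  unfolding ideal_cos_def by (subst comp_cos_commute) simp

lemma ideal_cos_self:
  fixes u :: "'a ideal_point"
  assumes "u \<in> visual_boundary"
  shows "ideal_cos u u = 1"
proof -
  note r = ray_from[OF assms, of undefined]
  have "1 \<le> ideal_cos u u"
    by (rule ideal_cos_ge[OF assms r(1) assms r(1)]) (simp add: comp_cos_ge_iff power2_eq_square)
  with ideal_cos_bounds[OF assms assms] show ?thesis by simp
qed

lemma ideal_cos_eq_1: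
  fixes u v :: "'a ideal_point"
  assumes uv: "u \<in> visual_boundary" "v \<in> visual_boundary" and "1 \<le> ideal_cos u v"
  shows "u = v"
proof -
  note r = ray_from[OF uv(1), of undefined] ray_from[OF uv(2), of undefined]
  have "dist (ray_from undefined u t) (ray_from undefined v t) = 0" if "t \<ge> 0" for t
  proof (cases "t = 0")
    case False
    with that have t: "t > 0" by simp
    have "1 \<le> comp_cos (ray_from undefined u) (ray_from undefined v) t t"
      using ideal_cos_le[OF uv(1) r(1) uv(2) r(4) _ t t] r assms(3) by simp
    hence "(dist (ray_from undefined u t) (ray_from undefined v t))\<^sup>2 \<le> 0"
      using t by (simp add: comp_cos_ge_iff power2_eq_square[of t])
    thus ?thesis by simp
  qed (use r in simp)
  hence "(ray_from undefined u, ray_from undefined v) \<in> asymptotic"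
    using r by (auto simp: asymptotic_def intro!: exI[of _ 0])
  thus ?thesis using boundary_eqI uv r(1,4) by blast
qed

text \<open>An infimum of continuous functions is upper semicontinuous; hence lower bounds on the
  cosine, that is, upper bounds on the angle, survive limits in the cone topology.\<close>

lemma ideal_cos_ge_tendsto:
  fixes u v :: "'a ideal_point"
  assumes u: "ideal_tendsto w u" and v: "ideal_tendsto z v"
    and a: "a \<longlonglongrightarrow> l" and le: "\<And>i. a i \<le> ideal_cos (w i) (z i)"
  shows "l \<le> ideal_cos u v"
proof -
  note r = ray_from[OF ideal_tendstoD(2)[OF u], of undefined] ray_from[OF ideal_tendstoD(2)[OF v], of undefined]
  show ?thesis
  proof (rule ideal_cos_ge[OF ideal_tendstoD(2)[OF u] r(1) ideal_tendstoD(2)[OF v] r(4)])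
    fix t :: real assume t: "t > 0"
    show "l \<le> comp_cos (ray_from undefined u) (ray_from undefined v) t t"
    proof (rule LIMSEQ_le[OF a])
      show "(\<lambda>i. comp_cos (ray_from undefined (w i)) (ray_from undefined (z i)) t t)
          \<longlonglongrightarrow> comp_cos (ray_from undefined u) (ray_from undefined v) t t"
        using t by (intro tendsto_comp_cos ideal_tendstoD(3)[OF u] ideal_tendstoD(3)[OF v]) auto
      have "a i \<le> comp_cos (ray_from undefined (w i)) (ray_from undefined (z i)) t t" for i
      proof -
        note ri = ray_from[OF ideal_tendstoD(1)[OF u, of i], of undefined]
          ray_from[OF ideal_tendstoD(1)[OF v, of i], of undefined]
        have "ideal_cos (w i) (z i) \<le> comp_cos (ray_from undefined (w i)) (ray_from undefined (z i)) t t"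
          using ri t by (intro ideal_cos_le[OF ideal_tendstoD(1)[OF u] ri(1) ideal_tendstoD(1)[OF v] ri(4)]) auto
        with le[of i] show ?thesis by linarith
      qed
      thus "\<exists>N. \<forall>n\<ge>N. a n \<le> comp_cos (ray_from undefined (w n)) (ray_from undefined (z n)) t t" by blast
    qed
  qed
qed

section \<open>The angle metric at infinity\<close>

definition angle :: "'a ideal_point \<Rightarrow> 'a ideal_point \<Rightarrow> real" where
  "angle u v = arccos (ideal_cos u v)"

lemma angle_bounds:
  assumes "u \<in> visual_boundary" "v \<in> visual_boundary"
  shows "0 \<le> angle u v" "angle u v \<le> pi" "cos (angle u v) = ideal_cos u v"
  using ideal_cos_bounds[OF assms] by (auto simp: angle_def arccos_lbound arccos_ubound)

lemma angle_commute: "angle u v = angle v u"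
  by (simp add: angle_def ideal_cos_commute)

lemma angle_self: "u \<in> visual_boundary \<Longrightarrow> angle u u = 0"
  by (simp add: angle_def ideal_cos_self)

lemma angle_le_iff:
  assumes "u \<in> visual_boundary" "v \<in> visual_boundary" "0 \<le> x" "x \<le> pi"
  shows "angle u v \<le> x \<longleftrightarrow> cos x \<le> ideal_cos u v"
  using cos_mono_le_eq[of x "angle u v"] angle_bounds[OF assms(1,2)] assms(3,4) by simp

lemma angle_eq_0:
  assumes "u \<in> visual_boundary" "v \<in> visual_boundary" "angle u v \<le> 0"
  shows "u = v"
  using ideal_cos_eq_1[OF assms(1,2)] angle_le_iff[OF assms(1,2), of 0] assms(3) by simp

text \<open>In a Euclidean sector of angle \<alpha> + \<beta> < \<pi> the chord between the points
  at distance \<open>t\<close> on its sides crosses the ray separating \<alpha> from \<beta> at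
  distance \<open>b * t\<close>. The point at that distance on the ray to \<open>v\<close> is
  inserted, and the two upper bounds add up to the Euclidean chord.\<close>

lemma angle_triangle:
  assumes u: "u \<in> visual_boundary" and v: "v \<in> visual_boundary" and w: "w \<in> visual_boundary"
  shows "angle u w \<le> angle u v + angle v w"
proof (cases "angle u v + angle v w < pi")
  case False
  with angle_bounds[OF u w] show ?thesis by linarith
next
  case True
  define \<alpha> \<beta> where "\<alpha> = angle u v" and "\<beta> = angle v w"
  have \<alpha>: "0 \<le> \<alpha>" "\<alpha> \<le> pi" "cos \<alpha> = ideal_cos u v" and \<beta>: "0 \<le> \<beta>" "\<beta> \<le> pi" "cos \<beta> = ideal_cos v w"
    using angle_bounds[OF u v] angle_bounds[OF v w] by (auto simp: \<alpha>_def \<beta>_def)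
  have lt: "\<alpha> + \<beta> < pi" using True by (simp add: \<alpha>_def \<beta>_def)
  \<comment> \<open>\<delta> is the angle between the direction of \<open>v\<close> and the bisector
    of the sector. As \<alpha> - \<delta> is half of \<alpha> + \<beta>, the chord lies at height
    \<open>cos (\<alpha> - \<delta>)\<close> and meets that direction at distance
    \<open>b\<close>.\<close>
  define \<delta> where "\<delta> = (\<alpha> - \<beta>) / 2"
  define b where "b = cos (\<alpha> - \<delta>) / cos \<delta>"
  have \<delta>: "\<bar>\<delta>\<bar> < pi / 2" 
  proof -
    have "\<alpha> - \<beta> < pi" "\<beta> - \<alpha> < pi" using \<alpha> \<beta> lt by linarith+
    thus ?thesis by (simp add: \<delta>_def abs_less_iff field_simps)
  qed
  have cd: "cos \<delta> > 0" using \<delta> by (intro cos_gt_zero_pi) auto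
  have "cos (\<alpha> - \<delta>) > 0"
    using \<alpha> \<beta> lt by (intro cos_gt_zero_pi) (auto simp: \<delta>_def field_simps)
  hence b: "b > 0" using cd by (simp add: b_def)
  \<comment> \<open>The law of cosines for one part of the chord. It is used with \<alpha>, \<delta>
    and with \<beta>, -\<delta>, which give the same value of \<open>cos (x - y)\<close>.\<close>
  have eq: "1 + (cos (x - y) / cos y)\<^sup>2 - 2 * (cos (x - y) / cos y) * cos x = (sin x / cos y)\<^sup>2"
    if "cos y \<noteq> 0" for x y :: real
  proof -
    have "cos (x - y) - cos y * cos x = sin x * sin y" by (simp add: cos_diff)
    moreover have "(sin x)\<^sup>2 + (cos x)\<^sup>2 = 1" "(sin y)\<^sup>2 + (cos y)\<^sup>2 = 1" by simp_all
    ultimately have "(cos y)\<^sup>2 + (cos (x - y))\<^sup>2 - 2 * cos (x - y) * cos y * cos x = (sin x)\<^sup>2"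
      by algebra
    thus ?thesis using that by (simp add: field_simps power2_eq_square)
  qed
  have eq1: "1 + b\<^sup>2 - 2 * b * cos \<alpha> = (sin \<alpha> / cos \<delta>)\<^sup>2"
    using eq[of \<delta> \<alpha>] cd by (simp add: b_def)
  have "b = cos (\<beta> + \<delta>) / cos \<delta>" by (simp add: b_def \<delta>_def field_simps)
  hence eq2: "1 + b\<^sup>2 - 2 * b * cos \<beta> = (sin \<beta> / cos \<delta>)\<^sup>2"
    using eq[of "- \<delta>" \<beta>] cd by simp
  define \<phi> where "\<phi> = \<alpha> + \<beta>"
  have sum: "sin \<alpha> / cos \<delta> + sin \<beta> / cos \<delta> = 2 * sin (\<phi> / 2)"
  proof -
    have "sin \<alpha> + sin \<beta> = 2 * sin (\<phi> / 2) * cos \<delta>"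
      by (simp add: sin_plus_sin \<phi>_def \<delta>_def)
    thus ?thesis using cd by (simp add: field_simps)
  qed
  define p :: 'a where "p = undefined"
  note r = ray_from[OF u, of p] ray_from[OF v, of p] ray_from[OF w, of p]
  have "cos \<phi> \<le> ideal_cos u w"
  proof (rule ideal_cos_ge[OF u r(1) w r(7)])
    fix t :: real assume t: "t > 0"
    let ?x = "ray_from p u t" and ?y = "ray_from p v (b * t)" and ?z = "ray_from p w t"
    have xy: "dist ?x ?y \<le> t * (sin \<alpha> / cos \<delta>)"
    proof (rule power2_le_imp_le)
      have "cos \<alpha> \<le> comp_cos (ray_from p u) (ray_from p v) t (b * t)"
        unfolding \<alpha>(3) using r b t by (intro ideal_cos_le[OF u r(1) v r(4)]) auto
      hence "(dist ?x ?y)\<^sup>2 \<le> t\<^sup>2 + (b * t)\<^sup>2 - 2 * t * (b * t) * cos \<alpha>"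
        using b t by (simp add: comp_cos_ge_iff)
      also have "\<dots> = t\<^sup>2 * (1 + b\<^sup>2 - 2 * b * cos \<alpha>)"
        by (simp add: power2_eq_square algebra_simps)
      finally show "(dist ?x ?y)\<^sup>2 \<le> (t * (sin \<alpha> / cos \<delta>))\<^sup>2"
        unfolding eq1 by (simp only: power_mult_distrib)
      show "0 \<le> t * (sin \<alpha> / cos \<delta>)" using t cd \<alpha> by (simp add: sin_ge_zero)
    qed
    have yz: "dist ?y ?z \<le> t * (sin \<beta> / cos \<delta>)"
    proof (rule power2_le_imp_le)
      have "cos \<beta> \<le> comp_cos (ray_from p v) (ray_from p w) (b * t) t"
        unfolding \<beta>(3) using r b t by (intro ideal_cos_le[OF v r(4) w r(7)]) auto
      hence "(dist ?y ?z)\<^sup>2 \<le> (b * t)\<^sup>2 + t\<^sup>2 - 2 * (b * t) * t * cos \<beta>"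
        using b t by (simp add: comp_cos_ge_iff)
      also have "\<dots> = t\<^sup>2 * (1 + b\<^sup>2 - 2 * b * cos \<beta>)"
        by (simp add: power2_eq_square algebra_simps)
      finally show "(dist ?y ?z)\<^sup>2 \<le> (t * (sin \<beta> / cos \<delta>))\<^sup>2"
        unfolding eq2 by (simp only: power_mult_distrib)
      show "0 \<le> t * (sin \<beta> / cos \<delta>)" using t cd \<beta> by (simp add: sin_ge_zero)
    qed
    have "dist ?x ?z \<le> t * (sin \<alpha> / cos \<delta>) + t * (sin \<beta> / cos \<delta>)"
      using xy yz dist_triangle[of ?x ?z ?y] by linarith
    also have "\<dots> = t * (2 * sin (\<phi> / 2))" by (simp only: sum flip: distrib_left)
    finally have "(dist ?x ?z)\<^sup>2 \<le> (t * (2 * sin (\<phi> / 2)))\<^sup>2" by (intro power_mono) auto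
    also have "\<dots> = t\<^sup>2 + t\<^sup>2 - 2 * t * t * cos \<phi>"
    proof -
      have "cos \<phi> = 1 - 2 * (sin (\<phi> / 2))\<^sup>2" using cos_double_sin[of "\<phi> / 2"] by simp
      thus ?thesis by algebra
    qed
    finally show "cos \<phi> \<le> comp_cos (ray_from p u) (ray_from p w) t t" using t by (simp add: comp_cos_ge_iff)
  qed
  thus ?thesis using angle_le_iff[OF u w, of \<phi>] \<alpha> \<beta> lt by (simp add: \<phi>_def \<alpha>_def \<beta>_def)
qed

text \<open>Far out on a ray towards \<open>u\<close> the directions of \<open>u\<close> and \<open>v\<close> make almost the full angle at
  infinity, because \<open>x \<mapsto> dist x (c' T)\<close> is convex along that ray.\<close>

lemma comp_cos_far_out_le:
  fixes u v :: "'a ideal_point"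
  assumes u: "u \<in> visual_boundary" and v: "v \<in> visual_boundary"
    and a: "ideal_cos u v < a" "a \<le> 1"
  obtains q where "\<And>s t. s > 0 \<Longrightarrow> t > 0 \<Longrightarrow> comp_cos (ray_from q u) (ray_from q v) s t \<le> a"
proof -
  define p :: 'a where "p = undefined"
  define c c' where "c = ray_from p u" and "c' = ray_from p v"
  have c: "c \<in> u" "c 0 = p" "geodesic_ray c" "c' \<in> v" "c' 0 = p" "geodesic_ray c'"
    using ray_from[OF u, of p] ray_from[OF v, of p] by (auto simp: c_def c'_def)
  have a1: "- 1 \<le> a" using ideal_cos_bounds[OF u v] a by linarith
  obtain \<tau> where \<tau>: "\<tau> > 0" "\<And>s t. s \<ge> \<tau> \<Longrightarrow> t \<ge> \<tau> \<Longrightarrow> comp_cos c c' s t < a"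
    using ideal_cos_lessE[OF u c(1) v c(4) _ a(1)] c by metis
  define q where "q = c \<tau>"
  define e where "e = ray_from q v"
  have e: "e \<in> v" "e 0 = q" "geodesic_ray e" using ray_from[OF v, of q] by (auto simp: e_def)
  have shift: "geodesic_ray (\<lambda>t. c (\<tau> + t))" using geodesic_ray_shift[OF c(3), of \<tau>] \<tau>(1) by simp
  have "(c, \<lambda>t. c (\<tau> + t)) \<in> asymptotic"
    using c shift \<tau> geodesic_rayD[OF c(3)] by (auto simp: asymptotic_def intro!: exI[of _ \<tau>])
  hence shift_u: "(\<lambda>t. c (\<tau> + t)) \<in> u" using boundary_closed u c by blast
  have qu: "ray_from q u t = c (\<tau> + t)" if "t \<ge> 0" for t
    using ray_from_eq[OF u shift_u that] by (simp add: q_def)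
  have pq: "dist p q = \<tau>" using geodesic_ray_dist0[OF c(3), of \<tau>] c \<tau> by (simp add: q_def)
  \<comment> \<open>A first variation estimate: moving from \<open>q\<close> by \<open>s\<close>
    along the ray to \<open>u\<close> brings one closer to \<open>e t\<close> by at most
    \<open>s * a\<close>. It is derived from the remote point \<open>c' T\<close>, with an error
    that vanishes as \<open>T\<close> grows.\<close>
  have far: "dist (c (\<tau> + s)) (e t) \<ge> t - s * a" if s: "s > 0" and t: "t > 0" for s t
  proof (rule tendsto_upperbound)
    have "filterlim (\<lambda>T. T - \<tau>) at_top at_top"
      using filterlim_tendsto_add_at_top[OF tendsto_const[of "- \<tau>"] filterlim_ident] by simp
    hence "((\<lambda>T. 2 * \<tau> * t / (T - \<tau>)) \<longlongrightarrow> 0) at_top"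
      by (intro tendsto_divide_0[OF tendsto_const] filterlim_at_top_imp_at_infinity)
    from tendsto_diff[OF tendsto_const this, of "t - s * a"]
    show "((\<lambda>T. t - s * a - 2 * \<tau> * t / (T - \<tau>)) \<longlongrightarrow> t - s * a) at_top" by simp
    show "eventually (\<lambda>T. t - s * a - 2 * \<tau> * t / (T - \<tau>) \<le> dist (c (\<tau> + s)) (e t)) at_top"
      using eventually_gt_at_top[of "2 * \<tau> + t"]
    proof eventually_elim
      case (elim T)
      have T: "T > \<tau>" "T > 0" using elim \<tau> t by linarith+
      define f where "f \<sigma> = dist (c \<sigma>) (c' T)" for \<sigma>
      have f0: "f 0 = T" using geodesic_ray_dist0[OF c(6)] c T by (simp add: f_def)
      \<comment> \<open>Up to time \<tau> the distance to \<open>c' T\<close> decreases at average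
        rate at most \<open>a\<close>; by convexity it cannot decrease faster afterwards.\<close>
      have f\<tau>: "T - \<tau> * a \<le> f \<tau>"
      proof (rule power2_le_imp_le)
        have "comp_cos c c' \<tau> T \<le> a" using \<tau>(2)[of \<tau> T] T by simp
        hence "\<tau>\<^sup>2 + T\<^sup>2 - 2 * \<tau> * T * a \<le> (f \<tau>)\<^sup>2"
          using \<tau> T by (simp add: comp_cos_le_iff f_def)
        moreover have "\<tau>\<^sup>2 * a\<^sup>2 \<le> \<tau>\<^sup>2 * 1"
          using a a1 by (intro mult_left_mono) (auto simp: abs_square_le_1 abs_le_iff)
        ultimately show "(T - \<tau> * a)\<^sup>2 \<le> (f \<tau>)\<^sup>2"
          by (simp add: power2_diff power_mult_distrib algebra_simps)
      qed (simp add: f_def)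
      define l where "l = \<tau> / (\<tau> + s)"
      have l: "0 < l" "l < 1" "l * (\<tau> + s) = \<tau>" "(1 - l) * (\<tau> + s) = s"
        using \<tau> s by (auto simp: l_def field_simps)
      have "f \<tau> \<le> (1 - l) * f 0 + l * f (\<tau> + s)"
        using convex_dist[of c "\<tau> + s" "\<lambda>_. c' T" 0 l] l c \<tau> s
        by (auto simp: f_def unit_speed_def geodesic_rayD)
      hence "f \<tau> * (\<tau> + s) \<le> ((1 - l) * f 0 + l * f (\<tau> + s)) * (\<tau> + s)"
        using \<tau> s by (intro mult_right_mono) auto
      also have "\<dots> = ((1 - l) * (\<tau> + s)) * f 0 + (l * (\<tau> + s)) * f (\<tau> + s)"
        by (simp add: algebra_simps)
      also have "\<dots> = s * T + \<tau> * f (\<tau> + s)" by (simp only: l f0)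
      finally have "s * (f \<tau> - T) \<le> \<tau> * (f (\<tau> + s) - f \<tau>)" by (simp add: algebra_simps)
      moreover have "s * (- (\<tau> * a)) \<le> s * (f \<tau> - T)" using f\<tau> s by (intro mult_left_mono) auto
      ultimately have "\<tau> * (- (s * a)) \<le> \<tau> * (f (\<tau> + s) - f \<tau>)" by (simp add: algebra_simps)
      hence "- (s * a) \<le> f (\<tau> + s) - f \<tau>" by (rule mult_left_le_imp_le) (rule \<tau>(1))
      hence 1: "f \<tau> - s * a \<le> f (\<tau> + s)" by simp
      \<comment> \<open>The segment from \<open>q\<close> to \<open>c' T\<close> is almost the ray
        \<open>e\<close>: the ends are within \<open>2 * \<tau>\<close>, so at the fixed time
        \<open>t\<close> contraction leaves an error of order
        \<open>1 / (T - \<tau>)\<close>.\<close>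
      obtain k where "geodesic k q (c' T)" using geodesic_exists by blast
      note k = geodesicD[OF this]
      define E where "E = dist q (c' T)"
      have E: "\<bar>T - E\<bar> \<le> \<tau>"
        using dist_triangle[of p "c' T" q] dist_triangle[of q "c' T" p] pq geodesic_ray_dist0[OF c(6), of T] c T
        by (auto simp: E_def dist_commute)
      hence E': "E > 0" "T - \<tau> \<le> E" "t \<le> E" using T elim by linarith+
      have "dist (c' T) (e T) \<le> \<tau>"
        using boundary_dist_le[OF v c(4) e(1), of T] T pq c e by simp
      moreover have "dist (e T) (e E) = \<bar>T - E\<bar>" using geodesic_rayD[OF e(3)] T E' by simp
      ultimately have kE: "dist (k E) (e E) \<le> 2 * \<tau>"
        using E dist_triangle[of "c' T" "e E" "e T"] k by (simp add: E_def)
      have "dist (k t) (e t) \<le> t / E * dist (k E) (e E)"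
        using k e E' t geodesic_ray_unit_speed[OF e(3), of E]
        by (intro same_origin_contraction) (simp_all add: E_def)
      also have "\<dots> \<le> t / (T - \<tau>) * (2 * \<tau>)"
        using kE E' t T by (intro mult_mono divide_left_mono) auto
      finally have ke: "dist (k t) (e t) \<le> 2 * \<tau> * t / (T - \<tau>)" by (simp add: mult.commute)
      have "dist (k t) (c' T) = E - t"
        using unit_speedD[OF k(1), of t E] k E' t by (simp add: E_def)
      hence "dist (e t) (c' T) \<le> 2 * \<tau> * t / (T - \<tau>) + (E - t)"
        using ke dist_triangle[of "e t" "c' T" "k t"] by (simp add: dist_commute)
      moreover have "f (\<tau> + s) \<le> dist (c (\<tau> + s)) (e t) + dist (e t) (c' T)"
        unfolding f_def by (rule dist_triangle)
      moreover have "f \<tau> = E" by (simp add: f_def E_def q_def)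
      ultimately show ?case using 1 by linarith
    qed
  qed simp
  show ?thesis
  proof (rule that)
    fix s t :: real assume st: "s > 0" "t > 0"
    show "comp_cos (ray_from q u) (ray_from q v) s t \<le> a"
    proof (rule field_le_epsilon)
      fix \<epsilon> :: real assume \<epsilon>: "\<epsilon> > 0"
      \<comment> \<open>Shrinking \<open>s\<close> can only enlarge the cosine, and for
        \<open>x\<close> at most \<open>2 * t * \<epsilon>\<close> the quadratic term in
        \<open>x\<close> is absorbed by \<epsilon>.\<close>
      define x where "x = min (min s t) (2 * t * \<epsilon>)"
      have x: "0 < x" "x \<le> s" "x \<le> t" "x \<le> 2 * t * \<epsilon>" using st \<epsilon> by (auto simp: x_def)
      have "comp_cos (ray_from q u) (ray_from q v) s t \<le> comp_cos (ray_from q u) (ray_from q v) x t"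
        using ray_from[OF u, of q] ray_from[OF v, of q] x st by (intro comp_cos_ray_antimono) auto
      also have "\<dots> \<le> a + \<epsilon>"
      proof -
        have "x * a \<le> x * 1" using x a by (intro mult_left_mono) auto
        hence "x * a \<le> t" using x by linarith
        hence "(t - x * a)\<^sup>2 \<le> (dist (ray_from q u x) (ray_from q v t))\<^sup>2"
          using far[OF x(1) st(2)] qu[of x] x by (intro power_mono) (auto simp: e_def)
        moreover have "x\<^sup>2 \<le> 2 * t * \<epsilon> * x" using x by (simp add: power2_eq_square mult_right_mono)
        moreover have "0 \<le> (x * a)\<^sup>2" by simp
        moreover have "x\<^sup>2 + t\<^sup>2 - 2 * x * t * (a + \<epsilon>) = (t - x * a)\<^sup>2 - (x * a)\<^sup>2 + (x\<^sup>2 - 2 * t * \<epsilon> * x)"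
          by algebra
        ultimately have "x\<^sup>2 + t\<^sup>2 - 2 * x * t * (a + \<epsilon>) \<le> (dist (ray_from q u x) (ray_from q v t))\<^sup>2"
          by linarith
        thus ?thesis using x st by (simp add: comp_cos_le_iff)
      qed
      finally show "comp_cos (ray_from q u) (ray_from q v) s t \<le> a + \<epsilon>" .
    qed
  qed
qed

lemma angle_at_eq_Limsup:
  fixes u v :: "'a ideal_point"
  assumes u: "u \<in> visual_boundary" and v: "v \<in> visual_boundary"
  shows "angle_at p u v =
    Limsup (at_right 0 \<times>\<^sub>F at_right 0) (\<lambda>(s, t). ereal (arccos (comp_cos (ray_from p u) (ray_from p v) s t)))"
  unfolding angle_at_def Alexandrov_angle_def
proof (rule Limsup_eq)
  note r = ray_from[OF u, of p] ray_from[OF v, of p]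
  have "eventually (\<lambda>x::real. x > 0) (at_right 0)" by (simp add: eventually_at_right_less)
  hence "eventually (\<lambda>x::real \<times> real. fst x > 0 \<and> snd x > 0) (at_right 0 \<times>\<^sub>F at_right 0)"
    by (auto simp: eventually_prod_filter)
  thus "eventually (\<lambda>x. (case x of (s, t) \<Rightarrow> ereal (comparison_angle (ray_from p u 0) (ray_from p u s) (ray_from p v t)))
      = (case x of (s, t) \<Rightarrow> ereal (arccos (comp_cos (ray_from p u) (ray_from p v) s t)))) (at_right 0 \<times>\<^sub>F at_right 0)"
  proof eventually_elim
    case (elim x)
    thus ?case
      using r geodesic_ray_dist0[OF r(3), of "fst x"] geodesic_ray_dist0[OF r(6), of "snd x"]
      by (auto simp: case_prod_unfold intro!: comparison_angle_comp_cos)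
  qed
qed

lemma positive_pair_filter:
  assumes "\<And>s t. s > 0 \<Longrightarrow> t > 0 \<Longrightarrow> P s t"
  shows "eventually (\<lambda>(s, t). P s t) (at_right (0::real) \<times>\<^sub>F at_right (0::real))"
proof -
  have "eventually (\<lambda>x::real. x > 0) (at_right 0)" by (simp add: eventually_at_right_less)
  with assms show ?thesis unfolding eventually_prod_filter by blast
qed

text \<open>Alexandrov angles are limits of comparison angles, which never exceed the angle at
  infinity; at base points far out on a ray they come arbitrarily close to it.\<close>

lemma angular_dist_eq:
  assumes u: "u \<in> visual_boundary" and v: "v \<in> visual_boundary"
  shows "angular_dist u v = ereal (angle u v)"
proof (rule antisym)
  have nontriv: "at_right (0::real) \<times>\<^sub>F at_right (0::real) \<noteq> bot"
    by (simp add: prod_filter_eq_bot)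
  have bnd: "- 1 \<le> comp_cos (ray_from p u) (ray_from p v) s t" "comp_cos (ray_from p u) (ray_from p v) s t \<le> 1"
    if "s > 0" "t > 0" for p s t
    using ray_from[OF u, of p] ray_from[OF v, of p] that by (intro comp_cos_ray_bounds; simp)+
  show "angular_dist u v \<le> ereal (angle u v)"
    unfolding angular_dist_def angle_at_eq_Limsup[OF u v]
  proof (intro SUP_least Limsup_bounded)
    fix p
    have "eventually (\<lambda>(s, t). ereal (arccos (comp_cos (ray_from p u) (ray_from p v) s t)) \<le> ereal (angle u v))
       (at_right 0 \<times>\<^sub>F at_right 0)"
    proof (rule positive_pair_filter)
      fix s t :: real assume st: "s > 0" "t > 0"
      have "ideal_cos u v \<le> comp_cos (ray_from p u) (ray_from p v) s t"
        using ray_from[OF u, of p] ray_from[OF v, of p] st by (intro ideal_cos_le[OF u _ v]) auto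
      thus "ereal (arccos (comp_cos (ray_from p u) (ray_from p v) s t)) \<le> ereal (angle u v)"
        using bnd[OF st] ideal_cos_bounds[OF u v] by (simp add: angle_def arccos_le_arccos)
    qed
    thus "eventually (\<lambda>x. (case x of (s, t) \<Rightarrow> ereal (arccos (comp_cos (ray_from p u) (ray_from p v) s t))) \<le> ereal (angle u v))
       (at_right 0 \<times>\<^sub>F at_right 0)"
      by (simp add: case_prod_unfold)
  qed
  have lower: "ereal (arccos a) \<le> angular_dist u v" if a: "- 1 \<le> a" "a \<le> 1"
    and le: "\<And>s t. s > 0 \<Longrightarrow> t > 0 \<Longrightarrow> comp_cos (ray_from q u) (ray_from q v) s t \<le> a" for a q
  proof -
    have "eventually (\<lambda>(s, t). ereal (arccos a) \<le> ereal (arccos (comp_cos (ray_from q u) (ray_from q v) s t)))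
       (at_right 0 \<times>\<^sub>F at_right 0)"
      by (rule positive_pair_filter) (use bnd le a in \<open>simp add: arccos_le_arccos\<close>)
    hence "ereal (arccos a) \<le> angle_at q u v"
      unfolding angle_at_eq_Limsup[OF u v] by (intro le_Limsup nontriv) (simp add: case_prod_unfold)
    also have "\<dots> \<le> angular_dist u v" unfolding angular_dist_def by (rule SUP_upper) simp
    finally show ?thesis .
  qed
  show "ereal (angle u v) \<le> angular_dist u v"
  proof (rule ccontr)
    assume "\<not> ereal (angle u v) \<le> angular_dist u v"
    hence less: "angular_dist u v < ereal (angle u v)" by simp
    \<comment> \<open>The bound \<open>lower\<close> with \<open>a = 1\<close>; it makes the
      supremum a real number \<open>y\<close>, to which the cosine can be applied.\<close>
    moreover have "0 \<le> angular_dist u v"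
      using lower[of 1 undefined] bnd(2) by (simp add: zero_ereal_def)
    ultimately obtain y where y: "angular_dist u v = ereal y" "0 \<le> y" "y < angle u v"
      by (cases "angular_dist u v") auto
    have "ideal_cos u v < cos y"
      using cos_monotone_0_pi[OF y(2,3)] angle_bounds[OF u v] by simp
    then obtain a where a: "ideal_cos u v < a" "a < cos y" using dense by blast
    have a1: "a < 1" "- 1 \<le> a" using a cos_le_one[of y] ideal_cos_bounds[OF u v] by linarith+
    then obtain q where "\<And>s t. s > 0 \<Longrightarrow> t > 0 \<Longrightarrow> comp_cos (ray_from q u) (ray_from q v) s t \<le> a"
      using comp_cos_far_out_le[OF u v a(1)] by (metis less_imp_le)
    hence "arccos a \<le> y" using lower[of a q] a1 y(1) by simp
    moreover have "y < arccos a"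
      using arccos_less_arccos[of a "cos y"] a a1 arccos_cos[of y] y angle_bounds[OF u v] by simp
    ultimately show False by simp
  qed
qed

end

section \<open>Geodesics for the angle metric\<close>

lemma divide_two_power_le: "0 \<le> x \<Longrightarrow> x / 2 ^ n \<le> (x :: real)"
  using divide_left_mono[of 1 "2 ^ n" x] by simp

context proper_CAT0
begin

definition seg :: "'a \<Rightarrow> 'a \<Rightarrow> real \<Rightarrow> 'a" where
  "seg x y = (SOME g. geodesic g x y)"

lemma geodesic_seg: "geodesic (seg x y) x y"
  unfolding seg_def using geodesic_exists by (rule someI_ex)

lemma seg:
  shows unit_speed_seg: "unit_speed (seg x y) (dist x y)"
    and seg_0: "seg x y 0 = x" and seg_dist: "seg x y (dist x y) = y"
  using geodesicD[OF geodesic_seg[of x y]] by auto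

text \<open>Monotonicity transports the bound at the far ends \<open>S i\<close> and
  \<open>T i\<close> to a fixed time \<open>t\<close>, where comparison cosines are continuous. This
  is how estimates at finite stages reach the boundary.\<close>

lemma comp_cos_limit:
  fixes u v :: "'a ideal_point"
  assumes u: "u \<in> visual_boundary" and v: "v \<in> visual_boundary"
    and g: "\<And>i. unit_speed (g i) (S i)" "\<And>i. g i 0 = p" "filterlim S at_top sequentially"
    and k: "\<And>i. unit_speed (k i) (T i)" "\<And>i. k i 0 = p" "filterlim T at_top sequentially"
    and lim: "\<And>t. t \<ge> 0 \<Longrightarrow> (\<lambda>i. g i t) \<longlonglongrightarrow> ray_from p u t" "\<And>t. t \<ge> 0 \<Longrightarrow> (\<lambda>i. k i t) \<longlonglongrightarrow> ray_from p v t"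
    and a: "eventually (\<lambda>i. a \<le> comp_cos (g i) (k i) (S i) (T i)) sequentially"
  shows "a \<le> ideal_cos u v"
proof (rule ideal_cos_ge[OF u ray_from_in[OF u, of p] v ray_from_in[OF v, of p]])
  fix t :: real assume t: "t > 0"
  show "a \<le> comp_cos (ray_from p u) (ray_from p v) t t"
  proof (rule tendsto_lowerbound)
    show "(\<lambda>i. comp_cos (g i) (k i) t t) \<longlonglongrightarrow> comp_cos (ray_from p u) (ray_from p v) t t"
      using t by (intro tendsto_comp_cos lim) auto
    have "eventually (\<lambda>i. t \<le> S i) sequentially" "eventually (\<lambda>i. t \<le> T i) sequentially"
      using g(3) k(3) unfolding filterlim_at_top by blast+
    with a show "eventually (\<lambda>i. a \<le> comp_cos (g i) (k i) t t) sequentially"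
    proof eventually_elim
      case (elim i)
      have "comp_cos (g i) (k i) (S i) (T i) \<le> comp_cos (g i) (k i) t t"
        using elim t g k by (intro comp_cos_antimono) auto
      with elim show ?case by linarith
    qed
  qed simp
qed

definition points_tendsto :: "'a \<Rightarrow> (nat \<Rightarrow> 'a) \<Rightarrow> 'a ideal_point \<Rightarrow> bool" where
  "points_tendsto p y u \<longleftrightarrow> u \<in> visual_boundary \<and> filterlim (\<lambda>i. dist p (y i)) at_top sequentially \<and>
     (\<forall>t\<ge>0. (\<lambda>i. seg p (y i) t) \<longlonglongrightarrow> ray_from p u t)"

lemma points_tendstoD:
  assumes "points_tendsto p y u"
  shows "u \<in> visual_boundary" "filterlim (\<lambda>i. dist p (y i)) at_top sequentially"
    "t \<ge> 0 \<Longrightarrow> (\<lambda>i. seg p (y i) t) \<longlonglongrightarrow> ray_from p u t"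
  using assms by (auto simp: points_tendsto_def)

lemma points_tendsto_subseq:
  "points_tendsto p y u \<Longrightarrow> strict_mono (r :: nat \<Rightarrow> nat) \<Longrightarrow> points_tendsto p (y \<circ> r) u"
  unfolding points_tendsto_def o_def by (auto intro: filterlim_comp_strict_mono)

lemma points_subseq:
  assumes y: "filterlim (\<lambda>i. dist p (y i)) at_top sequentially"
  obtains r u where "strict_mono (r :: nat \<Rightarrow> nat)" "points_tendsto p (y \<circ> r) u"
proof -
  obtain r c where r: "strict_mono (r :: nat \<Rightarrow> nat)" and c: "geodesic_ray c" "c 0 = p"
    and lim: "\<And>t. t \<ge> 0 \<Longrightarrow> (\<lambda>i. seg p (y (r i)) t) \<longlonglongrightarrow> c t"
    by (rule limit_ray[of "\<lambda>i. seg p (y i)" p "\<lambda>i. dist p (y i)"]) (use y seg in auto)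
  have "ray_from p (asymptotic `` {c}) t = c t" if "t \<ge> 0" for t
    using ray_from_eq[OF boundary_class[OF c(1)] that] c by simp
  hence "points_tendsto p (y \<circ> r) (asymptotic `` {c})"
    using boundary_class(1)[OF c(1)] filterlim_comp_strict_mono[OF y r] lim
    by (simp add: points_tendsto_def o_def)
  with r show ?thesis by (rule that)
qed

text \<open>The limit of the midpoints of \<open>c n\<close> and \<open>c' n\<close>: the law of cosines in the triangle
  \<open>p\<close>, \<open>c n\<close>, \<open>z n\<close> and AM-GM bound the angle by half of the total one, whatever the distance
  \<open>dist p (z n)\<close> is.\<close>

lemma ideal_midpoint:
  assumes u: "u \<in> visual_boundary" and v: "v \<in> visual_boundary" and less: "angle u v < pi"
  shows "\<exists>\<xi>\<in>visual_boundary. angle u \<xi> \<le> angle u v / 2 \<and> angle \<xi> v \<le> angle u v / 2"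
proof -
  define \<theta> where "\<theta> = angle u v"
  have \<theta>: "0 \<le> \<theta>" "\<theta> < pi" "cos \<theta> = ideal_cos u v" using angle_bounds[OF u v] less by (auto simp: \<theta>_def)
  have cos2: "1 + cos \<theta> = 2 * (cos (\<theta> / 2))\<^sup>2" and sin2: "1 - cos \<theta> = 2 * (sin (\<theta> / 2))\<^sup>2"
    using cos_double_cos[of "\<theta> / 2"] cos_double_sin[of "\<theta> / 2"] by simp_all
  have s0: "0 \<le> sin (\<theta> / 2)" using \<theta> by (intro sin_ge_zero) auto
  have s1: "sin (\<theta> / 2) < 1"
    using sin_monotone_2pi[of "\<theta> / 2" "pi / 2"] \<theta> by simp
  define p :: 'a where "p = undefined"
  define c c' where "c = ray_from p u" and "c' = ray_from p v"
  have c: "c \<in> u" "c 0 = p" "geodesic_ray c" "c' \<in> v" "c' 0 = p" "geodesic_ray c'"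
    using ray_from[OF u, of p] ray_from[OF v, of p] by (auto simp: c_def c'_def)
  define D where "D n = dist (c (real n)) (c' (real n))" for n
  define z where "z n = seg (c (real n)) (c' (real n)) (D n / 2)" for n
  have z: "dist (c (real n)) (z n) = D n / 2" "dist (c' (real n)) (z n) = D n / 2" for n
  proof -
    note sg = seg[of "c (real n)" "c' (real n)"]
    show "dist (c (real n)) (z n) = D n / 2"
      using unit_speedD[OF sg(1), of 0 "D n / 2"] sg(2) by (simp add: z_def D_def)
    show "dist (c' (real n)) (z n) = D n / 2"
      using unit_speedD[OF sg(1), of "D n" "D n / 2"] sg(3) by (simp add: z_def D_def)
  qed
  have D: "D n \<le> 2 * (real n * sin (\<theta> / 2))" if "n > 0" for n
  proof (rule power2_le_imp_le)
    have "cos \<theta> \<le> comp_cos c c' (real n) (real n)"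
      using ideal_cos_le[OF u c(1) v c(4)] c that \<theta> by simp
    hence "(D n)\<^sup>2 \<le> (real n)\<^sup>2 + (real n)\<^sup>2 - 2 * real n * real n * cos \<theta>"
      using that by (simp add: comp_cos_ge_iff D_def)
    also have "\<dots> = (2 * (real n * sin (\<theta> / 2)))\<^sup>2" using sin2 by algebra
    finally show "(D n)\<^sup>2 \<le> (2 * (real n * sin (\<theta> / 2)))\<^sup>2" .
    show "0 \<le> 2 * (real n * sin (\<theta> / 2))" using s0 by simp
  qed
  \<comment> \<open>Here \<open>angle u v < pi\<close> enters: half of the chord is at most
    \<open>n * sin (\<theta> / 2)\<close> with a sine below 1, so the midpoints escape to
    infinity.\<close>
  have far: "filterlim (\<lambda>n. dist p (z n)) at_top sequentially"
  proof (rule filterlim_at_top_mono)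
    show "filterlim (\<lambda>n. (1 - sin (\<theta> / 2)) * real n) at_top sequentially"
      using s1 by (intro filterlim_tendsto_pos_mult_at_top[OF tendsto_const] filterlim_real_sequentially) auto
    show "eventually (\<lambda>n. (1 - sin (\<theta> / 2)) * real n \<le> dist p (z n)) sequentially"
      using eventually_gt_at_top[of 0]
    proof eventually_elim
      case (elim n)
      show ?case
        using D[OF elim] z(1)[of n] geodesic_ray_dist0[OF c(3), of "real n"] c(2)
          dist_triangle[of p "c (real n)" "z n"] by (simp add: dist_commute algebra_simps)
    qed
  qed
  then obtain r \<xi> where r: "strict_mono (r :: nat \<Rightarrow> nat)" and \<xi>: "points_tendsto p (z \<circ> r) \<xi>"
    by (rule points_subseq)
  have r_top: "filterlim (\<lambda>i. real (r i)) at_top sequentially"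
    using filterlim_real_sequentially r by (rule filterlim_comp_strict_mono)
  have half: "cos (\<theta> / 2) \<le> ideal_cos w \<xi>"
    if w: "w \<in> visual_boundary" and d: "\<And>n. dist (ray_from p w (real n)) (z n) = D n / 2" for w
  proof (rule comp_cos_limit[OF w points_tendstoD(1)[OF \<xi>] geodesic_ray_unit_speed[OF ray_from_ray[OF w]]
        ray_from_0[OF w] r_top unit_speed_seg seg_0 points_tendstoD(2)[OF \<xi>] tendsto_const points_tendstoD(3)[OF \<xi>]])
    have "eventually (\<lambda>i. 1 \<le> real (r i)) sequentially" "eventually (\<lambda>i. 1 \<le> dist p ((z \<circ> r) i)) sequentially"
      using r_top points_tendstoD(2)[OF \<xi>] unfolding filterlim_at_top by blast+
    thus "eventually (\<lambda>i. cos (\<theta> / 2) \<le> comp_cos (ray_from p w) (seg p ((z \<circ> r) i)) (real (r i)) (dist p ((z \<circ> r) i))) sequentially"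
    proof eventually_elim
      case (elim i)
      define n R where "n = real (r i)" and "R = dist p (z (r i))"
      have nR: "n > 0" "R > 0" using elim by (auto simp: n_def R_def)
      have "(D (r i))\<^sup>2 \<le> (2 * (n * sin (\<theta> / 2)))\<^sup>2"
        using D[of "r i"] elim by (intro power_mono) (auto simp: D_def n_def)
      moreover have "0 \<le> (n * cos (\<theta> / 2) - R)\<^sup>2" by simp
      moreover have "n\<^sup>2 + R\<^sup>2 - 2 * n * R * cos (\<theta> / 2)
        = (n * cos (\<theta> / 2) - R)\<^sup>2 + (2 * (n * sin (\<theta> / 2)))\<^sup>2 / 4"
        using sin_cos_squared_add[of "\<theta> / 2"] by algebra
      moreover have "(D (r i) / 2)\<^sup>2 = (D (r i))\<^sup>2 / 4" by (simp add: power_divide)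
      ultimately have "(D (r i) / 2)\<^sup>2 \<le> n\<^sup>2 + R\<^sup>2 - 2 * n * R * cos (\<theta> / 2)"
        by linarith
      moreover have "dist (ray_from p w n) (seg p (z (r i)) R) = D (r i) / 2"
        using d seg_dist by (simp add: n_def R_def)
      ultimately have "(dist (ray_from p w n) (seg p (z (r i)) R))\<^sup>2 \<le> n\<^sup>2 + R\<^sup>2 - 2 * n * R * cos (\<theta> / 2)"
        by (simp only:)
      thus ?case using nR unfolding o_def n_def[symmetric] R_def[symmetric]
        by (simp add: comp_cos_ge_iff)
    qed
  qed auto
  have \<xi>_in: "\<xi> \<in> visual_boundary" using points_tendstoD(1)[OF \<xi>] .
  have "angle u \<xi> \<le> \<theta> / 2" "angle v \<xi> \<le> \<theta> / 2"
    using half[OF u] half[OF v] z \<theta> angle_le_iff[OF u \<xi>_in, of "\<theta> / 2"] angle_le_iff[OF v \<xi>_in, of "\<theta> / 2"]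
    unfolding c_def c'_def by auto
  thus ?thesis using \<xi>_in angle_commute[of v \<xi>] by (auto simp: \<theta>_def)
qed

definition ideal_mid :: "'a ideal_point \<Rightarrow> 'a ideal_point \<Rightarrow> 'a ideal_point" where
  "ideal_mid u v = (SOME \<xi>. \<xi> \<in> visual_boundary \<and> angle u \<xi> \<le> angle u v / 2 \<and> angle \<xi> v \<le> angle u v / 2)"

lemma ideal_mid:
  assumes "u \<in> visual_boundary" "v \<in> visual_boundary" "angle u v < pi"
  shows "ideal_mid u v \<in> visual_boundary" "angle u (ideal_mid u v) \<le> angle u v / 2" "angle (ideal_mid u v) v \<le> angle u v / 2"
proof -
  have "ideal_mid u v \<in> visual_boundary \<and> angle u (ideal_mid u v) \<le> angle u v / 2 \<and> angle (ideal_mid u v) v \<le> angle u v / 2"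
    unfolding ideal_mid_def by (rule someI_ex) (use ideal_midpoint[OF assms] in blast)
  thus "ideal_mid u v \<in> visual_boundary" "angle u (ideal_mid u v) \<le> angle u v / 2" "angle (ideal_mid u v) v \<le> angle u v / 2"
    by auto
qed

text \<open>\<open>dyadic u v n k\<close> is the point at parameter \<open>k / 2 ^ n\<close> of the path from \<open>u\<close> to \<open>v\<close> obtained by
  repeated bisection.\<close>

fun dyadic :: "'a ideal_point \<Rightarrow> 'a ideal_point \<Rightarrow> nat \<Rightarrow> nat \<Rightarrow> 'a ideal_point" where
  "dyadic u v 0 k = (if k = 0 then u else v)"
| "dyadic u v (Suc n) k = (if even k then dyadic u v n (k div 2)
     else ideal_mid (dyadic u v n (k div 2)) (dyadic u v n (Suc (k div 2))))"

lemma dyadic_ends: "dyadic u v n 0 = u" "dyadic u v n (2 ^ n) = v"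
  by (induction n) auto

text \<open>Membership and the angle bound go through one induction: midpoints are available only
  while neighbours have angle below \<pi>, which the bound guarantees.\<close>

lemma dyadic_step:
  assumes u: "u \<in> visual_boundary" and v: "v \<in> visual_boundary" and less: "angle u v < pi"
  shows "(\<forall>k\<le>2^n. dyadic u v n k \<in> visual_boundary) \<and>
    (\<forall>k<2^n. angle (dyadic u v n k) (dyadic u v n (Suc k)) \<le> angle u v / 2 ^ n)"
proof (induction n)
  case 0
  show ?case using u v by auto
next
  case (Suc n)
  let ?\<theta> = "angle u v"
  have IH1: "dyadic u v n k \<in> visual_boundary" if "k \<le> 2 ^ n" for k using Suc that by blast
  have IH2: "angle (dyadic u v n k) (dyadic u v n (Suc k)) \<le> ?\<theta> / 2 ^ n" if "k < 2 ^ n" for k using Suc that by blast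
  have "?\<theta> / 2 ^ n \<le> ?\<theta>" using angle_bounds[OF u v] divide_two_power_le by simp
  hence lp: "angle (dyadic u v n k) (dyadic u v n (Suc k)) < pi" if "k < 2 ^ n" for k using IH2[OF that] less by simp
  have mid: "ideal_mid (dyadic u v n k) (dyadic u v n (Suc k)) \<in> visual_boundary"
    "angle (dyadic u v n k) (ideal_mid (dyadic u v n k) (dyadic u v n (Suc k))) \<le> ?\<theta> / 2 ^ Suc n"
    "angle (ideal_mid (dyadic u v n k) (dyadic u v n (Suc k))) (dyadic u v n (Suc k)) \<le> ?\<theta> / 2 ^ Suc n"
    if "k < 2 ^ n" for k
    using ideal_mid[OF IH1 IH1 lp, of k] IH2[of k] that by auto
  show ?case
  proof (intro conjI allI impI)
    fix k :: nat assume k: "k \<le> 2 ^ Suc n"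
    show "dyadic u v (Suc n) k \<in> visual_boundary"
    proof (cases "even k")
      case True
      with k IH1[of "k div 2"] show ?thesis by auto
    next
      case False
      hence "k \<noteq> 2 ^ Suc n" by auto
      with k have "k div 2 < 2 ^ n" by (simp add: less_mult_imp_div_less mult.commute)
      with False mid(1)[of "k div 2"] show ?thesis by simp
    qed
  next
    fix k :: nat assume k: "k < 2 ^ Suc n"
    hence k2: "k div 2 < 2 ^ n" by (simp add: less_mult_imp_div_less mult.commute)
    show "angle (dyadic u v (Suc n) k) (dyadic u v (Suc n) (Suc k)) \<le> ?\<theta> / 2 ^ Suc n"
      using mid(2,3)[OF k2] by (cases "even k") auto
  qed
qed

lemma dyadic_in:
  assumes "u \<in> visual_boundary" "v \<in> visual_boundary" "angle u v < pi" "k \<le> 2 ^ n"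
  shows "dyadic u v n k \<in> visual_boundary"
  using dyadic_step[OF assms(1-3)] assms(4) by blast

lemma dyadic_dist:
  assumes uv: "u \<in> visual_boundary" "v \<in> visual_boundary" "angle u v < pi" and "j \<le> k" "k \<le> 2 ^ n"
  shows "angle (dyadic u v n j) (dyadic u v n k) \<le> (real k - real j) * (angle u v / 2 ^ n)"
  using assms(4,5)
proof (induction k rule: dec_induct)
  case base
  then show ?case using dyadic_in[OF uv, of j n] by (simp add: angle_self)
next
  case (step k)
  have "angle (dyadic u v n j) (dyadic u v n (Suc k)) \<le> angle (dyadic u v n j) (dyadic u v n k) + angle (dyadic u v n k) (dyadic u v n (Suc k))"
    using step by (intro angle_triangle dyadic_in[OF uv]) auto
  also have "angle (dyadic u v n k) (dyadic u v n (Suc k)) \<le> angle u v / 2 ^ n"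
    using dyadic_step[OF uv, of n] step by auto
  finally show ?case using step by (simp add: algebra_simps add_divide_distrib diff_divide_distrib)
qed


lemma ideal_tendsto_const: "u \<in> visual_boundary \<Longrightarrow> ideal_tendsto (\<lambda>_. u) u"
  by (auto simp: ideal_tendsto_def)

text \<open>The dyadic points at the rounded parameter accumulate by compactness of the boundary,
  and semicontinuity of the angle keeps the accumulation point within
  \<open>\<theta> / 2 ^ n\<close> of the \<open>n\<close>-th one. This takes the place of
  completeness of the angle metric.\<close>

lemma angle_geodesic:
  assumes u: "u \<in> visual_boundary" and v: "v \<in> visual_boundary" and less: "angle u v < pi"
  obtains \<gamma> where "\<gamma> ` {0..1} \<subseteq> visual_boundary" "\<gamma> 0 = u" "\<gamma> 1 = v"
    "\<And>s t. s \<in> {0..1} \<Longrightarrow> t \<in> {0..1::real} \<Longrightarrow> angle (\<gamma> s) (\<gamma> t) \<le> \<bar>s - t\<bar> * angle u v"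
proof -
  define \<theta> where "\<theta> = angle u v"
  have \<theta>: "0 \<le> \<theta>" "\<theta> < pi" using angle_bounds[OF u v] less by (auto simp: \<theta>_def)
  define idx where "idx n t = nat \<lfloor>2 ^ n * t\<rfloor>" for n and t :: real
  have idx_le: "idx n t \<le> 2 ^ n" if "t \<in> {0..1}" for n t
  proof -
    have "\<lfloor>2 ^ n * t\<rfloor> \<le> \<lfloor>2 ^ n :: real\<rfloor>" using that by (intro floor_mono) auto
    also have "\<dots> = 2 ^ n" by (metis floor_of_int of_int_numeral of_int_power)
    finally show ?thesis by (simp add: idx_def nat_le_iff)
  qed
  have idx_bounds: "real (idx n t) \<le> 2 ^ n * t" "2 ^ n * t < real (idx n t) + 1" if "t \<in> {0..1}" for n t
    using that by (auto simp: idx_def of_nat_nat)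
  have idx_Suc: "idx n t = idx (Suc n) t div 2" if t: "t \<in> {0..1}" for n t
  proof -
    have "\<lfloor>2 ^ Suc n * t\<rfloor> div 2 = \<lfloor>2 ^ n * t\<rfloor>"
      using floor_divide_real_eq_div[of 2 "2 ^ Suc n * t"] by simp
    thus ?thesis using t by (simp add: idx_def nat_div_distrib)
  qed
  define Q where "Q n t = dyadic u v n (idx n t)" for n t
  have Q_in: "Q n t \<in> visual_boundary" if "t \<in> {0..1}" for n t
    unfolding Q_def by (intro dyadic_in u v less idx_le that)
  have Q_Suc: "angle (Q n t) (Q (Suc n) t) \<le> \<theta> / 2 ^ Suc n" if t: "t \<in> {0..1}" for n t
  proof (cases "even (idx (Suc n) t)")
    case True
    hence "Q (Suc n) t = Q n t" using idx_Suc[OF t, of n] by (simp add: Q_def)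
    thus ?thesis using \<theta> Q_in[OF t] by (simp add: angle_self)
  next
    case False
    let ?k = "idx n t"
    have k: "idx (Suc n) t = Suc (2 * ?k)" using False idx_Suc[OF t, of n] by presburger
    hence kl: "?k < 2 ^ n" using idx_le[OF t, of "Suc n"] by simp
    have st: "angle (dyadic u v n ?k) (dyadic u v n (Suc ?k)) \<le> \<theta> / 2 ^ n"
      using dyadic_step[OF u v less, of n] kl by (simp add: \<theta>_def)
    moreover have "\<theta> / 2 ^ n \<le> \<theta>" using \<theta> divide_two_power_le by simp
    ultimately have "angle (dyadic u v n ?k) (dyadic u v n (Suc ?k)) < pi" using \<theta> by simp
    from ideal_mid(2)[OF dyadic_in[OF u v less] dyadic_in[OF u v less] this] kl st
    show ?thesis by (simp add: Q_def k)
  qed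
  \<comment> \<open>The subtracted term makes the geometric series telescope in the
    induction.\<close>
  have Q_tail: "angle (Q n t) (Q m t) \<le> \<theta> / 2 ^ n - \<theta> / 2 ^ m" if t: "t \<in> {0..1}" and "n \<le> m" for n m t
    using \<open>n \<le> m\<close>
  proof (induction m rule: dec_induct)
    case base
    show ?case using Q_in[OF t] by (simp add: angle_self)
  next
    case (step m)
    have "angle (Q n t) (Q (Suc m) t) \<le> angle (Q n t) (Q m t) + angle (Q m t) (Q (Suc m) t)"
      by (intro angle_triangle Q_in t)
    moreover define x where "x = \<theta> / 2 ^ m"
    moreover have "\<theta> / 2 ^ Suc m = x / 2" by (simp add: x_def)
    moreover have "angle (Q n t) (Q m t) \<le> \<theta> / 2 ^ n - x" using step.IH by (simp add: x_def)
    moreover have "angle (Q m t) (Q (Suc m) t) \<le> x / 2" using Q_Suc[OF t, of m] by (simp add: x_def)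
    ultimately show ?case by simp
  qed
  have "\<exists>x\<in>visual_boundary. \<forall>n. angle (Q n t) x \<le> \<theta> / 2 ^ n" if t: "t \<in> {0..1}" for t
  proof -
    obtain r x where r: "strict_mono (r :: nat \<Rightarrow> nat)" and x: "ideal_tendsto ((\<lambda>n. Q n t) \<circ> r) x"
      using ideal_subseq[of "\<lambda>n. Q n t"] Q_in[OF t] by blast
    have "angle (Q n t) x \<le> \<theta> / 2 ^ n" for n
    proof -
      have le: "0 \<le> \<theta> / 2 ^ n" "\<theta> / 2 ^ n \<le> \<theta>" using \<theta> divide_two_power_le by auto
      have "strict_mono (\<lambda>i. i + n)" by (simp add: strict_mono_def)
      hence "ideal_tendsto ((\<lambda>n. Q n t) \<circ> r \<circ> (\<lambda>i. i + n)) x" by (rule ideal_tendsto_subseq[OF x])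
      hence "cos (\<theta> / 2 ^ n) \<le> ideal_cos (Q n t) x"
      proof (rule ideal_cos_ge_tendsto[OF ideal_tendsto_const[OF Q_in[OF t]] _ tendsto_const])
        fix i
        have "n \<le> r (i + n)" using strict_mono_imp_increasing[OF r, of "i + n"] by linarith
        hence "angle (Q n t) (Q (r (i + n)) t) \<le> \<theta> / 2 ^ n"
          using Q_tail[OF t, of n "r (i + n)"] \<theta> by (smt (verit) divide_nonneg_pos zero_less_power)
        thus "cos (\<theta> / 2 ^ n) \<le> ideal_cos (Q n t) (((\<lambda>n. Q n t) \<circ> r \<circ> (\<lambda>i. i + n)) i)"
          using angle_le_iff[OF Q_in[OF t] Q_in[OF t]] le \<theta> by simp
      qed
      thus ?thesis using angle_le_iff[OF Q_in[OF t] ideal_tendstoD(2)[OF x]] le \<theta> by simp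
    qed
    thus ?thesis using ideal_tendstoD(2)[OF x] by blast
  qed
  then obtain \<gamma> where \<gamma>: "\<And>t. t \<in> {0..1} \<Longrightarrow> \<gamma> t \<in> visual_boundary"
    "\<And>t n. t \<in> {0..1} \<Longrightarrow> angle (Q n t) (\<gamma> t) \<le> \<theta> / 2 ^ n"
    by metis
  have small: "x \<le> y" if "\<And>n. x \<le> y + C / 2 ^ n" for x y C :: real
  proof (rule LIMSEQ_le_const)
    have "(\<lambda>n. C * (1 / 2) ^ n) \<longlonglongrightarrow> C * 0" by (intro tendsto_intros LIMSEQ_power_zero) auto
    hence "(\<lambda>n. y + C * (1 / 2) ^ n) \<longlonglongrightarrow> y + C * 0" by (intro tendsto_add tendsto_const)
    thus "(\<lambda>n. y + C / 2 ^ n) \<longlonglongrightarrow> y" by (simp add: power_divide)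
  qed (use that in auto)
  have ends: "\<gamma> t = x" if t: "t \<in> {0..1}" and "x \<in> visual_boundary" and "\<And>n. Q n t = x" for t x
  proof -
    have "angle x (\<gamma> t) \<le> 0" using \<gamma>(2)[OF t] that(3) by (intro small[of _ 0 \<theta>]) auto
    thus ?thesis using angle_eq_0[OF that(2) \<gamma>(1)[OF t]] by simp
  qed
  show ?thesis
  proof (rule that)
    show "\<gamma> ` {0..1} \<subseteq> visual_boundary" using \<gamma>(1) by blast
    show "\<gamma> 0 = u" using u dyadic_ends by (intro ends) (auto simp: Q_def idx_def)
    have "idx n 1 = 2 ^ n" for n
      using idx_le[of 1 n] idx_bounds(2)[of 1 n] by (simp add: idx_def)
    thus "\<gamma> 1 = v" using v dyadic_ends by (intro ends) (auto simp: Q_def)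
    have main: "angle (\<gamma> s) (\<gamma> t) \<le> (t - s) * \<theta>" if s: "s \<in> {0..1}" and t: "t \<in> {0..1}" and "s \<le> t" for s t
    proof (rule small)
      fix n
      have "\<lfloor>2 ^ n * s\<rfloor> \<le> \<lfloor>2 ^ n * t\<rfloor>" using \<open>s \<le> t\<close> by (intro floor_mono) auto
      hence "idx n s \<le> idx n t" by (simp add: idx_def nat_mono)
      hence "angle (Q n s) (Q n t) \<le> (real (idx n t) - real (idx n s)) * (\<theta> / 2 ^ n)"
        unfolding Q_def \<theta>_def by (intro dyadic_dist u v less idx_le t)
      \<comment> \<open>The summand 1 is the rounding error of the dyadic indices. With the two
        distances to \<gamma> the total error is \<open>3 * \<theta> / 2 ^ n\<close>, which
        \<open>small\<close> removes.\<close>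
      also have "\<dots> \<le> (2 ^ n * (t - s) + 1) * (\<theta> / 2 ^ n)"
        using idx_bounds[OF s, of n] idx_bounds[OF t, of n] \<theta>
        by (intro mult_right_mono) (auto simp: algebra_simps)
      also have "\<dots> = (t - s) * \<theta> + \<theta> / 2 ^ n" by (simp add: field_simps)
      finally have "angle (Q n s) (Q n t) \<le> (t - s) * \<theta> + \<theta> / 2 ^ n" .
      moreover have "angle (\<gamma> s) (\<gamma> t) \<le> angle (Q n s) (\<gamma> s) + (angle (Q n s) (Q n t) + angle (Q n t) (\<gamma> t))"
        using angle_triangle[OF \<gamma>(1)[OF s] Q_in[OF s, of n] \<gamma>(1)[OF t]]
          angle_triangle[OF Q_in[OF s, of n] Q_in[OF t, of n] \<gamma>(1)[OF t]] angle_commute[of "\<gamma> s" "Q n s"] by linarith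
      ultimately have "angle (\<gamma> s) (\<gamma> t) \<le> (t - s) * \<theta> + 3 * (\<theta> / 2 ^ n)"
        using \<gamma>(2)[OF s, of n] \<gamma>(2)[OF t, of n] by linarith
      thus "angle (\<gamma> s) (\<gamma> t) \<le> (t - s) * \<theta> + (3 * \<theta>) / 2 ^ n" by simp
    qed
    fix s t :: real assume "s \<in> {0..1}" "t \<in> {0..1}"
    thus "angle (\<gamma> s) (\<gamma> t) \<le> \<bar>s - t\<bar> * angle u v"
      using main[of s t] main[of t s] angle_commute[of "\<gamma> s" "\<gamma> t"] by (cases "s \<le> t") (auto simp: \<theta>_def)
  qed
qed

end

section \<open>The Tits metric\<close>

lemma angular_length_ge:
  assumes "t 0 = 0" "t n = 1" "mono_on {..n} t"
  shows "(\<Sum>i<n. angular_dist (\<gamma> (t i)) (\<gamma> (t (Suc i)))) \<le> angular_length \<gamma>"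
  unfolding angular_length_def using assms by (intro Sup_upper) blast

lemma Tits_dist_le_length: "angular_path \<gamma> u v \<Longrightarrow> Tits_dist u v \<le> angular_length \<gamma>"
  unfolding Tits_dist_def by (rule INF_lower) simp

lemma angular_pathD:
  assumes "angular_path \<gamma> u v"
  shows "t \<in> {0..1} \<Longrightarrow> \<gamma> t \<in> visual_boundary" "\<gamma> 0 = u" "\<gamma> 1 = v"
  using assms by (auto simp: angular_path_def)

lemma partition_in_unit:
  fixes t :: "nat \<Rightarrow> real"
  assumes "t 0 = 0" "t n = (1::real)" "mono_on {..n} t" "i \<le> n"
  shows "t i \<in> {0..1}"
  using monotone_onD[OF assms(3), of 0 i] monotone_onD[OF assms(3), of i n] assms by auto

context proper_CAT0
begin

lemma angular_path_angle_iff: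
  fixes u v :: "'a ideal_point"
  shows "angular_path \<gamma> u v \<longleftrightarrow> \<gamma> ` {0..1} \<subseteq> visual_boundary \<and> \<gamma> 0 = u \<and> \<gamma> 1 = v \<and>
     (\<forall>t\<in>{0..1}. \<forall>e>0. \<exists>d>0. \<forall>s\<in>{0..1}. \<bar>s - t\<bar> < d \<longrightarrow> angle (\<gamma> s) (\<gamma> t) < e)"
proof (cases "\<gamma> ` {0..1} \<subseteq> visual_boundary")
  case True
  hence "angular_dist (\<gamma> s) (\<gamma> t) = ereal (angle (\<gamma> s) (\<gamma> t))" if "s \<in> {0..1}" "t \<in> {0..1}" for s t
    using that by (intro angular_dist_eq) auto
  thus ?thesis by (simp add: angular_path_def cong: ball_cong_simp)
qed (simp add: angular_path_def)

lemma angular_length_le: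
  fixes \<gamma> :: "real \<Rightarrow> 'a ideal_point"
  assumes \<gamma>: "\<gamma> ` {0..1} \<subseteq> visual_boundary"
    and lip: "\<And>s t. s \<in> {0..1} \<Longrightarrow> t \<in> {0..1} \<Longrightarrow> angle (\<gamma> s) (\<gamma> t) \<le> \<bar>s - t\<bar> * C"
  shows "angular_length \<gamma> \<le> ereal C"
  unfolding angular_length_def
proof (rule Sup_least)
  fix x assume "x \<in> {\<Sum>i<n. angular_dist (\<gamma> (t i)) (\<gamma> (t (Suc i))) | (n::nat) t. t 0 = 0 \<and> t n = 1 \<and> mono_on {..n} t}"
  then obtain n :: nat and t where x: "x = (\<Sum>i<n. angular_dist (\<gamma> (t i)) (\<gamma> (t (Suc i))))"
    and t: "t 0 = 0" "t n = 1" "mono_on {..n} t" by blast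
  note ti = partition_in_unit[OF t]
  have "x = (\<Sum>i<n. ereal (angle (\<gamma> (t i)) (\<gamma> (t (Suc i)))))"
    unfolding x using \<gamma> ti by (intro sum.cong refl angular_dist_eq) auto
  also have "\<dots> = ereal (\<Sum>i<n. angle (\<gamma> (t i)) (\<gamma> (t (Suc i))))" by simp
  also have "(\<Sum>i<n. angle (\<gamma> (t i)) (\<gamma> (t (Suc i)))) \<le> (\<Sum>i<n. (t (Suc i) - t i) * C)"
  proof (rule sum_mono)
    fix i assume i: "i \<in> {..<n}"
    hence "t i \<le> t (Suc i)" using monotone_onD[OF t(3), of i "Suc i"] by simp
    thus "angle (\<gamma> (t i)) (\<gamma> (t (Suc i))) \<le> (t (Suc i) - t i) * C"
      using lip[OF ti ti, of i "Suc i"] i by simp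
  qed
  also have "\<dots> = C" using t by (simp add: sum_lessThan_telescope flip: sum_distrib_right)
  finally show "x \<le> ereal C" by simp
qed

text \<open>The bisection path is Lipschitz with constant \<open>angle u v\<close>, and this bounds
  every partition sum.\<close>

lemma Tits_dist_le_angle:
  assumes u: "u \<in> visual_boundary" and v: "v \<in> visual_boundary" and less: "angle u v < pi"
  shows "Tits_dist u v \<le> ereal (angle u v)"
proof -
  obtain \<gamma> where \<gamma>: "\<gamma> ` {0..1} \<subseteq> visual_boundary" "\<gamma> 0 = u" "\<gamma> 1 = v"
    "\<And>s t. s \<in> {0..1} \<Longrightarrow> t \<in> {0..1::real} \<Longrightarrow> angle (\<gamma> s) (\<gamma> t) \<le> \<bar>s - t\<bar> * angle u v"
    using angle_geodesic[OF u v less] by metis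
  have "angular_path \<gamma> u v"
    unfolding angular_path_angle_iff
  proof (intro conjI \<gamma> ballI allI impI)
    fix t e :: real assume t: "t \<in> {0..1}" and e: "e > 0"
    show "\<exists>d>0. \<forall>s\<in>{0..1}. \<bar>s - t\<bar> < d \<longrightarrow> angle (\<gamma> s) (\<gamma> t) < e"
    proof (intro exI conjI ballI impI)
      show "e / (angle u v + 1) > 0" using e angle_bounds[OF u v] by simp
      fix s assume s: "s \<in> {0..1}" "\<bar>s - t\<bar> < e / (angle u v + 1)"
      have "angle (\<gamma> s) (\<gamma> t) \<le> \<bar>s - t\<bar> * angle u v" by (rule \<gamma>(4)[OF s(1) t])
      also have "\<dots> \<le> \<bar>s - t\<bar> * (angle u v + 1)" by (intro mult_left_mono) auto
      also have "\<dots> < e" using s(2) angle_bounds[OF u v] by (simp add: pos_less_divide_eq)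
      finally show "angle (\<gamma> s) (\<gamma> t) < e" .
    qed
  qed
  from Tits_dist_le_length[OF this] angular_length_le[OF \<gamma>(1,4)] show ?thesis by (rule order_trans)
qed

lemma Tits_dist_le_half_pi:
  fixes u v :: "'a ideal_point"
  assumes u: "u \<in> visual_boundary" and v: "v \<in> visual_boundary" and "0 \<le> ideal_cos u v"
  shows "Tits_dist u v \<le> ereal (pi / 2)"
proof -
  have "angle u v \<le> pi / 2" using angle_le_iff[OF u v, of "pi / 2"] assms(3) by simp
  moreover from this have "angle u v < pi" using pi_gt_zero by linarith
  ultimately show ?thesis using Tits_dist_le_angle[OF u v] by (meson ereal_less_eq(3) order_trans)
qed

lemma ideal_cos_antipodal:
  fixes u v :: "'a ideal_point"
  assumes u: "u \<in> visual_boundary" and v: "v \<in> visual_boundary" and far: "Tits_dist u v > ereal pi"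
  shows "ideal_cos u v = - 1"
proof (rule ccontr)
  assume ne: "ideal_cos u v \<noteq> - 1"
  have "angle u v \<noteq> pi" using angle_bounds(3)[OF u v] ne by auto
  hence less: "angle u v < pi" using angle_bounds[OF u v] by simp
  have "Tits_dist u v \<le> ereal pi"
    using Tits_dist_le_angle[OF u v less] less by (meson ereal_less_eq(3) less_imp_le order_trans)
  with far show False by simp
qed

lemma angular_length_ge_three_points:
  fixes \<gamma> :: "real \<Rightarrow> 'a ideal_point"
  assumes \<gamma>: "angular_path \<gamma> u v" and s: "s \<in> {0..1}"
  shows "ereal (angle u (\<gamma> s) + angle (\<gamma> s) v) \<le> angular_length \<gamma>"
proof -
  \<comment> \<open>Partitions are only weakly increasing, so \<open>s\<close> may be an
    endpoint.\<close>
  define t where "t i = (if i = 0 then 0 else if i = 1 then s else 1)" for i :: nat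
  have t: "t 0 = 0" "t 1 = s" "t 2 = 1" by (simp_all add: t_def)
  have "mono_on {..2} t" using s by (auto simp: t_def monotone_on_def)
  from angular_length_ge[OF t(1,3) this, of \<gamma>]
  have "angular_dist (\<gamma> 0) (\<gamma> s) + angular_dist (\<gamma> s) (\<gamma> 1) \<le> angular_length \<gamma>"
    using t by (simp add: numeral_2_eq_2)
  thus ?thesis using angular_pathD[OF \<gamma>] s
    by (metis angular_dist_eq atLeastAtMost_iff order_refl plus_ereal.simps(1) zero_le_one)
qed

lemma Tits_dist_nonneg:
  fixes u v :: "'a ideal_point"
  shows "0 \<le> Tits_dist u v"
  unfolding Tits_dist_def
proof (rule INF_greatest)
  fix \<gamma> :: "real \<Rightarrow> 'a ideal_point" assume "\<gamma> \<in> {\<gamma>. angular_path \<gamma> u v}"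
  hence p: "angular_path \<gamma> u v" by simp
  have uv: "u \<in> visual_boundary" "v \<in> visual_boundary" using angular_pathD[OF p] by force+
  have "ereal 0 \<le> ereal (angle u (\<gamma> 0) + angle (\<gamma> 0) v)"
    using angular_pathD(2)[OF p] angle_bounds[OF uv] angle_bounds[OF uv(1,1)] by simp
  also have "\<dots> \<le> angular_length \<gamma>" by (rule angular_length_ge_three_points[OF p]) simp
  finally show "0 \<le> angular_length \<gamma>" by (simp add: zero_ereal_def)
qed

lemma Tits_dist_commute_le:
  fixes u v :: "'a ideal_point"
  shows "Tits_dist v u \<le> Tits_dist u v"
  unfolding Tits_dist_def[of u v]
proof (rule INF_greatest)
  fix \<gamma> :: "real \<Rightarrow> 'a ideal_point" assume "\<gamma> \<in> {\<gamma>. angular_path \<gamma> u v}"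
  hence p: "angular_path \<gamma> u v" by simp
  let ?\<gamma> = "\<lambda>t. \<gamma> (1 - t)"
  have "angular_path ?\<gamma> v u"
    unfolding angular_path_def
  proof (intro conjI ballI allI impI)
    show "?\<gamma> ` {0..1} \<subseteq> visual_boundary" using angular_pathD(1)[OF p] by auto
    fix t e :: real assume t: "t \<in> {0..1}" and "e > 0"
    moreover have "1 - t \<in> {0..1}" using t by auto
    ultimately obtain d where d: "d > 0"
      "\<forall>s\<in>{0..1}. \<bar>s - (1 - t)\<bar> < d \<longrightarrow> angular_dist (\<gamma> s) (\<gamma> (1 - t)) < ereal e"
      using p unfolding angular_path_def by blast
    show "\<exists>d>0. \<forall>s\<in>{0..1}. \<bar>s - t\<bar> < d \<longrightarrow> angular_dist (\<gamma> (1 - s)) (\<gamma> (1 - t)) < ereal e"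
      using d by (intro exI[of _ d]) (auto simp: abs_minus_commute)
  qed (use angular_pathD[OF p] in auto)
  hence "Tits_dist v u \<le> angular_length ?\<gamma>" by (rule Tits_dist_le_length)
  also have "\<dots> \<le> angular_length \<gamma>"
    unfolding angular_length_def[of ?\<gamma>]
  proof (rule Sup_least)
    fix x assume "x \<in> {\<Sum>i<n. angular_dist (?\<gamma> (t i)) (?\<gamma> (t (Suc i))) | (n::nat) t. t 0 = 0 \<and> t n = 1 \<and> mono_on {..n} t}"
    then obtain n :: nat and t where x: "x = (\<Sum>i<n. angular_dist (?\<gamma> (t i)) (?\<gamma> (t (Suc i))))"
      and t: "t 0 = 0" "t n = 1" "mono_on {..n} t" by blast
    define t' where "t' i = 1 - t (n - i)" for i
    have "angular_dist (\<gamma> (1 - t i)) (\<gamma> (1 - t (Suc i))) = angular_dist (\<gamma> (1 - t (Suc i))) (\<gamma> (1 - t i))" if "i < n" for i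
    proof -
      have "1 - t i \<in> {0..1}" "1 - t (Suc i) \<in> {0..1}"
        using partition_in_unit[OF t, of i] partition_in_unit[OF t, of "Suc i"] that by auto
      thus ?thesis using angular_pathD(1)[OF p] by (simp add: angular_dist_eq angle_commute)
    qed
    hence "x = (\<Sum>i<n. angular_dist (\<gamma> (1 - t (Suc i))) (\<gamma> (1 - t i)))"
      unfolding x by (intro sum.cong) auto
    also have "\<dots> = (\<Sum>i<n. angular_dist (\<gamma> (t' i)) (\<gamma> (t' (Suc i))))"
      by (subst sum.nat_diff_reindex[symmetric]) (auto simp: t'_def Suc_diff_Suc intro!: sum.cong)
    also have "\<dots> \<le> angular_length \<gamma>"
    proof (rule angular_length_ge)
      show "mono_on {..n} t'"
        using t(3) by (auto simp: t'_def monotone_on_def)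
    qed (use t in \<open>auto simp: t'_def\<close>)
    finally show "x \<le> angular_length \<gamma>" .
  qed
  finally show "Tits_dist v u \<le> angular_length \<gamma>" .
qed

lemma Tits_dist_commute:
  fixes u v :: "'a ideal_point"
  shows "Tits_dist u v = Tits_dist v u"
  by (intro antisym Tits_dist_commute_le)

lemma angular_path_concat:
  fixes u v w :: "'a ideal_point"
  assumes p: "angular_path \<gamma> u v" and q: "angular_path \<delta> v w"
  shows "Tits_dist u w \<le> angular_length \<gamma> + angular_length \<delta>"
proof -
  define \<eta> where "\<eta> t = (if t \<le> 1/2 then \<gamma> (2 * t) else \<delta> (2 * t - 1))" for t
  \<comment> \<open>Clamped parameters: each increment of \<eta> is bounded by the sum of those of
    \<gamma> and \<delta>, and clamping a partition yields partitions for both, so none has to be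
    refined at 1/2.\<close>
  define a b where "a t = min (2 * t) 1" and "b t = max (2 * t - 1) 0" for t :: real
  have ab: "a t \<in> {0..1}" "b t \<in> {0..1}" if "t \<in> {0..1}" for t using that by (auto simp: a_def b_def)
  have \<gamma>_in: "\<gamma> (a t) \<in> visual_boundary" and \<delta>_in: "\<delta> (b t) \<in> visual_boundary" if "t \<in> {0..1}" for t
    using angular_pathD(1)[OF p] angular_pathD(1)[OF q] ab[OF that] by auto
  have v: "v \<in> visual_boundary" using angular_pathD[OF q] by force
  have \<eta>_in: "\<eta> t \<in> visual_boundary" if "t \<in> {0..1}" for t
    using angular_pathD(1)[OF p] angular_pathD(1)[OF q] that by (auto simp: \<eta>_def)
  have le: "angle (\<eta> s) (\<eta> t) \<le> angle (\<gamma> (a s)) (\<gamma> (a t)) + angle (\<delta> (b s)) (\<delta> (b t))"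
    if st: "s \<in> {0..1}" "t \<in> {0..1}" for s t
  proof -
    have 1: "\<eta> x = \<gamma> (a x)" "\<delta> (b x) = v" if "x \<le> 1/2" for x
      using that angular_pathD[OF q] by (auto simp: \<eta>_def a_def b_def)
    have 2: "\<eta> x = \<delta> (b x)" "\<gamma> (a x) = v" if "\<not> x \<le> 1/2" for x
      using that angular_pathD[OF p] by (auto simp: \<eta>_def a_def b_def)
    show ?thesis
      using angle_triangle[OF \<gamma>_in[OF st(1)] v \<delta>_in[OF st(2)]] angle_triangle[OF \<delta>_in[OF st(1)] v \<gamma>_in[OF st(2)]]
        angle_self[OF v]
      by (cases "s \<le> 1/2"; cases "t \<le> 1/2") (auto simp: 1 2)
  qed
  have "angular_path \<eta> u w"
    unfolding angular_path_angle_iff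
  proof (intro conjI ballI allI impI)
    show "\<eta> ` {0..1} \<subseteq> visual_boundary" using \<eta>_in by auto
    show "\<eta> 0 = u" "\<eta> 1 = w" using angular_pathD[OF p] angular_pathD[OF q] by (auto simp: \<eta>_def)
    fix t e :: real assume t: "t \<in> {0..1}" and e: "e > 0"
    obtain d1 where d1: "d1 > 0" "\<And>s. s \<in> {0..1} \<Longrightarrow> \<bar>s - a t\<bar> < d1 \<Longrightarrow> angle (\<gamma> s) (\<gamma> (a t)) < e / 2"
      using p ab[OF t] half_gt_zero[OF e] unfolding angular_path_angle_iff by meson
    obtain d2 where d2: "d2 > 0" "\<And>s. s \<in> {0..1} \<Longrightarrow> \<bar>s - b t\<bar> < d2 \<Longrightarrow> angle (\<delta> s) (\<delta> (b t)) < e / 2"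
      using q ab[OF t] half_gt_zero[OF e] unfolding angular_path_angle_iff by meson
    show "\<exists>d>0. \<forall>s\<in>{0..1}. \<bar>s - t\<bar> < d \<longrightarrow> angle (\<eta> s) (\<eta> t) < e"
    proof (intro exI conjI ballI impI)
      show "min d1 d2 / 2 > 0" using d1 d2 by simp
      fix s assume s: "s \<in> {0..1}" "\<bar>s - t\<bar> < min d1 d2 / 2"
      have "\<bar>a s - a t\<bar> \<le> 2 * \<bar>s - t\<bar>" "\<bar>b s - b t\<bar> \<le> 2 * \<bar>s - t\<bar>"
        by (auto simp: a_def b_def min_def max_def abs_if)
      hence "angle (\<gamma> (a s)) (\<gamma> (a t)) < e / 2" "angle (\<delta> (b s)) (\<delta> (b t)) < e / 2"
        using s ab[OF s(1)] d1(2)[of "a s"] d2(2)[of "b s"] by simp_all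
      thus "angle (\<eta> s) (\<eta> t) < e" using le[OF s(1) t] by linarith
    qed
  qed
  hence "Tits_dist u w \<le> angular_length \<eta>" by (rule Tits_dist_le_length)
  also have "\<dots> \<le> angular_length \<gamma> + angular_length \<delta>"
    unfolding angular_length_def[of \<eta>]
  proof (rule Sup_least)
    fix x assume "x \<in> {\<Sum>i<n. angular_dist (\<eta> (t i)) (\<eta> (t (Suc i))) | (n::nat) t. t 0 = 0 \<and> t n = 1 \<and> mono_on {..n} t}"
    then obtain n :: nat and t where x: "x = (\<Sum>i<n. angular_dist (\<eta> (t i)) (\<eta> (t (Suc i))))"
      and t: "t 0 = 0" "t n = 1" "mono_on {..n} t" by blast
    note ti = partition_in_unit[OF t]
    have "x \<le> (\<Sum>i<n. angular_dist (\<gamma> (a (t i))) (\<gamma> (a (t (Suc i)))) + angular_dist (\<delta> (b (t i))) (\<delta> (b (t (Suc i)))))"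
      unfolding x
    proof (rule sum_mono)
      fix i assume "i \<in> {..<n}"
      hence i: "t i \<in> {0..1}" "t (Suc i) \<in> {0..1}" using ti by auto
      show "angular_dist (\<eta> (t i)) (\<eta> (t (Suc i)))
          \<le> angular_dist (\<gamma> (a (t i))) (\<gamma> (a (t (Suc i)))) + angular_dist (\<delta> (b (t i))) (\<delta> (b (t (Suc i))))"
        using le[OF i] i by (simp add: angular_dist_eq \<eta>_in \<gamma>_in \<delta>_in)
    qed
    also have "\<dots> = (\<Sum>i<n. angular_dist (\<gamma> (a (t i))) (\<gamma> (a (t (Suc i))))) + (\<Sum>i<n. angular_dist (\<delta> (b (t i))) (\<delta> (b (t (Suc i)))))"
      by (rule sum.distrib)
    also have "\<dots> \<le> angular_length \<gamma> + angular_length \<delta>"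
    proof (rule add_mono)
      have "mono_on {..n} (\<lambda>i. a (t i))" "mono_on {..n} (\<lambda>i. b (t i))"
        using monotone_onD[OF t(3)] by (auto simp: a_def b_def intro!: monotone_onI min.mono max.mono)
      moreover have "a (t 0) = 0" "a (t n) = 1" "b (t 0) = 0" "b (t n) = 1"
        using t by (simp_all add: a_def b_def)
      ultimately show "(\<Sum>i<n. angular_dist (\<gamma> (a (t i))) (\<gamma> (a (t (Suc i))))) \<le> angular_length \<gamma>"
        "(\<Sum>i<n. angular_dist (\<delta> (b (t i))) (\<delta> (b (t (Suc i))))) \<le> angular_length \<delta>"
        using angular_length_ge[of "\<lambda>i. a (t i)" n \<gamma>] angular_length_ge[of "\<lambda>i. b (t i)" n \<delta>] by simp_all
    qed
    finally show "x \<le> angular_length \<gamma> + angular_length \<delta>" .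
  qed
  finally show ?thesis .
qed

lemma Tits_dist_triangle:
  fixes u v w :: "'a ideal_point"
  shows "Tits_dist u w \<le> Tits_dist u v + Tits_dist v w"
proof (cases "Tits_dist u v = \<infinity> \<or> Tits_dist v w = \<infinity>")
  case True
  thus ?thesis using Tits_dist_nonneg[of u v] Tits_dist_nonneg[of v w] by auto
next
  case False
  show ?thesis
  proof (rule ereal_le_epsilon2)
    fix e :: real assume e: "e > 0"
    have fin: "\<bar>Tits_dist u v\<bar> \<noteq> \<infinity>" "\<bar>Tits_dist v w\<bar> \<noteq> \<infinity>"
      using False Tits_dist_nonneg[of u v] Tits_dist_nonneg[of v w] by auto
    have inc: "x < x + ereal (e / 2)" if "\<bar>x\<bar> \<noteq> \<infinity>" for x using e that by (cases x) auto
    from inc[OF fin(1)] inc[OF fin(2)] obtain \<gamma> \<delta> where \<gamma>: "angular_path \<gamma> u v" "angular_length \<gamma> < Tits_dist u v + ereal (e / 2)"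
      and \<delta>: "angular_path \<delta> v w" "angular_length \<delta> < Tits_dist v w + ereal (e / 2)"
      unfolding Tits_dist_def INF_less_iff by blast
    have "Tits_dist u w \<le> angular_length \<gamma> + angular_length \<delta>" by (rule angular_path_concat[OF \<gamma>(1) \<delta>(1)])
    also have "\<dots> \<le> (Tits_dist u v + ereal (e / 2)) + (Tits_dist v w + ereal (e / 2))"
      using \<gamma>(2) \<delta>(2) by (intro add_mono) auto
    also have "\<dots> = Tits_dist u v + Tits_dist v w + ereal e"
      using fin by (cases "Tits_dist u v"; cases "Tits_dist v w") auto
    finally show "Tits_dist u w \<le> Tits_dist u v + Tits_dist v w + ereal e" .
  qed
qed

text \<open>The point dividing a nearly shortest path into two arcs of angle about \<open>\<pi> / 2\<close> has a limit, and
  the angle is lower semicontinuous for the cone topology.\<close>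

lemma Tits_cball_pi_closed:
  assumes m: "m \<in> visual_boundary" and v: "ideal_tendsto v u" and le: "\<And>i. Tits_dist m (v i) \<le> ereal pi"
  shows "Tits_dist m u \<le> ereal pi"
proof -
  have "\<exists>\<xi>\<in>visual_boundary. angle m \<xi> \<le> pi / 2 \<and> angle \<xi> (v i) \<le> pi / 2 + 1 / (Suc i + 1)" for i
  proof -
    note vi = ideal_tendstoD(1)[OF v, of i]
    show ?thesis
    proof (cases "angle m (v i) \<le> pi / 2")
      case True
      \<comment> \<open>Up to \<pi>/2 there may be no crossing point for the intermediate value
        argument; \<open>v i\<close> itself serves.\<close>
      thus ?thesis using vi by (intro bexI[of _ "v i"]) (auto simp: angle_self add_nonneg_nonneg)
    next
      case False
      \<comment> \<open>The slack makes room for a path that is only nearly shortest. It tends to 0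
        and is at most 1/2, so \<pi>/2 plus the slack stays below \<pi>, where the cosine is
        monotone.\<close>
      have "ereal pi < ereal (pi + 1 / (Suc i + 1))" by simp
      with le[of i] have "Tits_dist m (v i) < ereal (pi + 1 / (Suc i + 1))" by (rule le_less_trans)
      then obtain \<gamma> where \<gamma>: "angular_path \<gamma> m (v i)" "angular_length \<gamma> < ereal (pi + 1 / (Suc i + 1))"
        unfolding Tits_dist_def INF_less_iff by blast
      note \<gamma>' = angular_pathD[OF \<gamma>(1)]
      have "continuous_on {0..1} (\<lambda>s. angle m (\<gamma> s))"
        unfolding continuous_on_iff
      proof (intro ballI allI impI)
        fix t e :: real assume t: "t \<in> {0..1}" and e: "e > 0"
        then obtain d where d: "d > 0" "\<And>s. s \<in> {0..1} \<Longrightarrow> \<bar>s - t\<bar> < d \<Longrightarrow> angle (\<gamma> s) (\<gamma> t) < e"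
          using \<gamma>(1) unfolding angular_path_angle_iff by meson
        show "\<exists>d>0. \<forall>s\<in>{0..1}. dist s t < d \<longrightarrow> dist (angle m (\<gamma> s)) (angle m (\<gamma> t)) < e"
        proof (intro exI conjI ballI impI)
          fix s assume s: "s \<in> {0..1}" "dist s t < d"
          have "angle (\<gamma> s) (\<gamma> t) < e" using d(2)[OF s(1)] s(2) by (simp add: dist_real_def)
          thus "dist (angle m (\<gamma> s)) (angle m (\<gamma> t)) < e"
            using angle_triangle[OF m \<gamma>'(1)[OF s(1)] \<gamma>'(1)[OF t]] angle_triangle[OF m \<gamma>'(1)[OF t] \<gamma>'(1)[OF s(1)]]
              angle_commute[of "\<gamma> s" "\<gamma> t"] by (simp add: dist_real_def abs_less_iff)
        qed (rule d(1))
      qed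
      hence "\<exists>s\<ge>0. s \<le> 1 \<and> angle m (\<gamma> s) = pi / 2"
        using False \<gamma>' m by (intro IVT') (auto simp: angle_self)
      then obtain s where s: "s \<in> {0..1}" "angle m (\<gamma> s) = pi / 2" by auto
      have "ereal (angle m (\<gamma> s) + angle (\<gamma> s) (v i)) < ereal (pi + 1 / (Suc i + 1))"
        using angular_length_ge_three_points[OF \<gamma>(1) s(1)] \<gamma>(2) by (rule le_less_trans)
      hence "angle (\<gamma> s) (v i) \<le> pi / 2 + 1 / (Suc i + 1)" using s(2) by simp
      thus ?thesis using \<gamma>'(1)[OF s(1)] s(2) by (intro bexI[of _ "\<gamma> s"]) auto
    qed
  qed
  then obtain \<xi> where \<xi>: "\<And>i. \<xi> i \<in> visual_boundary" "\<And>i. angle m (\<xi> i) \<le> pi / 2"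
    "\<And>i. angle (\<xi> i) (v i) \<le> pi / 2 + 1 / (Suc i + 1)"
    by metis
  obtain r \<zeta> where r: "strict_mono (r :: nat \<Rightarrow> nat)" and \<zeta>: "ideal_tendsto (\<xi> \<circ> r) \<zeta>"
    using ideal_subseq[of \<xi>] \<xi>(1) by blast
  note u = ideal_tendstoD(2)[OF v] and \<zeta>_in = ideal_tendstoD(2)[OF \<zeta>]
  have half: "1 / (real (Suc i) + 1) \<le> 1 / 2" for i by (simp add: field_simps)
  have "0 \<le> ideal_cos m \<zeta>"
  proof (rule ideal_cos_ge_tendsto[OF ideal_tendsto_const[OF m] \<zeta> tendsto_const])
    show "0 \<le> ideal_cos m ((\<xi> \<circ> r) i)" for i
      using angle_le_iff[OF m \<xi>(1), of "pi / 2" "r i"] \<xi>(2)[of "r i"] by simp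
  qed
  moreover have "0 \<le> ideal_cos \<zeta> u"
  proof (rule ideal_cos_ge_tendsto[OF \<zeta> ideal_tendsto_subseq[OF v r]])
    have "(\<lambda>i. pi / 2 + 1 / (real (Suc i) + 1)) \<longlonglongrightarrow> pi / 2 + 0"
      by (intro tendsto_intros tendsto_divide_0[OF tendsto_const] filterlim_at_top_imp_at_infinity
          filterlim_tendsto_add_at_top[OF tendsto_const, where c = 1, unfolded add.commute[of 1]]
          filterlim_compose[OF filterlim_real_sequentially filterlim_Suc])
    hence "(\<lambda>i. cos (pi / 2 + 1 / (real (Suc i) + 1))) \<longlonglongrightarrow> cos (pi / 2 + 0)" by (rule tendsto_cos)
    from filterlim_comp_strict_mono[OF this r]
    show "(\<lambda>i. cos (pi / 2 + 1 / (real (Suc (r i)) + 1))) \<longlonglongrightarrow> 0" by simp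
    show "cos (pi / 2 + 1 / (real (Suc (r i)) + 1)) \<le> ideal_cos ((\<xi> \<circ> r) i) ((v \<circ> r) i)" for i
    proof -
      have "pi / 2 + 1 / (real (Suc (r i)) + 1) \<le> pi" using half[of "r i"] pi_gt3 by linarith
      moreover have "0 \<le> pi / 2 + 1 / (real (Suc (r i)) + 1)" by (intro add_nonneg_nonneg) auto
      ultimately show ?thesis
        using angle_le_iff[OF \<xi>(1) ideal_tendstoD(1)[OF v], of _ "r i" "r i"] \<xi>(3)[of "r i"] by simp
    qed
  qed
  ultimately have "Tits_dist m u \<le> ereal (pi / 2) + ereal (pi / 2)"
    using Tits_dist_triangle[of m u \<zeta>] Tits_dist_le_half_pi m u \<zeta>_in
    by (meson add_mono order_trans)
  thus ?thesis by simp
qed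

end

section \<open>Isometries, the cone topology and pi-convergence\<close>

lemma isometry_dist: "isometry h \<Longrightarrow> dist (h x) (h y) = dist x y"
  by (simp add: isometry_def)

lemma isometry_bij: "isometry h \<Longrightarrow> bij h"
  unfolding isometry_def bij_def inj_def by (metis dist_eq_0_iff)

lemma isometry_inv_cancel: "isometry h \<Longrightarrow> h (inv h x) = x" "isometry h \<Longrightarrow> inv h (h x) = x"
  by (simp_all add: isometry_bij bij_is_inj bij_is_surj surj_f_inv_f inv_f_f)

lemma isometry_inv: "isometry h \<Longrightarrow> isometry (inv h)"
  using isometry_bij[of h] isometry_dist[of h] isometry_inv_cancel[of h]
  unfolding isometry_def by (metis bij_is_inj inj_imp_surj_inv)

lemma isometry_comp: "isometry g \<Longrightarrow> isometry h \<Longrightarrow> isometry (g \<circ> h)"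
  unfolding isometry_def using comp_surj by auto

lemma isometry_id: "isometry id"
  by (simp add: isometry_def)

lemma isometry_funpow: "isometry h \<Longrightarrow> isometry (h ^^ n)"
  by (induction n) (simp_all add: isometry_comp isometry_id[unfolded id_def] isometry_id)

lemma isometry_int_funpow: "isometry h \<Longrightarrow> isometry (int_funpow h i)"
  by (simp add: int_funpow_def isometry_funpow isometry_inv)

lemma isometry_continuous: "isometry h \<Longrightarrow> (f \<longlongrightarrow> l) F \<Longrightarrow> ((\<lambda>x. h (f x)) \<longlongrightarrow> h l) F"
  by (simp add: tendsto_iff isometry_dist)

lemma isometry_ray: "isometry h \<Longrightarrow> geodesic_ray c \<Longrightarrow> geodesic_ray (h \<circ> c)"
  by (simp add: geodesic_ray_def isometry_dist)

lemma isometry_asymptotic: "isometry h \<Longrightarrow> (c, c') \<in> asymptotic \<Longrightarrow> (h \<circ> c, h \<circ> c') \<in> asymptotic"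
  by (auto simp: asymptotic_def isometry_ray isometry_dist)

lemma boundary_map_class:
  assumes h: "isometry h"
  shows "boundary_map h (asymptotic `` {c}) = asymptotic `` {h \<circ> c}"
proof (intro equalityI subsetI)
  fix d assume "d \<in> asymptotic `` {h \<circ> c}"
  hence "(inv h \<circ> (h \<circ> c), inv h \<circ> d) \<in> asymptotic" using isometry_asymptotic isometry_inv[OF h] by blast
  moreover have "inv h \<circ> (h \<circ> c) = c" "h \<circ> (inv h \<circ> d) = d" using isometry_inv_cancel[OF h] by auto
  ultimately show "d \<in> boundary_map h (asymptotic `` {c})"
    unfolding boundary_map_def by (metis Image_singleton_iff imageI)
qed (auto simp: boundary_map_def isometry_asymptotic[OF h])

lemma boundary_map_in:
  assumes h: "isometry h" and u: "u \<in> visual_boundary"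
  shows "boundary_map h u \<in> visual_boundary"
proof -
  obtain c where "geodesic_ray c" "u = asymptotic `` {c}"
    using u by (auto simp: visual_boundary_def quotient_def)
  thus ?thesis using boundary_map_class[OF h] boundary_class(1) isometry_ray[OF h] by metis
qed

lemma boundary_map_mem: "c \<in> u \<Longrightarrow> h \<circ> c \<in> boundary_map h u"
  by (simp add: boundary_map_def)

lemma boundary_map_comp: "boundary_map (g \<circ> h) u = boundary_map g (boundary_map h u)"
  by (simp add: boundary_map_def image_image comp_assoc)

lemma boundary_map_id: "boundary_map id u = u"
  by (simp add: boundary_map_def)

lemma boundary_map_inv:
  assumes "isometry h"
  shows "boundary_map h (boundary_map (inv h) u) = u" "boundary_map (inv h) (boundary_map h u) = u"
  using isometry_bij[OF assms]
  by (simp_all flip: boundary_map_comp add: bij_is_surj bij_is_inj surj_iff[THEN iffD1] boundary_map_id)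

section \<open>The cone topology of the boundary through sequences\<close>

lemma openin_cone_nbhd: "geodesic_ray c \<Longrightarrow> r > 0 \<Longrightarrow> e > 0 \<Longrightarrow> openin cone_topology (cone_nbhd c r e)"
  unfolding cone_topology_def by (rule topology_generated_by_Basis) blast

lemma topspace_boundary:
  "topspace boundary_topology = (visual_boundary :: 'a::metric_space ideal_point set)"
proof -
  have "Inr u \<in> topspace cone_topology" if u: "u \<in> visual_boundary" for u :: "'a ideal_point"
  proof -
    obtain c where c: "c \<in> u" using boundary_nonempty[OF u] by blast
    have "Inr u \<in> cone_nbhd c 1 1" unfolding cone_nbhd_def using c u by (auto intro!: bexI[of _ c])
    moreover have "geodesic_ray c" using boundary_ray u c by blast
    ultimately show ?thesis using openin_subset[OF openin_cone_nbhd[of c 1 1]] by auto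
  qed
  thus ?thesis unfolding boundary_topology_def topspace_pullback_topology by auto
qed

lemma openin_boundary_nbhd:
  assumes "geodesic_ray c" "r > 0" "e > 0"
  shows "openin boundary_topology (visual_boundary \<inter> Inr -` cone_nbhd c r e)"
  unfolding boundary_topology_def openin_pullback_topology using openin_cone_nbhd[OF assms] by blast

context proper_CAT0
begin

lemma Inr_in_cone_nbhd:
  fixes u :: "'a ideal_point"
  assumes u: "u \<in> visual_boundary" and "r > 0"
  shows "Inr u \<in> cone_nbhd c r e \<longleftrightarrow> dist (ray_from (c 0) u r) (c r) < e"
proof
  assume "Inr u \<in> cone_nbhd c r e"
  then obtain c' where "c' \<in> u" "c' 0 = c 0" "dist (c' r) (c r) < e" by (auto simp: cone_nbhd_def)
  thus "dist (ray_from (c 0) u r) (c r) < e" using ray_from_eq[OF u, of c' r] assms by simp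
next
  assume "dist (ray_from (c 0) u r) (c r) < e"
  thus "Inr u \<in> cone_nbhd c r e" using ray_from[OF u, of "c 0"] u by (auto simp: cone_nbhd_def)
qed

lemma Inl_in_cone_nbhd:
  fixes x :: 'a
  assumes "r > 0"
  shows "Inl x \<in> cone_nbhd c r e \<longleftrightarrow> r < dist (c 0) x \<and> dist (seg (c 0) x r) (c r) < e"
proof
  assume "Inl x \<in> cone_nbhd c r e"
  then obtain g where "r < dist (c 0) x" "geodesic g (c 0) x" "dist (g r) (c r) < e" by (auto simp: cone_nbhd_def)
  thus "r < dist (c 0) x \<and> dist (seg (c 0) x r) (c r) < e"
    using geodesic_unique[OF geodesic_seg, of g "c 0" x r] assms by simp
next
  assume "r < dist (c 0) x \<and> dist (seg (c 0) x r) (c r) < e"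
  thus "Inl x \<in> cone_nbhd c r e" using geodesic_seg[of "c 0" x] by (auto simp: cone_nbhd_def)
qed

lemma ideal_tendsto_eventually:
  assumes w: "ideal_tendsto w u" and U: "openin boundary_topology U" "u \<in> U"
  shows "eventually (\<lambda>i. w i \<in> U) sequentially"
proof -
  obtain V where V: "openin cone_topology V" "U = Inr -` V \<inter> visual_boundary"
    using U(1) unfolding boundary_topology_def openin_pullback_topology by blast
  have "generate_topology_on ({Inl ` ball x r | x r. r > 0} \<union>
      {cone_nbhd c r e | c r e. geodesic_ray c \<and> r > 0 \<and> e > 0}) V"
    using V(1) unfolding cone_topology_def openin_topology_generated_by_iff .
  hence "Inr u \<in> V \<longrightarrow> eventually (\<lambda>i. Inr (w i) \<in> V) sequentially"
  proof induction
    case (Int a b)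
    thus ?case by (auto intro: eventually_conj simp: eventually_conj_iff)
  next
    case (UN K)
    show ?case
    proof
      assume "Inr u \<in> \<Union>K"
      then obtain k where k: "k \<in> K" "Inr u \<in> k" by blast
      with UN have "eventually (\<lambda>i. Inr (w i) \<in> k) sequentially" by blast
      thus "eventually (\<lambda>i. Inr (w i) \<in> \<Union>K) sequentially" by eventually_elim (use k in blast)
    qed
  next
    case (Basis s)
    show ?case
    proof
      assume us: "Inr u \<in> s"
      \<comment> \<open>Metric balls contain no ideal points, so the basic set is a cone
        neighbourhood.\<close>
      with Basis obtain c r e where s: "s = cone_nbhd c r e" "geodesic_ray c" "r > 0" "e > 0" by blast
      have "dist (ray_from (c 0) u r) (c r) < e"
        using us Inr_in_cone_nbhd[OF ideal_tendstoD(2)[OF w] s(3)] by (simp add: s)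
      moreover have "(\<lambda>i. dist (ray_from (c 0) (w i) r) (c r)) \<longlonglongrightarrow> dist (ray_from (c 0) u r) (c r)"
        using s by (intro tendsto_intros ideal_tendstoD(3)[OF w]) auto
      ultimately have "eventually (\<lambda>i. dist (ray_from (c 0) (w i) r) (c r) < e) sequentially"
        using order_tendstoD(2) by blast
      thus "eventually (\<lambda>i. Inr (w i) \<in> s) sequentially"
        by eventually_elim (use Inr_in_cone_nbhd[OF ideal_tendstoD(1)[OF w] s(3)] s in simp)
    qed
  qed auto
  with V U have "eventually (\<lambda>i. Inr (w i) \<in> V) sequentially" by blast
  thus ?thesis by eventually_elim (use V ideal_tendstoD(1)[OF w] in auto)
qed

text \<open>The sets \<open>N n\<close> shrink to \<open>u\<close> along a single ray: closeness at
  time \<open>Suc n\<close> gives closeness at all earlier times by contraction. So the boundary is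
  first countable and sequences detect open sets.\<close>

lemma openin_boundaryI:
  assumes sub: "\<Omega> \<subseteq> visual_boundary"
    and seq: "\<And>w u. ideal_tendsto w u \<Longrightarrow> (\<And>i. w i \<notin> \<Omega>) \<Longrightarrow> u \<notin> \<Omega>"
  shows "openin boundary_topology \<Omega>"
proof (subst openin_subopen, intro ballI)
  fix u assume u\<Omega>: "u \<in> \<Omega>"
  hence u: "u \<in> visual_boundary" using sub by blast
  define p :: 'a where "p = undefined"
  define N where "N n = visual_boundary \<inter> Inr -` cone_nbhd (ray_from p u) (real (Suc n)) (1 / real (Suc n))" for n
  have open_N: "openin boundary_topology (N n)" for n
    unfolding N_def by (rule openin_boundary_nbhd) (use ray_from[OF u, of p] in auto)
  have uN: "u \<in> N n" for n
    using Inr_in_cone_nbhd[OF u, of "real (Suc n)"] u ray_from[OF u, of p] by (simp add: N_def)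
  have "\<exists>n. N n \<subseteq> \<Omega>"
  proof (rule ccontr)
    assume "\<nexists>n. N n \<subseteq> \<Omega>"
    hence "\<forall>n. \<exists>w. w \<in> N n \<and> w \<notin> \<Omega>" by blast
    then obtain w where w: "\<And>n. w n \<in> N n" "\<And>n. w n \<notin> \<Omega>" by metis
    have w_in: "w n \<in> visual_boundary" for n using w(1)[of n] by (simp add: N_def)
    have near: "dist (ray_from p (w n) (real (Suc n))) (ray_from p u (real (Suc n))) < 1 / real (Suc n)" for n
      using w(1)[of n] Inr_in_cone_nbhd[OF w_in, of "real (Suc n)" n "ray_from p u"] ray_from[OF u, of p]
      by (simp add: N_def)
    have "ideal_tendsto w u"
    proof (rule ideal_tendstoI[OF w_in u])
      fix t :: real assume t: "t \<ge> 0"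
      show "(\<lambda>i. ray_from p (w i) t) \<longlonglongrightarrow> ray_from p u t"
      proof (rule metric_tendsto_imp_tendsto[OF lim_inverse_n'])
        show "eventually (\<lambda>i. dist (ray_from p (w i) t) (ray_from p u t) \<le> dist (1 / real i) 0) sequentially"
          using eventually_ge_at_top[of "Suc (nat \<lceil>t\<rceil>)"]
        proof eventually_elim
          case (elim i)
          hence i: "t \<le> real (Suc i)" "i > 0" by linarith+
          have "dist (ray_from p (w i) t) (ray_from p u t)
            \<le> t / real (Suc i) * dist (ray_from p (w i) (real (Suc i))) (ray_from p u (real (Suc i)))"
            using ray_from[OF w_in, of p] ray_from[OF u, of p] t i
            by (intro same_origin_contraction geodesic_ray_unit_speed) auto
          also have "\<dots> \<le> 1 * (1 / real (Suc i))"
            using near[of i] t i by (intro mult_mono) auto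
          also have "\<dots> \<le> 1 / real i" using i by (simp add: field_simps)
          finally show ?case by simp
        qed
      qed
    qed
    from seq[OF this w(2)] u\<Omega> show False by blast
  qed
  thus "\<exists>T. openin boundary_topology T \<and> u \<in> T \<and> T \<subseteq> \<Omega>" using open_N uN by blast
qed

text \<open>Were \<open>u\<close> outside, \<open>K\<close> would be covered by the open sets of
  points whose ray differs from that of \<open>u\<close> by more than \<open>e\<close> at time
  \<open>r\<close>. Finitely many suffice, and the sequence eventually leaves each of them.\<close>

lemma compactin_boundary_seq:
  assumes K: "compactin boundary_topology K" and w: "\<And>i. w i \<in> K" and lim: "ideal_tendsto w u"
  shows "u \<in> K"
proof (rule ccontr)
  assume uK: "u \<notin> K"
  have K_in: "K \<subseteq> visual_boundary" using compactin_subset_topspace[OF K] by (simp add: topspace_boundary)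
  note u = ideal_tendstoD(2)[OF lim]
  define p :: 'a where "p = undefined"
  define O' where "O' r e = {v \<in> visual_boundary. dist (ray_from p v r) (ray_from p u r) > e}" for r e
  have "\<exists>r e. r > 0 \<and> e > 0 \<and> v \<in> O' r e" if v: "v \<in> K" for v
  proof -
    have v_in: "v \<in> visual_boundary" using v K_in by blast
    have "\<exists>r>0. ray_from p v r \<noteq> ray_from p u r"
    proof (rule ccontr)
      assume "\<not> ?thesis"
      hence "dist (ray_from p v t) (ray_from p u t) \<le> 0" if "t \<ge> 0" for t
        using that ray_from_0[OF u] ray_from_0[OF v_in] by (cases "t = 0") auto
      hence "(ray_from p v, ray_from p u) \<in> asymptotic"
        using ray_from_ray u v_in by (auto simp: asymptotic_def)
      hence "v = u" using boundary_eqI u v_in ray_from_in by blast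
      with v uK show False by simp
    qed
    then obtain r where "r > 0" "dist (ray_from p v r) (ray_from p u r) > 0" by auto
    thus ?thesis unfolding O'_def using v_in by (intro exI[of _ r] exI[of _ "dist (ray_from p v r) (ray_from p u r) / 2"]) auto
  qed
  hence cover: "K \<subseteq> \<Union> {O' r e | r e. r > 0 \<and> e > 0}" by blast
  have open_O: "openin boundary_topology (O' r e)" if "r > 0" for r e
  proof (rule openin_boundaryI)
    fix z v assume z: "ideal_tendsto z v" and out: "\<And>i. z i \<notin> O' r e"
    have "dist (ray_from p v r) (ray_from p u r) \<le> e"
    proof (rule tendsto_upperbound)
      show "(\<lambda>i. dist (ray_from p (z i) r) (ray_from p u r)) \<longlonglongrightarrow> dist (ray_from p v r) (ray_from p u r)"
        using that by (intro tendsto_intros ideal_tendstoD(3)[OF z]) auto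
    qed (use out ideal_tendstoD(1)[OF z] in \<open>auto simp: O'_def not_less\<close>)
    thus "v \<notin> O' r e" by (simp add: O'_def)
  qed (auto simp: O'_def)
  obtain F where F: "finite F" "F \<subseteq> {O' r e | r e. r > 0 \<and> e > 0}" "K \<subseteq> \<Union>F"
    using K cover open_O unfolding compactin_def by (smt (verit, ccfv_threshold) mem_Collect_eq)
  have "\<forall>A\<in>F. eventually (\<lambda>i. w i \<notin> A) sequentially"
  proof
    fix A assume "A \<in> F"
    then obtain r e where A: "A = O' r e" "r > 0" "e > 0" using F by blast
    have "(\<lambda>i. dist (ray_from p (w i) r) (ray_from p u r)) \<longlonglongrightarrow> dist (ray_from p u r) (ray_from p u r)"
      using A by (intro tendsto_intros ideal_tendstoD(3)[OF lim]) auto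
    hence "eventually (\<lambda>i. dist (ray_from p (w i) r) (ray_from p u r) < e) sequentially"
      using A order_tendstoD(2) by fastforce
    thus "eventually (\<lambda>i. w i \<notin> A) sequentially" by eventually_elim (simp add: A O'_def)
  qed
  hence "eventually (\<lambda>i. \<forall>A\<in>F. w i \<notin> A) sequentially" using F by (simp add: eventually_ball_finite)
  then obtain i where "\<forall>A\<in>F. w i \<notin> A" by (auto simp: eventually_sequentially)
  with w F show False by blast
qed

lemma limitin_points_tendsto:
  fixes u :: "'a ideal_point"
  assumes u: "u \<in> visual_boundary" and lim: "limitin cone_topology (\<lambda>i. Inl (y i)) (Inr u) sequentially"
  shows "points_tendsto p y u"
proof -
  have ev: "eventually (\<lambda>i. r < dist p (y i) \<and> dist (seg p (y i) r) (ray_from p u r) < e) sequentially"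
    if "r > 0" "e > 0" for r e
  proof -
    have "Inr u \<in> cone_nbhd (ray_from p u) r e"
      using that Inr_in_cone_nbhd[OF u] ray_from[OF u, of p] by simp
    moreover have "openin cone_topology (cone_nbhd (ray_from p u) r e)"
      using that ray_from[OF u] by (intro openin_cone_nbhd) auto
    ultimately have "eventually (\<lambda>i. Inl (y i) \<in> cone_nbhd (ray_from p u) r e) sequentially"
      using lim unfolding limitin_def by blast
    thus ?thesis using Inl_in_cone_nbhd[OF that(1)] ray_from_0[OF u] by simp
  qed
  show ?thesis unfolding points_tendsto_def
  proof (intro conjI allI impI u)
    show "filterlim (\<lambda>i. dist p (y i)) at_top sequentially"
      unfolding filterlim_at_top_gt[of _ _ 0]
    proof (intro allI impI)
      fix Z :: real assume "Z > 0"
      from ev[OF this, of 1] have "eventually (\<lambda>i. Z < dist p (y i) \<and> dist (seg p (y i) Z) (ray_from p u Z) < 1) sequentially"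
        by simp
      thus "eventually (\<lambda>i. Z \<le> dist p (y i)) sequentially" by eventually_elim auto
    qed
    fix t :: real assume t: "t \<ge> 0"
    show "(\<lambda>i. seg p (y i) t) \<longlonglongrightarrow> ray_from p u t"
    proof (cases "t = 0")
      case True
      thus ?thesis using seg_0 ray_from_0[OF u] by simp
    next
      case False
      with t have "t > 0" by simp
      show ?thesis unfolding tendsto_iff
      proof (intro allI impI)
        fix e :: real assume "e > 0"
        from ev[OF \<open>t > 0\<close> this] show "eventually (\<lambda>i. dist (seg p (y i) t) (ray_from p u t) < e) sequentially"
          by eventually_elim auto
      qed
    qed
  qed
qed

section \<open>Isometries acting on the boundary\<close>

lemma ray_from_boundary_map:
  fixes u :: "'a ideal_point"
  assumes "isometry h" "u \<in> visual_boundary" "t \<ge> 0"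
  shows "ray_from (h p) (boundary_map h u) t = h (ray_from p u t)"
  using ray_from_eq[OF boundary_map_in[OF assms(1,2)] boundary_map_mem[OF ray_from_in[OF assms(2), of p]] assms(3)]
    ray_from_0[OF assms(2)] by simp

lemma ideal_cos_boundary_map:
  fixes u v :: "'a ideal_point"
  assumes h: "isometry h" and u: "u \<in> visual_boundary" and v: "v \<in> visual_boundary"
  shows "ideal_cos (boundary_map h u) (boundary_map h v) = ideal_cos u v"
proof -
  define c c' where "c = ray_from undefined u" and "c' = ray_from undefined v"
  have c: "c \<in> u" "c' \<in> v" using ray_from_in u v by (auto simp: c_def c'_def)
  have "comp_cos (h \<circ> c) (h \<circ> c') t t = comp_cos c c' t t" for t by (simp add: comp_cos_def isometry_dist[OF h])
  hence "((\<lambda>t. comp_cos c c' t t) \<longlongrightarrow> ideal_cos (boundary_map h u) (boundary_map h v)) at_top"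
    using ideal_cos_tendsto[OF boundary_map_in[OF h u] boundary_map_mem[OF c(1), of h]
        boundary_map_in[OF h v] boundary_map_mem[OF c(2), of h]] by simp
  from tendsto_unique[OF _ this ideal_cos_tendsto[OF u c(1) v c(2)]] show ?thesis by simp
qed

lemma angle_boundary_map:
  assumes "isometry h" "u \<in> visual_boundary" "v \<in> visual_boundary"
  shows "angle (boundary_map h u) (boundary_map h v) = angle u v"
  using ideal_cos_boundary_map[OF assms] by (simp add: angle_def)

lemma Tits_dist_boundary_map_le:
  fixes u v :: "'a ideal_point"
  assumes h: "isometry h"
  shows "Tits_dist (boundary_map h u) (boundary_map h v) \<le> Tits_dist u v"
  unfolding Tits_dist_def[of u v]
proof (rule INF_greatest)
  fix \<gamma> :: "real \<Rightarrow> 'a ideal_point" assume "\<gamma> \<in> {\<gamma>. angular_path \<gamma> u v}"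
  hence p: "angular_path \<gamma> u v" by simp
  let ?\<gamma> = "\<lambda>t. boundary_map h (\<gamma> t)"
  have a: "angle (?\<gamma> s) (?\<gamma> t) = angle (\<gamma> s) (\<gamma> t)" and d: "angular_dist (?\<gamma> s) (?\<gamma> t) = angular_dist (\<gamma> s) (\<gamma> t)"
    if "s \<in> {0..1}" "t \<in> {0..1}" for s t
    using angle_boundary_map[OF h] angular_pathD(1)[OF p] boundary_map_in[OF h] that by (simp_all add: angular_dist_eq)
  have "angular_path ?\<gamma> (boundary_map h u) (boundary_map h v)"
    using p a boundary_map_in[OF h] unfolding angular_path_angle_iff by (auto simp: image_subset_iff)
  hence "Tits_dist (boundary_map h u) (boundary_map h v) \<le> angular_length ?\<gamma>" by (rule Tits_dist_le_length)
  also have "\<dots> \<le> angular_length \<gamma>"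
    unfolding angular_length_def[of ?\<gamma>]
  proof (rule Sup_least)
    fix x assume "x \<in> {\<Sum>i<n. angular_dist (?\<gamma> (t i)) (?\<gamma> (t (Suc i))) | (n::nat) t. t 0 = 0 \<and> t n = 1 \<and> mono_on {..n} t}"
    then obtain n :: nat and t where x: "x = (\<Sum>i<n. angular_dist (?\<gamma> (t i)) (?\<gamma> (t (Suc i))))"
      and t: "t 0 = 0" "t n = 1" "mono_on {..n} t" by blast
    have "x = (\<Sum>i<n. angular_dist (\<gamma> (t i)) (\<gamma> (t (Suc i))))"
      unfolding x using partition_in_unit[OF t] by (intro sum.cong refl d) auto
    also have "\<dots> \<le> angular_length \<gamma>" using t by (intro angular_length_ge)
    finally show "x \<le> angular_length \<gamma>" .
  qed
  finally show "Tits_dist (boundary_map h u) (boundary_map h v) \<le> angular_length \<gamma>" .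
qed

lemma Tits_dist_boundary_map:
  fixes u v :: "'a ideal_point"
  assumes h: "isometry h"
  shows "Tits_dist (boundary_map h u) (boundary_map h v) = Tits_dist u v"
proof (rule antisym[OF Tits_dist_boundary_map_le[OF h]])
  show "Tits_dist u v \<le> Tits_dist (boundary_map h u) (boundary_map h v)"
    using Tits_dist_boundary_map_le[OF isometry_inv[OF h], of "boundary_map h u" "boundary_map h v"]
      boundary_map_inv[OF h] by simp
qed

lemma ideal_tendsto_boundary_map:
  assumes h: "isometry h" and w: "ideal_tendsto w u"
  shows "ideal_tendsto (\<lambda>i. boundary_map h (w i)) (boundary_map h u)"
proof (rule ideal_tendstoI[where p = "h undefined"])
  note in_bd = ideal_tendstoD(1,2)[OF w]
  show "boundary_map h (w i) \<in> visual_boundary" for i using boundary_map_in[OF h] in_bd by blast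
  show "boundary_map h u \<in> visual_boundary" using boundary_map_in[OF h] in_bd by blast
  fix t :: real assume t: "t \<ge> 0"
  show "(\<lambda>i. ray_from (h undefined) (boundary_map h (w i)) t) \<longlonglongrightarrow> ray_from (h undefined) (boundary_map h u) t"
    using isometry_continuous[OF h ideal_tendstoD(3)[OF w t, of undefined]]
    by (simp add: ray_from_boundary_map[OF h] in_bd t)
qed

text \<open>At distance \<open>R n\<close> from \<open>p\<close> the segment to \<open>c n\<close>
  and the ray from \<open>p\<close> to \<open>u\<close> are within \<open>2 * \<delta>\<close>;
  contraction towards \<open>p\<close> makes them merge at every fixed time.\<close>

lemma points_tendsto_along_ray:
  fixes u :: "'a ideal_point"
  assumes u: "u \<in> visual_boundary" and c: "c \<in> u"
  shows "points_tendsto p (\<lambda>n. c (real n)) u"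
proof -
  define \<delta> where "\<delta> = dist p (c 0)"
  define R where "R n = dist p (c (real n))" for n
  have ray: "geodesic_ray c" using boundary_ray u c by blast
  have R: "\<bar>real n - R n\<bar> \<le> \<delta>" for n
    using dist_triangle[of p "c (real n)" "c 0"] dist_triangle[of "c 0" "c (real n)" p]
      geodesic_ray_dist0[OF ray, of "real n"] by (auto simp: R_def \<delta>_def dist_commute)
  have Rtop: "filterlim R at_top sequentially"
  proof (rule filterlim_at_top_mono)
    show "filterlim (\<lambda>n. - \<delta> + real n) at_top sequentially"
      by (intro filterlim_tendsto_add_at_top[OF tendsto_const] filterlim_real_sequentially)
    show "eventually (\<lambda>n. - \<delta> + real n \<le> R n) sequentially"
      using R by (intro always_eventually allI) (smt (verit))
  qed
  show ?thesis unfolding points_tendsto_def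
  proof (intro conjI allI impI u)
    show "filterlim (\<lambda>i. dist p (c (real i))) at_top sequentially" using Rtop by (simp add: R_def[abs_def])
    fix t :: real assume t: "t \<ge> 0"
    define e where "e = ray_from p u"
    have e: "e \<in> u" "e 0 = p" "geodesic_ray e" using ray_from[OF u, of p] by (auto simp: e_def)
    have "(\<lambda>n. dist (seg p (c (real n)) t) (e t)) \<longlonglongrightarrow> 0"
    proof (rule Lim_null_comparison)
      show "(\<lambda>n. t * (2 * \<delta>) / R n) \<longlonglongrightarrow> 0"
        by (intro tendsto_divide_0[OF tendsto_const] filterlim_at_top_imp_at_infinity Rtop)
      have "eventually (\<lambda>n. t + 1 \<le> R n) sequentially" using Rtop by (simp add: filterlim_at_top)
      thus "eventually (\<lambda>n. norm (dist (seg p (c (real n)) t) (e t)) \<le> t * (2 * \<delta>) / R n) sequentially"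
      proof eventually_elim
        case (elim n)
        have pos: "R n > 0" using elim t by linarith
        have "dist (c (real n)) (e (real n)) \<le> \<delta>"
          using boundary_dist_le[OF u c e(1), of "real n"] e by (simp add: \<delta>_def dist_commute)
        moreover have "dist (e (real n)) (e (R n)) = \<bar>real n - R n\<bar>"
          using geodesic_rayD[OF e(3)] pos by simp
        ultimately have "dist (c (real n)) (e (R n)) \<le> 2 * \<delta>"
          using R[of n] dist_triangle[of "c (real n)" "e (R n)" "e (real n)"] by linarith
        hence "dist (seg p (c (real n)) (R n)) (e (R n)) \<le> 2 * \<delta>" by (simp add: R_def seg_dist)
        moreover have "dist (seg p (c (real n)) t) (e t) \<le> t / R n * dist (seg p (c (real n)) (R n)) (e (R n))"
          using elim t pos seg[of p "c (real n)"] e geodesic_ray_unit_speed[OF e(3), of "R n"]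
          by (intro same_origin_contraction) (auto simp: R_def)
        ultimately have "dist (seg p (c (real n)) t) (e t) \<le> t / R n * (2 * \<delta>)"
          using t pos by (meson divide_nonneg_pos mult_left_mono order_trans)
        thus ?case by simp
      qed
    qed
    thus "(\<lambda>i. seg p (c (real i)) t) \<longlonglongrightarrow> ray_from p u t"
      unfolding e_def using tendsto_dist_iff by blast
  qed
qed

text \<open>In the triangle with vertices \<open>p\<close>, \<open>g p\<close> and a far away point in the direction of \<open>g u\<close> the
  angles at \<open>p\<close> and \<open>g p\<close> almost add up to \<open>\<pi>\<close>, and the latter is the angle at \<open>p\<close> between
  \<open>inv g p\<close> and the direction of \<open>u\<close>.\<close>

lemma comp_cos_displaced_ge:
  fixes u :: "'a ideal_point"
  assumes g: "isometry g" and u: "u \<in> visual_boundary"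
    and T: "T > 0" "T \<le> dist p (g p)" and less: "comp_cos (ray_from p u) (seg p (inv g p)) T T < a"
    and t: "t > 0"
  shows "- a \<le> comp_cos (seg p (g p)) (ray_from p (boundary_map g u)) (dist p (g p)) t"
proof -
  define L where "L = dist p (g p)"
  have L: "dist p (inv g p) = L" "L > 0"
    using isometry_dist[OF g, of p "inv g p"] isometry_inv_cancel[OF g] T by (auto simp: L_def dist_commute)
  define c where "c = ray_from p u"
  have c: "c \<in> u" "c 0 = p" "geodesic_ray c" using ray_from[OF u, of p] by (auto simp: c_def)
  note w = boundary_map_in[OF g u]
  have lim: "points_tendsto p (\<lambda>n. (g \<circ> c) (real n)) (boundary_map g u)"
    by (rule points_tendsto_along_ray[OF w boundary_map_mem[OF c(1)]])
  define R where "R n = dist p (g (c (real n)))" for n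
  have Rtop: "filterlim R at_top sequentially" using points_tendstoD(2)[OF lim] by (simp add: R_def[abs_def])
  \<comment> \<open>Applying \<open>inv g\<close> moves the triangle \<open>p\<close>,
    \<open>g p\<close>, \<open>g (c n)\<close> to \<open>inv g p\<close>, \<open>p\<close>,
    \<open>c n\<close>, where the hypothesis controls the angle at \<open>p\<close>.\<close>
  have R_eq: "R n = dist (inv g p) (c (real n))" for n
    using isometry_dist[OF g, of "inv g p" "c (real n)"] isometry_inv_cancel[OF g] by (simp add: R_def)
  have nR: "\<bar>real n - R n\<bar> \<le> L" for n
    using geodesic_ray_dist0[OF c(3), of "real n"] c(2) L dist_triangle[of p "c (real n)" "inv g p"]
      dist_triangle[of "inv g p" "c (real n)" p] by (auto simp: R_eq dist_commute)
  show ?thesis unfolding L_def[symmetric]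
  proof (rule tendsto_le[of sequentially])
    show "(\<lambda>n. comp_cos (seg p (g p)) (seg p ((g \<circ> c) (real n))) L t) \<longlonglongrightarrow> comp_cos (seg p (g p)) (ray_from p (boundary_map g u)) L t"
      using t L by (intro tendsto_comp_cos tendsto_const points_tendstoD(3)[OF lim]) auto
    have "(\<lambda>n. - a - \<bar>a\<bar> * L / R n) \<longlonglongrightarrow> - a - 0"
      by (intro tendsto_intros tendsto_divide_0[OF tendsto_const] filterlim_at_top_imp_at_infinity Rtop)
    thus "(\<lambda>n. - a - \<bar>a\<bar> * L / R n) \<longlonglongrightarrow> - a" by simp
    have "eventually (\<lambda>n. t \<le> R n) sequentially" using Rtop by (simp add: filterlim_at_top)
    moreover have "eventually (\<lambda>n. T \<le> real n) sequentially"
      using filterlim_real_sequentially by (simp add: filterlim_at_top)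
    ultimately show "eventually (\<lambda>n. - a - \<bar>a\<bar> * L / R n \<le> comp_cos (seg p (g p)) (seg p ((g \<circ> c) (real n))) L t) sequentially"
    proof eventually_elim
      case (elim n)
      have pos: "R n > 0" "real n > 0" using elim t T by linarith+
      have "comp_cos c (seg p (inv g p)) (real n) L \<le> comp_cos c (seg p (inv g p)) T T"
        using elim T c L seg[of p "inv g p"] geodesic_ray_unit_speed[OF c(3)]
        by (intro comp_cos_antimono) (auto simp: L_def)
      also have "\<dots> < a" using less by (simp add: c_def)
      finally have "(real n)\<^sup>2 + L\<^sup>2 - 2 * real n * L * a < (dist (c (real n)) (seg p (inv g p) L))\<^sup>2"
        using pos L by (simp add: comp_cos_less_iff)
      hence *: "(real n)\<^sup>2 + L\<^sup>2 - 2 * real n * L * a \<le> (R n)\<^sup>2"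
        using seg_dist[of p "inv g p"] L by (simp add: R_eq dist_commute)
      \<comment> \<open>The lower bound on \<open>R n\<close> is read as an upper bound on
        \<open>n\<close>, the side opposite to \<open>p\<close> in the original triangle. Replacing
        \<open>n\<close> by \<open>R n\<close> in the mixed term costs
        \<open>\<bar>a\<bar> * L / R n\<close>, which vanishes in the limit.\<close>
      have "a * (real n - R n) \<le> \<bar>a\<bar> * L"
        using nR[of n] by (metis abs_ge_self abs_ge_zero abs_mult mult_left_mono order_trans)
      hence "2 * L * (a * (real n - R n)) \<le> 2 * L * (\<bar>a\<bar> * L)" using L by (intro mult_left_mono) auto
      hence "2 * real n * L * a \<le> 2 * L * R n * a + 2 * L * (\<bar>a\<bar> * L)" by (simp add: algebra_simps)
      moreover have "2 * L * R n * (- a - \<bar>a\<bar> * L / R n) = - 2 * L * R n * a - 2 * L * (\<bar>a\<bar> * L)"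
        using pos by (simp add: field_simps)
      ultimately have "(real n)\<^sup>2 \<le> L\<^sup>2 + (R n)\<^sup>2 - 2 * L * R n * (- a - \<bar>a\<bar> * L / R n)"
        using * zero_le_power2[of L] by linarith
      moreover have "dist (seg p (g p) L) (seg p ((g \<circ> c) (real n)) (R n)) = real n"
        using seg_dist[of p "g p"] seg_dist[of p "g (c (real n))"] isometry_dist[OF g, of p "c (real n)"]
          geodesic_ray_dist0[OF c(3), of "real n"] c(2) by (simp add: L_def R_def)
      ultimately have "- a - \<bar>a\<bar> * L / R n \<le> comp_cos (seg p (g p)) (seg p ((g \<circ> c) (real n))) L (R n)"
        using L pos by (simp add: comp_cos_ge_iff)
      also have "\<dots> \<le> comp_cos (seg p (g p)) (seg p ((g \<circ> c) (real n))) L t"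
        using elim t L seg[of p "g p"] seg[of p "g (c (real n))"]
        by (intro comp_cos_antimono) (auto simp: L_def R_def)
      finally show ?case .
    qed
  qed simp
qed

text \<open>The cosine form of \<open>angle q w \<le> pi - angle u n\<close>. The estimate of
  \<open>comp_cos_displaced_ge\<close> holds at every \<open>t\<close>, so
  \<open>comp_cos_limit\<close> applies; \<epsilon> provides a strict inequality at one time
  \<open>T\<close>, which the approximating sequences inherit.\<close>

lemma pi_convergence:
  assumes g: "\<And>i. isometry (g i)"
    and n: "points_tendsto p (\<lambda>i. inv (g i) p) n" and q: "points_tendsto p (\<lambda>i. g i p) q"
    and u: "ideal_tendsto u' u" and w: "ideal_tendsto (\<lambda>i. boundary_map (g i) (u' i)) w"
  shows "- ideal_cos u n \<le> ideal_cos q w"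
proof (rule field_le_epsilon)
  fix \<epsilon> :: real assume \<epsilon>: "\<epsilon> > 0"
  define a where "a = ideal_cos u n + \<epsilon>"
  note u_in = ideal_tendstoD(2)[OF u] and n_in = points_tendstoD(1)[OF n]
  obtain T where T: "T > 0" "comp_cos (ray_from p u) (ray_from p n) T T < a"
    using ideal_cos_lessE[OF u_in ray_from_in[OF u_in, of p] n_in ray_from_in[OF n_in, of p], of a]
      ray_from_0 u_in n_in \<epsilon> by (metis a_def less_add_same_cancel1 order_refl)
  have "(\<lambda>i. comp_cos (ray_from p (u' i)) (seg p (inv (g i) p)) T T) \<longlonglongrightarrow> comp_cos (ray_from p u) (ray_from p n) T T"
    using T by (intro tendsto_comp_cos ideal_tendstoD(3)[OF u] points_tendstoD(3)[OF n]) auto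
  hence ev1: "eventually (\<lambda>i. comp_cos (ray_from p (u' i)) (seg p (inv (g i) p)) T T < a) sequentially"
    using T order_tendstoD(2) by blast
  have ev2: "eventually (\<lambda>i. T \<le> dist p (g i p)) sequentially"
    using points_tendstoD(2)[OF q] by (simp add: filterlim_at_top)
  have "- a \<le> ideal_cos q w"
  proof (rule comp_cos_limit[where g = "\<lambda>i. seg p (g i p)" and S = "\<lambda>i. dist p (g i p)"
        and k = "\<lambda>i. ray_from p (boundary_map (g i) (u' i))" and T = real and p = p])
    note w_in = ideal_tendstoD(1)[OF w]
    show "unit_speed (ray_from p (boundary_map (g i) (u' i))) (real i)" "ray_from p (boundary_map (g i) (u' i)) 0 = p" for i
      using ray_from[OF w_in] by (auto intro: geodesic_ray_unit_speed)
    show "eventually (\<lambda>i. - a \<le> comp_cos (seg p (g i p)) (ray_from p (boundary_map (g i) (u' i))) (dist p (g i p)) (real i)) sequentially"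
      using ev1 ev2 eventually_gt_at_top[of 0]
      by eventually_elim (use comp_cos_displaced_ge[OF g ideal_tendstoD(1)[OF u] T(1)] in auto)
  qed (use q w seg points_tendstoD ideal_tendstoD filterlim_real_sequentially in auto)
  thus "- ideal_cos u n \<le> ideal_cos q w + \<epsilon>" by (simp add: a_def)
qed

end

section \<open>Parabolic isometries\<close>

lemma int_funpow_Suc:
  assumes h: "bij h"
  shows "int_funpow h (i + 1) x = h (int_funpow h i x)"
proof -
  consider "i \<ge> 0" | "i = -1" | "i < -1" by linarith
  thus ?thesis
  proof cases
    case 1
    thus ?thesis by (simp add: int_funpow_def nat_add_distrib)
  next
    case 2
    thus ?thesis using h by (simp add: int_funpow_def bij_is_surj surj_f_inv_f)
  next
    case 3
    hence "nat (- i) = Suc (nat (- (i + 1)))" by simp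
    thus ?thesis using 3 h by (simp add: int_funpow_def bij_is_surj surj_f_inv_f)
  qed
qed

lemma int_funpow_pred:
  assumes h: "bij h"
  shows "int_funpow h (i - 1) x = inv h (int_funpow h i x)"
  using int_funpow_Suc[OF h, of "i - 1" x] h by (simp add: bij_is_inj inv_f_f)

lemma int_funpow_0 [simp]: "int_funpow h 0 x = x"
  by (simp add: int_funpow_def)

lemma int_funpow_1 [simp]: "int_funpow h 1 x = h x"
  by (simp add: int_funpow_def)

lemma int_funpow_add:
  assumes h: "bij h"
  shows "int_funpow h (i + j) x = int_funpow h i (int_funpow h j x)"
proof (induction i rule: int_induct[of _ 0])
  case (step1 i)
  thus ?case using int_funpow_Suc[OF h, of "i + j"] int_funpow_Suc[OF h, of i] by (simp add: algebra_simps)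
next
  case (step2 i)
  thus ?case using int_funpow_pred[OF h, of "i + j"] int_funpow_pred[OF h, of i] by (simp add: algebra_simps)
qed simp

lemma int_funpow_minus:
  assumes h: "bij h"
  shows "inv (int_funpow h i) = int_funpow h (- i)"
  using int_funpow_add[OF h, of "- i" i] int_funpow_add[OF h, of i "- i"]
  by (intro inv_unique_comp) (auto simp: fun_eq_iff)

lemma int_funpow_commute:
  assumes h: "bij h"
  shows "int_funpow h i (h x) = h (int_funpow h i x)"
  using int_funpow_add[OF h, of i 1 x] int_funpow_Suc[OF h, of i x] by simp

lemma int_funpow_dist:
  assumes h: "isometry h"
  shows "dist (int_funpow h i x) (int_funpow h j x) = dist x (int_funpow h (j - i) x)"
  using isometry_dist[OF isometry_int_funpow[OF h, of i], of x "int_funpow h (j - i) x"]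
    int_funpow_add[OF isometry_bij[OF h], of i "j - i" x] by simp

lemma int_funpow_dist_minus:
  assumes h: "isometry h"
  shows "dist x (int_funpow h (- i) x) = dist x (int_funpow h i x)"
  using int_funpow_dist[OF h, of i x 0] by (simp add: dist_commute)

lemma int_funpow_displacement:
  assumes h: "isometry h"
  shows "dist x (int_funpow h i x) \<le> \<bar>i\<bar> * dist x (h x)"
proof -
  have "dist x (int_funpow h (int n) x) \<le> n * dist x (h x)" for n
  proof (induction n)
    case (Suc n)
    have "dist x (int_funpow h (int (Suc n)) x) \<le> dist x (int_funpow h (int n) x) + dist (int_funpow h (int n) x) (int_funpow h (int (Suc n)) x)"
      by (rule dist_triangle)
    also have "dist (int_funpow h (int n) x) (int_funpow h (int (Suc n)) x) = dist x (h x)"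
      by (simp add: int_funpow_dist[OF h])
    finally show ?case using Suc by (simp add: algebra_simps)
  qed simp
  from this[of "nat \<bar>i\<bar>"] show ?thesis
    using int_funpow_dist_minus[OF h, of x "- i"] by (cases "i \<ge> 0") auto
qed

lemma not_filterlim_at_top_subseq:
  fixes f :: "nat \<Rightarrow> real"
  assumes "\<not> filterlim f at_top sequentially"
  obtains r R where "strict_mono (r :: nat \<Rightarrow> nat)" "\<And>n. f (r n) \<le> R"
proof -
  obtain R where "\<not> eventually (\<lambda>n. R \<le> f n) sequentially" using assms unfolding filterlim_at_top by blast
  hence inf: "infinite {n. \<not> R \<le> f n}"
    by (simp add: INFM_iff_infinite[symmetric] not_eventually cofinite_eq_sequentially)
  show ?thesis
  proof (rule that[of "enumerate {n. \<not> R \<le> f n}" R])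
    show "strict_mono (enumerate {n. \<not> R \<le> f n})" using strict_mono_enumerate inf by blast
    show "f (enumerate {n. \<not> R \<le> f n} n) \<le> R" for n using enumerate_in_set[OF inf, of n] by auto
  qed
qed

context proper_CAT0
begin

section \<open>Orbits of a parabolic isometry\<close>

lemma cball_cover:
  obtains k where "finite k" "cball (x::'a) r \<subseteq> (\<Union>c\<in>k. ball c (1/2))"
  using compact_cball[of x r] unfolding compact_eq_totally_bounded
  by (metis half_gt_zero zero_less_one)

text \<open>Calka's theorem: returning infinitely often, the orbit returns at bounded time intervals.\<close>

lemma recurrent_orbit_bounded:
  fixes h :: "'a \<Rightarrow> 'a"
  assumes h: "isometry h" and inf: "infinite {i. dist x (int_funpow h i x) \<le> R}"
  obtains M where "\<And>i. dist x (int_funpow h i x) \<le> M"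
proof -
  define \<phi> where "\<phi> i = int_funpow h i x" for i
  have \<phi>0: "\<phi> 0 = x" by (simp add: \<phi>_def)
  have d: "dist (\<phi> i) (\<phi> j) = dist x (\<phi> (j - i))" for i j by (simp add: \<phi>_def int_funpow_dist[OF h])
  have sym: "dist x (\<phi> (- i)) = dist x (\<phi> i)" for i by (simp add: \<phi>_def int_funpow_dist_minus[OF h])
  \<comment> \<open>Close return times. Finitely many balls of radius 1/2 cover the ball of radius
    \<open>R\<close>, so infinitely many orbit points share one of them, and differences of their
    indices are close returns.\<close>
  define N where "N = {i. dist x (\<phi> i) < 1}"
  have N_inf: "infinite N"
  proof -
    obtain k where k: "finite k" "cball x R \<subseteq> (\<Union>c\<in>k. ball c (1/2))" by (rule cball_cover)
    define S where "S = {i. dist x (\<phi> i) \<le> R}"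
    have "infinite S" using inf by (simp add: S_def \<phi>_def)
    have "\<exists>c\<in>k. \<phi> i \<in> ball c (1/2)" if "i \<in> S" for i
    proof -
      have "\<phi> i \<in> cball x R" using that by (simp add: S_def)
      with k(2) show ?thesis by blast
    qed
    then obtain f where f: "\<And>i. i \<in> S \<Longrightarrow> f i \<in> k" "\<And>i. i \<in> S \<Longrightarrow> \<phi> i \<in> ball (f i) (1/2)" by metis
    have "finite (f ` S)" using finite_subset[OF _ k(1)] f(1) by blast
    from pigeonhole_infinite[OF \<open>infinite S\<close> this]
    obtain i0 where i0: "i0 \<in> S" "infinite {i \<in> S. f i = f i0}" by blast
    have "(\<lambda>i. i - i0) ` {i \<in> S. f i = f i0} \<subseteq> N"
    proof safe
      fix i assume "i \<in> S" "f i = f i0"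
      hence "dist (\<phi> i0) (\<phi> i) < 1"
        using f(2)[of i] f(2)[OF i0(1)] dist_triangle_half_r[of "f i0" "\<phi> i0" 1 "\<phi> i"] by simp
      thus "i - i0 \<in> N" by (simp add: N_def d)
    qed
    moreover have "infinite ((\<lambda>i. i - i0) ` {i \<in> S. f i = f i0})"
      using i0(2) by (subst finite_image_iff) (auto simp: inj_on_def)
    ultimately show ?thesis using finite_subset by blast
  qed
  \<comment> \<open>\<open>F\<close> indexes finitely many orbit points that are 1-dense among the
    orbit points within distance 2 of \<open>x\<close>.\<close>
  obtain F where F: "finite F" "\<And>i. dist x (\<phi> i) \<le> 2 \<Longrightarrow> \<exists>f\<in>F. dist (\<phi> f) (\<phi> i) < 1"
  proof -
    obtain k where k: "finite k" "cball x 2 \<subseteq> (\<Union>c\<in>k. ball c (1/2))" by (rule cball_cover)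
    define s where "s c = (SOME i. \<phi> i \<in> ball c (1/2))" for c
    show ?thesis
    proof (rule that[of "s ` k"])
      show "finite (s ` k)" using k by simp
      fix i assume "dist x (\<phi> i) \<le> 2"
      hence "\<phi> i \<in> cball x 2" by simp
      with k(2) obtain c where c: "c \<in> k" "\<phi> i \<in> ball c (1/2)" by blast
      have "\<phi> (s c) \<in> ball c (1/2)" unfolding s_def using c(2) by (rule someI)
      hence "dist (\<phi> (s c)) (\<phi> i) < 1"
        using c dist_triangle_half_r[of c "\<phi> (s c)" 1 "\<phi> i"] by simp
      thus "\<exists>f\<in>s ` k. dist (\<phi> f) (\<phi> i) < 1" using c by blast
    qed
  qed
  define B where "B = Max (insert 0 (abs ` F))"
  have B: "\<bar>f\<bar> \<le> B" if "f \<in> F" for f using F that by (simp add: B_def)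
  have B0: "B \<ge> 0" using F by (simp add: B_def)
  have "\<not> N \<subseteq> {- B..B}" using N_inf finite_subset by blast
  then obtain q' where "q' \<in> N" "q' \<notin> {- B..B}" by blast
  moreover from this have "\<bar>q'\<bar> > B" by auto
  moreover have "\<bar>q'\<bar> \<in> N" using \<open>q' \<in> N\<close> sym[of q'] by (cases "q' \<ge> 0") (auto simp: N_def)
  ultimately obtain q where q: "q \<in> N" "q > B" by blast
  \<comment> \<open>For returns \<open>m\<close> and \<open>q\<close> the orbit point at
    \<open>m + q\<close> is within 2 of \<open>x\<close>, and subtracting a suitable
    \<open>f\<close> in \<open>F\<close> makes it a return again. Since \<bar>f\<bar> \<le> B < q,
    this advances by a positive amount below \<open>2 * q\<close>.\<close>
  have "\<exists>m\<in>N. int n - 2 * q \<le> m \<and> m \<le> int n" for n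
  proof (induction n)
    case 0
    show ?case using q B0 by (intro bexI[of _ 0]) (auto simp: N_def \<phi>0)
  next
    case (Suc n)
    then obtain m where m: "m \<in> N" "int n - 2 * q \<le> m" "m \<le> int n" by blast
    show ?case
    proof (cases "int (Suc n) - 2 * q \<le> m")
      case True
      thus ?thesis using m by (intro bexI[of _ m]) auto
    next
      case False
      have "dist x (\<phi> (m + q)) \<le> dist x (\<phi> m) + dist (\<phi> m) (\<phi> (m + q))" by (rule dist_triangle)
      also have "\<dots> \<le> 2" using m q by (simp add: d N_def)
      finally obtain f where f: "f \<in> F" "dist (\<phi> f) (\<phi> (m + q)) < 1" using F by blast
      have "m + q - f \<in> N" using f by (simp add: N_def d)
      thus ?thesis using B[OF f(1)] q m False by (intro bexI[of _ "m + q - f"]) auto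
    qed
  qed
  note syndetic = this
  define M where "M = 1 + (\<Sum>j\<in>{0..2 * q}. dist x (\<phi> j))"
  have pos: "dist x (\<phi> (int n)) \<le> M" for n
  proof -
    obtain m where m: "m \<in> N" "int n - 2 * q \<le> m" "m \<le> int n" using syndetic by blast
    have "dist x (\<phi> (int n)) \<le> dist x (\<phi> m) + dist (\<phi> m) (\<phi> (int n))" by (rule dist_triangle)
    also have "\<dots> \<le> 1 + dist x (\<phi> (int n - m))" using m by (simp add: N_def d)
    also have "dist x (\<phi> (int n - m)) \<le> (\<Sum>j\<in>{0..2 * q}. dist x (\<phi> j))"
      using m by (intro member_le_sum[of "int n - m"]) auto
    finally show ?thesis by (simp add: M_def)
  qed
  have "dist x (\<phi> i) \<le> M" for i
    using pos[of "nat \<bar>i\<bar>"] sym[of i] by (cases "i \<ge> 0") auto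
  thus ?thesis by (intro that[of M]) (simp add: \<phi>_def)
qed

text \<open>The fixed point is the circumcentre of the orbit.\<close>

lemma bounded_orbit_fixed_point:
  fixes h :: "'a \<Rightarrow> 'a"
  assumes h: "isometry h" and M: "\<And>i. dist x (int_funpow h i x) \<le> M"
  shows "\<exists>z. h z = z"
proof -
  define \<phi> where "\<phi> i = int_funpow h i x" for i
  define r where "r y = (SUP i. dist y (\<phi> i))" for y
  have bdd: "bdd_above (range (\<lambda>i. dist y (\<phi> i)))" for y
  proof (rule bdd_aboveI2)
    show "dist y (\<phi> i) \<le> dist y x + M" for i
      using dist_triangle[of y "\<phi> i" x] M[of i] by (simp add: \<phi>_def)
  qed
  have upper: "dist y (\<phi> i) \<le> r y" for y i unfolding r_def using bdd by (intro cSUP_upper) auto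
  have least: "r y \<le> c" if "\<And>i. dist y (\<phi> i) \<le> c" for y c
    unfolding r_def using that by (intro cSUP_least) auto
  have lip: "r y \<le> r z + dist y z" for y z
  proof (rule least)
    show "dist y (\<phi> i) \<le> r z + dist y z" for i
      using dist_triangle[of y "\<phi> i" z] upper[of z i] by linarith
  qed
  have cont: "continuous_on A r" for A
    unfolding continuous_on_iff
  proof (intro ballI allI impI)
    fix y e :: real and y' assume "e > 0"
    thus "\<exists>d>0. \<forall>z\<in>A. dist z y' < d \<longrightarrow> dist (r z) (r y') < e"
      using lip by (intro exI[of _ e]) (smt (verit) dist_commute dist_real_def)
  qed
  have rx: "dist y x \<le> r y" for y using upper[of y 0] by (simp add: \<phi>_def)
  obtain z where z: "z \<in> cball x (r x)" "\<And>y. y \<in> cball x (r x) \<Longrightarrow> r z \<le> r y"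
    using continuous_attains_inf[OF compact_cball _ cont, of x "r x"] rx[of x] by force
  \<comment> \<open>Outside the compact ball the radius is larger than \<open>r x\<close>, so the
    minimum over the ball is global.\<close>
  have min: "r z \<le> r y" for y
  proof (cases "y \<in> cball x (r x)")
    case False
    hence "r x \<le> r y" using rx[of y] by (simp add: dist_commute)
    with z(2)[of x] rx[of x] show ?thesis by simp
  qed (rule z(2))
  have inv: "r (h z) \<le> r z"
  proof (rule least)
    fix i
    have "\<phi> i = h (\<phi> (i - 1))" using int_funpow_Suc[OF isometry_bij[OF h], of "i - 1" x] by (simp add: \<phi>_def)
    thus "dist (h z) (\<phi> i) \<le> r z" using upper[of z "i - 1"] isometry_dist[OF h] by simp
  qed
  have r0: "0 \<le> r z" using rx[of z] by (meson order_trans zero_le_dist)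
  define L where "L = dist z (h z)"
  \<comment> \<open>Both \<open>z\<close> and \<open>h z\<close> minimise the radius; if they
    differed, their midpoint would have a smaller one by the CN inequality.\<close>
  define y where "y = seg z (h z) (L / 2)"
  have sq: "(dist y (\<phi> i))\<^sup>2 \<le> (r z)\<^sup>2 - L\<^sup>2 / 4" for i
  proof -
    have "(dist (\<phi> i) y)\<^sup>2 \<le> ((dist (\<phi> i) z)\<^sup>2 + (dist (\<phi> i) (h z))\<^sup>2) / 2 - L\<^sup>2 / 4"
      using CN_midpoint[OF unit_speed_seg, of z "h z" "\<phi> i"] by (simp add: y_def L_def seg_0 seg_dist)
    moreover have "(dist (\<phi> i) z)\<^sup>2 \<le> (r z)\<^sup>2" "(dist (\<phi> i) (h z))\<^sup>2 \<le> (r z)\<^sup>2"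
      using upper[of z i] upper[of "h z" i] inv by (auto intro!: power_mono simp: dist_commute)
    ultimately show ?thesis by (simp add: dist_commute field_simps)
  qed
  have nn: "0 \<le> (r z)\<^sup>2 - L\<^sup>2 / 4" using sq[of 0] by (meson order_trans zero_le_power2)
  have "r z \<le> sqrt ((r z)\<^sup>2 - L\<^sup>2 / 4)"
    using min[of y] least[of y "sqrt ((r z)\<^sup>2 - L\<^sup>2 / 4)"] sq real_le_rsqrt by (meson order_trans)
  hence "(r z)\<^sup>2 \<le> (r z)\<^sup>2 - L\<^sup>2 / 4" using r0 nn by (metis power_mono real_sqrt_pow2)
  hence "L = 0" by simp
  hence "h z = z" by (simp add: L_def)
  thus ?thesis by blast
qed

text \<open>A bounded orbit would give a fixed point, at which the displacement attains the infimum
  0.\<close>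

lemma parabolic_orbit_finite:
  fixes h :: "'a \<Rightarrow> 'a"
  assumes "parabolic h"
  shows "finite {i. dist x (int_funpow h i x) \<le> R}"
proof (rule ccontr)
  have h: "isometry h" using assms by (simp add: parabolic_def)
  assume "infinite {i. dist x (int_funpow h i x) \<le> R}"
  then obtain M where "\<And>i. dist x (int_funpow h i x) \<le> M" using recurrent_orbit_bounded[OF h] by blast
  then obtain z where z: "h z = z" using bounded_orbit_fixed_point[OF h] by blast
  have "(INF y. dist y (h y)) \<le> dist z (h z)" by (intro cINF_lower bdd_belowI2[of _ 0]) auto
  moreover have "0 \<le> (INF y. dist y (h y))" by (intro cINF_greatest) auto
  ultimately have "dist z (h z) = (INF y. dist y (h y))" using z by simp
  with assms show False by (auto simp: parabolic_def)
qed

lemma parabolic_orbit_at_top: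
  fixes h :: "'a \<Rightarrow> 'a" and f :: "nat \<Rightarrow> int"
  assumes h: "parabolic h" and f: "inj f"
  shows "filterlim (\<lambda>i. dist p (int_funpow h (f i) p)) at_top sequentially"
  unfolding filterlim_at_top
proof
  fix Z
  have "finite (f -` {i. dist p (int_funpow h i p) \<le> Z})"
    using parabolic_orbit_finite[OF h] f by (rule finite_vimageI)
  hence "finite {i. \<not> Z < dist p (int_funpow h (f i) p)}" by (simp add: vimage_def not_less)
  hence "eventually (\<lambda>i. Z < dist p (int_funpow h (f i) p)) sequentially"
    by (simp add: cofinite_eq_sequentially[symmetric] eventually_cofinite)
  thus "eventually (\<lambda>i. Z \<le> dist p (int_funpow h (f i) p)) sequentially" by eventually_elim simp
qed

text \<open>The fixed point is the limit of the points closest to \<open>p\<close> in the sublevel sets of the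
  displacement function, which are invariant under \<open>h\<close>; the inequality says that the orbit of \<open>p\<close>
  stays in a horosphere centred at \<open>m\<close>.\<close>

lemma parabolic_fixed_point:
  fixes h :: "'a \<Rightarrow> 'a"
  assumes par: "parabolic h"
  obtains m where "m \<in> visual_boundary" "boundary_map h m = m"
    "\<And>i t. t \<ge> 0 \<Longrightarrow> (dist (int_funpow h i p) (ray_from p m t))\<^sup>2 \<le> t\<^sup>2 + (dist p (int_funpow h i p))\<^sup>2"
proof -
  have h: "isometry h" using par by (simp add: parabolic_def)
  note bij = isometry_bij[OF h]
  define f where "f y = dist y (h y)" for y
  define I where "I = (INF y. f y)"
  have f0: "f y \<ge> 0" for y by (simp add: f_def)
  have I_le: "I \<le> f y" for y unfolding I_def using f0 by (intro cINF_lower bdd_belowI2[of _ 0]) auto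
  have not_I: "f y \<noteq> I" for y using par by (auto simp: parabolic_def f_def I_def)
  have f_lim: "(\<lambda>n. f (y n)) \<longlonglongrightarrow> f l" if "y \<longlonglongrightarrow> l" for y l
    unfolding f_def using that isometry_continuous[OF h that] by (intro tendsto_dist)
  have closed: "closed {y. f y \<le> a}" for a
    unfolding closed_sequential_limits using f_lim by (auto intro!: LIMSEQ_le_const2[OF f_lim])
  have "\<exists>z. f z \<le> I + 1 / Suc n \<and> (\<forall>y. f y \<le> I + 1 / Suc n \<longrightarrow> dist p z \<le> dist p y)" for n
  proof -
    have "I < I + 1 / Suc n" by simp
    then obtain y0 where y0: "f y0 < I + 1 / Suc n"
      using f0 unfolding I_def by (subst (asm) cINF_less_iff) (auto intro: bdd_belowI2[of _ 0])
    let ?C = "cball p (dist p y0) \<inter> {y. f y \<le> I + 1 / Suc n}"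
    have "compact ?C" using compact_cball closed by (intro compact_Int_closed)
    moreover have "?C \<noteq> {}" using y0 by auto
    moreover have "continuous_on ?C (dist p)" by (intro continuous_intros)
    ultimately obtain z where z: "z \<in> ?C" "\<And>y. y \<in> ?C \<Longrightarrow> dist p z \<le> dist p y"
      using continuous_attains_inf by metis
    have "dist p z \<le> dist p y" if "f y \<le> I + 1 / Suc n" for y
      using z(2)[of y] z(1) that by (cases "dist p y \<le> dist p y0") auto
    thus ?thesis using z(1) by blast
  qed
  then obtain z where z: "\<And>n. f (z n) \<le> I + 1 / Suc n"
    and near: "\<And>n y. f y \<le> I + 1 / Suc n \<Longrightarrow> dist p (z n) \<le> dist p y"
    by metis
  \<comment> \<open>A bounded subsequence would accumulate at a point of displacement
    \<open>I\<close>, which a parabolic isometry does not have.\<close>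
  have top: "filterlim (\<lambda>n. dist p (z n)) at_top sequentially"
  proof (rule ccontr)
    assume "\<not> ?thesis"
    then obtain r R where r: "strict_mono (r :: nat \<Rightarrow> nat)" "\<And>n. dist p (z (r n)) \<le> R"
      by (rule not_filterlim_at_top_subseq) blast
    obtain l r' where r': "strict_mono (r' :: nat \<Rightarrow> nat)" "((\<lambda>n. z (r n)) \<circ> r') \<longlonglongrightarrow> l"
      using bounded_subseq[of p "\<lambda>n. z (r n)" R] r(2) by metis
    have "(\<lambda>n. f (z (r (r' n)))) \<longlonglongrightarrow> f l" using f_lim[OF r'(2)] by (simp add: o_def)
    moreover have "(\<lambda>n. I + 1 / Suc n) \<longlonglongrightarrow> I + 0"
      using LIMSEQ_inverse_real_of_nat by (intro tendsto_add tendsto_const) (simp add: inverse_eq_divide)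
    from filterlim_comp_strict_mono[OF filterlim_comp_strict_mono[OF this r(1)] r'(1)]
    have "(\<lambda>n. I + 1 / Suc (r (r' n))) \<longlonglongrightarrow> I" by simp
    ultimately have "f l \<le> I" using z by (intro LIMSEQ_le) auto
    with I_le[of l] not_I[of l] show False by simp
  qed
  then obtain r m where r: "strict_mono (r :: nat \<Rightarrow> nat)" and m: "points_tendsto p (z \<circ> r) m"
    by (rule points_subseq)
  note m_in = points_tendstoD(1)[OF m]
  have fz: "f (z n) \<le> I + 1" for n
  proof -
    have "1 / Suc n \<le> (1::real)" by simp
    with z[of n] show ?thesis by linarith
  qed
  have ev_top: "eventually (\<lambda>i. t + 1 \<le> dist p (z (r i))) sequentially" for t
    using points_tendstoD(2)[OF m] by (simp add: filterlim_at_top)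
  show ?thesis
  proof (rule that[OF m_in])
    \<comment> \<open>The displacement is convex along the segments from \<open>p\<close> to
      \<open>z n\<close>, hence bounded on them independently of \<open>n\<close>; so
      \<open>h\<close> moves the limit ray by a bounded amount.\<close>
    have "f (ray_from p m t) \<le> f p + (I + 1)" if t: "t \<ge> 0" for t
    proof (rule tendsto_upperbound[OF f_lim[OF points_tendstoD(3)[OF m t]]])
      show "eventually (\<lambda>i. f (seg p ((z \<circ> r) i) t) \<le> f p + (I + 1)) sequentially"
        using ev_top[of t]
      proof eventually_elim
        case (elim i)
        define y L where "y = z (r i)" and "L = dist p y"
        have L: "L > 0" "t \<le> L" using elim t by (auto simp: L_def y_def)
        have "unit_speed (h \<circ> seg p y) L"
          using unit_speed_seg[of p y] by (simp add: unit_speed_def isometry_dist[OF h] L_def)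
        from convex_dist[OF unit_speed_seg this, of p y "t / L"]
        have "f (seg p y t) \<le> (1 - t / L) * f p + t / L * f y"
          using L t by (simp add: f_def seg_0 seg_dist L_def)
        also have "\<dots> \<le> 1 * f p + 1 * f y"
          using L t f0 by (intro add_mono mult_right_mono) auto
        finally show ?case using fz[of "r i"] by (simp add: y_def)
      qed
    qed simp
    hence "(ray_from p m, h \<circ> ray_from p m) \<in> asymptotic"
      using ray_from_ray[OF m_in] isometry_ray[OF h] by (auto simp: asymptotic_def f_def)
    thus "boundary_map h m = m"
      using boundary_eqI[OF m_in boundary_map_in[OF h m_in] ray_from_in[OF m_in] boundary_map_mem[OF ray_from_in[OF m_in]]]
      by simp
    fix i :: int and t :: real assume t: "t \<ge> 0"
    define \<eta> where "\<eta> = int_funpow h i"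
    have \<eta>: "isometry \<eta>" unfolding \<eta>_def by (rule isometry_int_funpow[OF h])
    define \<delta> K where "\<delta> = dist p (\<eta> p)" and "K = \<bar>i\<bar> * (I + 1)"
    have K: "dist (z n) (\<eta> (z n)) \<le> K" for n
    proof -
      have "dist (z n) (\<eta> (z n)) \<le> \<bar>i\<bar> * f (z n)"
        using int_funpow_displacement[OF h, of "z n" i] by (simp add: \<eta>_def f_def)
      also have "\<dots> \<le> K" unfolding K_def using fz by (intro mult_left_mono) auto
      finally show ?thesis .
    qed
    \<comment> \<open>As \<eta> commutes with \<open>h\<close>, the point
      \<open>\<eta> (z n)\<close> lies in the same sublevel set and is no closer to \<open>p\<close>
      than \<open>z n\<close>. The quadrilateral inequality, with diagonals from \<open>p\<close> to
      \<open>\<eta> (z n)\<close> and from \<open>\<eta> p\<close> to \<open>z n\<close>, then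
      bounds the second diagonal.\<close>
    have yz: "(dist (\<eta> p) (z n))\<^sup>2 \<le> \<delta>\<^sup>2 + (dist p (z n))\<^sup>2 + K\<^sup>2" for n
    proof -
      have "f (\<eta> (z n)) = f (z n)"
        using int_funpow_commute[OF bij, of i "z n"] isometry_dist[OF \<eta>, of "z n" "h (z n)"] by (simp add: f_def \<eta>_def)
      hence "dist p (z n) \<le> dist p (\<eta> (z n))" using near z by simp
      hence "(dist p (z n))\<^sup>2 \<le> (dist p (\<eta> (z n)))\<^sup>2" by (intro power_mono) auto
      moreover have "(dist p (\<eta> (z n)))\<^sup>2 + (dist (\<eta> p) (z n))\<^sup>2
          \<le> \<delta>\<^sup>2 + (dist p (z n))\<^sup>2 + (dist (\<eta> (z n)) (z n))\<^sup>2 + (dist p (z n))\<^sup>2"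
        using quadrilateral[of p "\<eta> (z n)" "\<eta> p" "z n"] isometry_dist[OF \<eta>, of p "z n"]
        by (simp add: \<delta>_def dist_commute)
      moreover have "(dist (\<eta> (z n)) (z n))\<^sup>2 \<le> K\<^sup>2" using K[of n] by (intro power_mono) (auto simp: dist_commute)
      ultimately show ?thesis by linarith
    qed
    \<comment> \<open>The CN inequality carries the bound from \<open>z n\<close> back to the point
      at distance \<open>t\<close> from \<open>p\<close>; the square of \<open>K\<close> gets weight
      \<open>t / L\<close> and disappears in the limit.\<close>
    have "(dist (\<eta> p) (ray_from p m t))\<^sup>2 \<le> t\<^sup>2 + \<delta>\<^sup>2"
    proof (rule tendsto_le[of sequentially])
      show "(\<lambda>i. (dist (\<eta> p) (seg p ((z \<circ> r) i) t))\<^sup>2) \<longlonglongrightarrow> (dist (\<eta> p) (ray_from p m t))\<^sup>2"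
        by (intro tendsto_intros points_tendstoD(3)[OF m t])
      have "(\<lambda>i. t\<^sup>2 + \<delta>\<^sup>2 + t * K\<^sup>2 / dist p ((z \<circ> r) i)) \<longlonglongrightarrow> t\<^sup>2 + \<delta>\<^sup>2 + 0"
        by (intro tendsto_add tendsto_const tendsto_divide_0[OF tendsto_const]
            filterlim_at_top_imp_at_infinity points_tendstoD(2)[OF m])
      thus "(\<lambda>i. t\<^sup>2 + \<delta>\<^sup>2 + t * K\<^sup>2 / dist p ((z \<circ> r) i)) \<longlonglongrightarrow> t\<^sup>2 + \<delta>\<^sup>2" by simp
      show "eventually (\<lambda>i. (dist (\<eta> p) (seg p ((z \<circ> r) i) t))\<^sup>2 \<le> t\<^sup>2 + \<delta>\<^sup>2 + t * K\<^sup>2 / dist p ((z \<circ> r) i)) sequentially"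
        using ev_top[of t]
      proof eventually_elim
        case (elim i)
        define y L l where "y = z (r i)" and "L = dist p y" and "l = t / L"
        have L: "L > 0" "t \<le> L" using elim t by (auto simp: L_def y_def)
        have l: "0 \<le> l" "l \<le> 1" "l * L = t" using L t by (auto simp: l_def)
        have "(dist (\<eta> p) (seg p y t))\<^sup>2 \<le> (1 - l) * \<delta>\<^sup>2 + l * (dist (\<eta> p) y)\<^sup>2 - l * (1 - l) * L\<^sup>2"
          using CN_inequality[OF unit_speed_seg, of p y l "\<eta> p"] l
          by (simp add: seg_0 seg_dist L_def \<delta>_def dist_commute)
        also have "\<dots> \<le> (1 - l) * \<delta>\<^sup>2 + l * (\<delta>\<^sup>2 + L\<^sup>2 + K\<^sup>2) - l * (1 - l) * L\<^sup>2"
          using yz[of "r i"] l by (intro diff_right_mono add_left_mono mult_left_mono) (auto simp: y_def L_def)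
        also have "\<dots> = \<delta>\<^sup>2 + (l * L)\<^sup>2 + l * K\<^sup>2" by (simp add: power2_eq_square algebra_simps)
        also have "\<dots> = t\<^sup>2 + \<delta>\<^sup>2 + t * K\<^sup>2 / L" unfolding l(3) by (simp add: l_def)
        finally show ?case by (simp add: y_def L_def)
      qed
    qed simp
    thus "(dist (int_funpow h i p) (ray_from p m t))\<^sup>2 \<le> t\<^sup>2 + (dist p (int_funpow h i p))\<^sup>2"
      by (simp add: \<eta>_def \<delta>_def)
  qed
qed

end

section \<open>The domain of discontinuity\<close>

lemma boundary_map_int_funpow_fixed:
  assumes h: "isometry h" and m: "boundary_map h m = m"
  shows "boundary_map (int_funpow h i) m = m"
proof -
  have pow: "boundary_map (g ^^ n) m = m" if "boundary_map g m = m" for g :: "'a::metric_space \<Rightarrow> 'a" and n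
    using that by (induction n) (simp_all add: boundary_map_comp boundary_map_id[unfolded id_def] boundary_map_id)
  have "boundary_map (inv h) m = m" using boundary_map_inv(2)[OF h, of m] m by simp
  thus ?thesis using pow m by (simp add: int_funpow_def)
qed

context proper_CAT0
begin

text \<open>The hypothesis \<open>horo\<close> says that comparison angles at \<open>p\<close> are
  at most \<pi>/2, and this persists at infinity.\<close>

lemma horosphere_limit:
  fixes h :: "'a \<Rightarrow> 'a" and m :: "'a ideal_point"
  assumes m: "m \<in> visual_boundary" and q: "points_tendsto p y q"
    and horo: "\<And>i t. t \<ge> 0 \<Longrightarrow> (dist (y i) (ray_from p m t))\<^sup>2 \<le> t\<^sup>2 + (dist p (y i))\<^sup>2"
  shows "Tits_dist m q \<le> ereal (pi / 2)"
proof -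
  have "0 \<le> ideal_cos m q"
  proof (rule comp_cos_limit[where g = "\<lambda>_. ray_from p m" and S = real
        and k = "\<lambda>i. seg p (y i)" and T = "\<lambda>i. dist p (y i)" and p = p])
    have "eventually (\<lambda>i. 1 \<le> dist p (y i)) sequentially"
      using points_tendstoD(2)[OF q] by (simp add: filterlim_at_top)
    thus "eventually (\<lambda>i. 0 \<le> comp_cos (ray_from p m) (seg p (y i)) (real i) (dist p (y i))) sequentially"
      using eventually_gt_at_top[of 0]
    proof eventually_elim
      case (elim i)
      thus ?case using horo[of "real i" i] by (subst comp_cos_ge_iff) (auto simp: seg_dist dist_commute)
    qed
  qed (use m q seg ray_from points_tendstoD filterlim_real_sequentially in \<open>auto intro: geodesic_ray_unit_speed\<close>)
  thus ?thesis by (rule Tits_dist_le_half_pi[OF m points_tendstoD(1)[OF q]])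
qed

text \<open>Beyond Tits distance \<pi> from the repelling point the angle is exactly \<pi>, so
  \<open>pi_convergence\<close> leaves angle 0 between \<open>q\<close> and any accumulation point;
  compactness then gives convergence.\<close>

lemma north_south:
  assumes g: "\<And>i. isometry (g i)"
    and n: "points_tendsto p (\<lambda>i. inv (g i) p) n" and q: "points_tendsto p (\<lambda>i. g i p) q"
    and z: "z \<in> visual_boundary" and far: "Tits_dist n z > ereal pi"
  shows "ideal_tendsto (\<lambda>i. boundary_map (g i) z) q"
proof (rule ideal_tendsto_subsubseq[OF boundary_map_in[OF g z] points_tendstoD(1)[OF q]])
  fix r v assume r: "strict_mono (r :: nat \<Rightarrow> nat)" and v: "ideal_tendsto ((\<lambda>i. boundary_map (g i) z) \<circ> r) v"
  have "ideal_cos z n = - 1"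
    using ideal_cos_antipodal[OF points_tendstoD(1)[OF n] z far] ideal_cos_commute[of z n] by simp
  moreover have "- ideal_cos z n \<le> ideal_cos q v"
    using pi_convergence[OF g, of p "\<lambda>i. r i" n q "\<lambda>_. z" z v]
      points_tendsto_subseq[OF n r] points_tendsto_subseq[OF q r] ideal_tendsto_const[OF z] v
    by (simp add: o_def)
  ultimately show "v = q"
    using ideal_cos_eq_1[OF points_tendstoD(1)[OF q] ideal_tendstoD(2)[OF v]] by simp
qed

lemma far_point:
  fixes u :: "'a ideal_point"
  assumes "Tits_radius (visual_boundary :: 'a ideal_point set) > ereal R" and u: "u \<in> visual_boundary"
  obtains z where "z \<in> visual_boundary" "Tits_dist u z > ereal R"
proof -
  \<comment> \<open>The radius concerns open balls; the intermediate \<open>r\<close> turns a point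
    outside the ball into a strict inequality for \<open>R\<close>.\<close>
  obtain r where r: "ereal R < r" "r < Tits_radius (visual_boundary :: 'a ideal_point set)"
    using dense assms(1) by blast
  have "\<not> visual_boundary \<subseteq> Tits_ball u r"
  proof
    assume "visual_boundary \<subseteq> Tits_ball u r"
    hence "Tits_radius (visual_boundary :: 'a ideal_point set) \<le> r"
      unfolding Tits_radius_def using u by (intro Inf_lower) blast
    with r show False by simp
  qed
  then obtain z where "z \<in> visual_boundary" "\<not> Tits_dist u z < r" by (auto simp: Tits_ball_def)
  with r that show ?thesis by (meson less_le_trans not_less)
qed

end

theorem theorem6:
  fixes h :: "'a::metric_space \<Rightarrow> 'a"
  assumes "proper_space TYPE('a)"
    and "CAT0_space TYPE('a)"
    and "Tits_radius (visual_boundary :: 'a ideal_point set) > ereal (3 * pi)"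
    and "parabolic h"
  shows "\<exists>m\<in>visual_boundary. boundary_map h m = m \<and>
    (let \<Omega> = visual_boundary - Tits_cball m (ereal pi) in
       openin boundary_topology \<Omega> \<and>
       acts_properly_discontinuously h \<Omega> \<and>
       (Tits_cball m (ereal pi) \<subseteq> limit_set \<longrightarrow>
          boundary_topology closure_of \<Omega> = visual_boundary))"
proof -
  interpret proper_CAT0 "TYPE('a)" using assms by unfold_locales
  note radius = assms(3) and par = assms(4)
  have h: "isometry h" using par by (simp add: parabolic_def)
  note bij = isometry_bij[OF h]
  define p :: 'a where "p = undefined"
  obtain m where m: "m \<in> visual_boundary" "boundary_map h m = m"
    and horo: "\<And>i t. t \<ge> 0 \<Longrightarrow> (dist (int_funpow h i p) (ray_from p m t))\<^sup>2 \<le> t\<^sup>2 + (dist p (int_funpow h i p))\<^sup>2"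
    by (rule parabolic_fixed_point[OF par]) blast
  define H where "H i = int_funpow h i" for i
  have H: "isometry (H i)" for i unfolding H_def by (rule isometry_int_funpow[OF h])
  have H_fix: "boundary_map (H i) m = m" for i unfolding H_def by (rule boundary_map_int_funpow_fixed[OF h m(2)])
  have H_Tits: "Tits_dist m (boundary_map (H i) v) = Tits_dist m v" for i v
    using Tits_dist_boundary_map[OF H, of i m v] H_fix by simp
  have H_inv: "inv (H i) = H (- i)" for i unfolding H_def by (rule int_funpow_minus[OF bij])
  \<comment> \<open>Inverses are again powers of \<open>h\<close>, so their orbit lies in the same
    horosphere; two successive subsequences make both orbits converge.\<close>
  have limits: "\<exists>r q n. strict_mono (r :: nat \<Rightarrow> nat) \<and> points_tendsto p (\<lambda>i. H (f (r i)) p) q \<and>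
      points_tendsto p (\<lambda>i. inv (H (f (r i))) p) n \<and>
      Tits_dist m q \<le> ereal (pi / 2) \<and> Tits_dist m n \<le> ereal (pi / 2)" if f: "inj f" for f :: "nat \<Rightarrow> int"
  proof -
    have "filterlim (\<lambda>i. dist p (H (f i) p)) at_top sequentially"
      unfolding H_def by (rule parabolic_orbit_at_top[OF par f])
    then obtain r1 q where r1: "strict_mono (r1 :: nat \<Rightarrow> nat)" and q: "points_tendsto p ((\<lambda>i. H (f i) p) \<circ> r1) q"
      by (rule points_subseq)
    have "inj (\<lambda>i. - f (r1 i))" using f strict_mono_eq[OF r1] by (auto simp: inj_def)
    hence "filterlim (\<lambda>i. dist p (H (- f (r1 i)) p)) at_top sequentially"
      unfolding H_def by (rule parabolic_orbit_at_top[OF par])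
    then obtain r2 n where r2: "strict_mono (r2 :: nat \<Rightarrow> nat)" and n: "points_tendsto p ((\<lambda>i. H (- f (r1 i)) p) \<circ> r2) n"
      by (rule points_subseq)
    have q': "points_tendsto p (\<lambda>i. H (f (r1 (r2 i))) p) q"
      using points_tendsto_subseq[OF q r2] by (simp add: o_def)
    have n': "points_tendsto p (\<lambda>i. H (- f (r1 (r2 i))) p) n" using n by (simp add: o_def)
    have "Tits_dist m q \<le> ereal (pi / 2)" "Tits_dist m n \<le> ereal (pi / 2)"
      using horosphere_limit[OF m(1) q'] horosphere_limit[OF m(1) n'] horo by (auto simp: H_def)
    thus ?thesis
      using q' n' strict_mono_o[OF r1 r2] by (intro exI[of _ "r1 \<circ> r2"] exI[of _ q] exI[of _ n]) (auto simp: H_inv)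
  qed
  define \<Omega> where "\<Omega> = visual_boundary - Tits_cball m (ereal pi)"
  have \<Omega>_iff: "v \<in> \<Omega> \<longleftrightarrow> v \<in> visual_boundary \<and> Tits_dist m v > ereal pi" for v
    by (auto simp: \<Omega>_def Tits_cball_def not_le)
  have "openin boundary_topology \<Omega>"
  proof (rule openin_boundaryI)
    fix w u assume w: "ideal_tendsto w u" and out: "\<And>i. w i \<notin> \<Omega>"
    have "Tits_dist m (w i) \<le> ereal pi" for i
      using out[of i] ideal_tendstoD(1)[OF w] by (simp add: \<Omega>_iff not_less)
    from Tits_cball_pi_closed[OF m(1) w this] show "u \<notin> \<Omega>" by (simp add: \<Omega>_iff not_less)
  qed (auto simp: \<Omega>_iff)
  moreover have "acts_properly_discontinuously h \<Omega>"
    unfolding acts_properly_discontinuously_def H_def[symmetric]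
  proof (intro conjI allI impI)
    fix i
    have map: "boundary_map (H i) v \<in> \<Omega>" if "v \<in> \<Omega>" for i v
      using that boundary_map_in[OF H] H_Tits by (simp add: \<Omega>_iff)
    show "boundary_map (H i) ` \<Omega> = \<Omega>"
    proof (intro equalityI subsetI)
      fix v assume "v \<in> \<Omega>"
      moreover have "v = boundary_map (H i) (boundary_map (H (- i)) v)"
        using boundary_map_inv(1)[OF H, of i v] by (simp add: H_inv)
      ultimately show "v \<in> boundary_map (H i) ` \<Omega>" using map by blast
    qed (use map in auto)
  next
    fix K :: "'a ideal_point set" assume "compactin boundary_topology K \<and> K \<subseteq> \<Omega>"
    hence K: "compactin boundary_topology K" and K\<Omega>: "K \<subseteq> \<Omega>" by auto
    show "finite {i. boundary_map (H i) ` K \<inter> K \<noteq> {}}"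
    proof (rule ccontr)
      assume "infinite {i. boundary_map (H i) ` K \<inter> K \<noteq> {}}"
      then obtain f :: "nat \<Rightarrow> int" where f: "inj f" "range f \<subseteq> {i. boundary_map (H i) ` K \<inter> K \<noteq> {}}"
        using infinite_countable_subset by blast
      obtain r q n where r: "strict_mono (r :: nat \<Rightarrow> nat)" and q: "points_tendsto p (\<lambda>i. H (f (r i)) p) q"
        and n: "points_tendsto p (\<lambda>i. inv (H (f (r i))) p) n"
        and mq: "Tits_dist m q \<le> ereal (pi / 2)" and mn: "Tits_dist m n \<le> ereal (pi / 2)"
        using limits[OF f(1)] by blast
      have "\<exists>u. u \<in> K \<and> boundary_map (H (f (r i))) u \<in> K" for i using f(2) by blast
      then obtain u' where u': "\<And>i. u' i \<in> K" "\<And>i. boundary_map (H (f (r i))) (u' i) \<in> K" by metis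
      have K_in: "v \<in> visual_boundary" if "v \<in> K" for v using that K\<Omega> by (auto simp: \<Omega>_iff)
      obtain s1 u where s1: "strict_mono (s1 :: nat \<Rightarrow> nat)" and u: "ideal_tendsto (u' \<circ> s1) u"
        using ideal_subseq[of u'] u'(1) K_in by blast
      obtain s2 w where s2: "strict_mono (s2 :: nat \<Rightarrow> nat)"
        and w: "ideal_tendsto ((\<lambda>i. boundary_map (H (f (r (s1 i)))) (u' (s1 i))) \<circ> s2) w"
        using ideal_subseq[of "\<lambda>i. boundary_map (H (f (r (s1 i)))) (u' (s1 i))"] u'(2) K_in by blast
      have s: "strict_mono (\<lambda>i. s1 (s2 i))" using strict_mono_o[OF s1 s2] by (simp add: o_def)
      have uK: "u \<in> K" using compactin_boundary_seq[OF K _ u] u'(1) by simp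
      have wK: "w \<in> K" using compactin_boundary_seq[OF K _ w] u'(2) by simp
      \<comment> \<open>\<open>K\<close> misses the closed \<pi>-ball about \<open>m\<close>, so
        \<open>u\<close> is farther than \<pi>/2 from \<open>n\<close>, and \<open>w\<close> farther
        than \<pi>/2 from \<open>q\<close>; this inequality does not allow both.\<close>
      have le: "- ideal_cos u n \<le> ideal_cos q w"
        using pi_convergence[of "\<lambda>i. H (f (r (s1 (s2 i))))" p n q "\<lambda>i. u' (s1 (s2 i))" u w] H
          points_tendsto_subseq[OF n s] points_tendsto_subseq[OF q s] ideal_tendsto_subseq[OF u s2] w
        by (simp add: o_def)
      have n_in: "n \<in> visual_boundary" and q_in: "q \<in> visual_boundary"
        using points_tendstoD(1)[OF n] points_tendstoD(1)[OF q] by auto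
      have two: "ereal (pi / 2) + ereal (pi / 2) = ereal pi" by simp
      have "ideal_cos u n < 0"
      proof (rule ccontr)
        assume "\<not> ideal_cos u n < 0"
        hence "Tits_dist n u \<le> ereal (pi / 2)"
          using Tits_dist_le_half_pi[OF n_in K_in[OF uK]] ideal_cos_commute[of u n] by simp
        with mn have "Tits_dist m u \<le> ereal (pi / 2) + ereal (pi / 2)"
          using Tits_dist_triangle[of m u n] by (meson add_mono order_trans)
        thus False using subsetD[OF K\<Omega> uK] two by (auto simp: \<Omega>_iff dest: leD)
      qed
      with le have "Tits_dist q w \<le> ereal (pi / 2)" using Tits_dist_le_half_pi[OF q_in K_in[OF wK]] by simp
      with mq have "Tits_dist m w \<le> ereal (pi / 2) + ereal (pi / 2)"
        using Tits_dist_triangle[of m w q] by (meson add_mono order_trans)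
      thus False using subsetD[OF K\<Omega> wK] two by (auto simp: \<Omega>_iff dest: leD)
    qed
  qed
  moreover have "boundary_topology closure_of \<Omega> = visual_boundary" if lim: "Tits_cball m (ereal pi) \<subseteq> limit_set"
  proof (intro equalityI subsetI)
    fix v assume "v \<in> boundary_topology closure_of \<Omega>"
    thus "v \<in> visual_boundary" by (simp add: in_closure_of topspace_boundary)
  next
    fix v :: "'a ideal_point" assume v: "v \<in> visual_boundary"
    have "\<exists>y. y \<in> \<Omega> \<and> y \<in> U" if vU: "v \<in> U" and U: "openin boundary_topology U" for U
    proof (rule ccontr)
      assume none: "\<nexists>y. y \<in> \<Omega> \<and> y \<in> U"
      have U_in: "U \<subseteq> visual_boundary" using openin_subset[OF U] by (simp add: topspace_boundary)
      have U_near: "Tits_dist m y \<le> ereal pi" if "y \<in> U" for y using none that U_in by (auto simp: \<Omega>_iff not_less)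
      have "v \<in> limit_set" using U_near[OF vU] v lim by (auto simp: Tits_cball_def)
      then obtain g :: "nat \<Rightarrow> 'a \<Rightarrow> 'a" and n where g: "\<And>i. isometry (g i)" and n_in: "n \<in> visual_boundary"
        and lim_v: "\<And>x. limitin cone_topology (\<lambda>i. Inl (g i x)) (Inr v) sequentially"
        and lim_n: "\<And>x. limitin cone_topology (\<lambda>i. Inl (inv (g i) x)) (Inr n) sequentially"
        unfolding limit_set_def by blast
      note gv = limitin_points_tendsto[OF v lim_v, of p p] and gn = limitin_points_tendsto[OF n_in lim_n, of p p]
      have into_U: "eventually (\<lambda>i. boundary_map (g i) z \<in> U) sequentially"
        if "z \<in> visual_boundary" "Tits_dist n z > ereal pi" for z
        using ideal_tendsto_eventually[OF north_south[OF g gn gv that] U vU] .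
      obtain r P N where P: "points_tendsto p (\<lambda>i. H (int (r i)) p) P"
        and N: "points_tendsto p (\<lambda>i. inv (H (int (r i))) p) N"
        and mP: "Tits_dist m P \<le> ereal (pi / 2)" and mN: "Tits_dist m N \<le> ereal (pi / 2)"
        using limits[of int] by auto
      note P_in = points_tendstoD(1)[OF P]
      obtain z0 where z0: "z0 \<in> visual_boundary" "Tits_dist n z0 > ereal (3 * pi)"
        using far_point[OF radius n_in] .
      have "ereal pi < ereal (3 * pi)" using pi_gt_zero by simp
      hence "Tits_dist n z0 > ereal pi" using z0(2) by (rule less_trans)
      from into_U[OF z0(1) this] obtain i0 where i0: "boundary_map (g i0) z0 \<in> U"
        by (auto simp: eventually_sequentially)
      define \<gamma> where "\<gamma> = inv (g i0)"
      have \<gamma>: "isometry \<gamma>" unfolding \<gamma>_def by (rule isometry_inv[OF g])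
      define \<gamma>P where "\<gamma>P = boundary_map \<gamma> P"
      have \<gamma>P_in: "\<gamma>P \<in> visual_boundary" unfolding \<gamma>P_def by (rule boundary_map_in[OF \<gamma> P_in])
      have "Tits_dist n \<gamma>P > ereal pi"
      proof (rule ccontr)
        assume "\<not> Tits_dist n \<gamma>P > ereal pi"
        hence 1: "Tits_dist n \<gamma>P \<le> ereal pi" by simp
        have "Tits_dist \<gamma>P (boundary_map \<gamma> m) = Tits_dist m P"
          unfolding \<gamma>P_def using Tits_dist_boundary_map[OF \<gamma>] Tits_dist_commute by metis
        with mP have 2: "Tits_dist \<gamma>P (boundary_map \<gamma> m) \<le> ereal (pi / 2)" by simp
        have "boundary_map \<gamma> (boundary_map (g i0) z0) = z0"
          unfolding \<gamma>_def by (rule boundary_map_inv(2)[OF g])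
        hence 3: "Tits_dist (boundary_map \<gamma> m) z0 \<le> ereal pi"
          using Tits_dist_boundary_map[OF \<gamma>, of m "boundary_map (g i0) z0"] U_near[OF i0] by simp
        \<comment> \<open>\<open>z0\<close> is the image under \<gamma> of a point of
          \<open>U\<close>, hence within \<pi> of the image of \<open>m\<close>; the three legs add
          up to at most 5\<pi>/2.\<close>
        have "Tits_dist n z0 \<le> Tits_dist n \<gamma>P + (Tits_dist \<gamma>P (boundary_map \<gamma> m) + Tits_dist (boundary_map \<gamma> m) z0)"
          using Tits_dist_triangle[of n z0 \<gamma>P] Tits_dist_triangle[of \<gamma>P z0 "boundary_map \<gamma> m"]
          by (meson add_left_mono order_trans)
        also have "\<dots> \<le> ereal pi + (ereal (pi / 2) + ereal pi)" using 1 2 3 by (intro add_mono)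
        also have "\<dots> \<le> ereal (3 * pi)" using pi_gt_zero by simp
        finally show False using z0(2) by simp
      qed
      from into_U[OF \<gamma>P_in this] obtain i1 where i1: "boundary_map (g i1) \<gamma>P \<in> U"
        by (auto simp: eventually_sequentially)
      define \<eta> where "\<eta> = g i1 \<circ> \<gamma>"
      have \<eta>: "isometry \<eta>" unfolding \<eta>_def by (rule isometry_comp[OF g \<gamma>])
      have \<eta>P: "boundary_map \<eta> P \<in> U" using i1 by (simp add: \<eta>_def \<gamma>P_def boundary_map_comp)
      \<comment> \<open>\<open>z\<close> is so far from \<open>m\<close> that it is also farther
        than \<pi> from \<open>N\<close>. Hence its images under powers of \<open>h\<close> converge
        to \<open>P\<close>, although they keep their distance from the fixed point
        \<open>m\<close>.\<close>
      obtain z where z: "z \<in> visual_boundary" "Tits_dist m z > ereal (3 * pi)"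
        using far_point[OF radius m(1)] .
      have "Tits_dist N z > ereal pi"
      proof (rule ccontr)
        assume "\<not> Tits_dist N z > ereal pi"
        hence "Tits_dist m N + Tits_dist N z \<le> ereal (pi / 2) + ereal pi" using mN by (intro add_mono) auto
        hence "Tits_dist m z \<le> ereal (pi / 2) + ereal pi" using Tits_dist_triangle order_trans by blast
        also have "\<dots> \<le> ereal (3 * pi)" using pi_gt_zero by simp
        finally show False using z(2) by simp
      qed
      from north_south[OF H N P z(1) this]
      have "ideal_tendsto (\<lambda>i. boundary_map \<eta> (boundary_map (H (int (r i))) z)) (boundary_map \<eta> P)"
        by (rule ideal_tendsto_boundary_map[OF \<eta>])
      from ideal_tendsto_eventually[OF this U \<eta>P]
      obtain j where j: "boundary_map \<eta> (boundary_map (H (int (r j))) z) \<in> U"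
        by (auto simp: eventually_sequentially)
      let ?y = "boundary_map \<eta> (boundary_map (H (int (r j))) z)"
      \<comment> \<open>The power of \<open>h\<close> fixes \<open>m\<close>, so \<eta> transports
        the distance from \<open>m\<close> to \<open>z\<close> to one starting at the image of
        \<open>m\<close>; the detour through the image of \<open>P\<close> and \<open>m\<close> is
        short because that image and \<open>?y\<close> both lie in \<open>U\<close>.\<close>
      have "Tits_dist m z = Tits_dist (boundary_map \<eta> m) ?y"
        by (simp add: Tits_dist_boundary_map[OF \<eta>] H_Tits)
      also have "\<dots> \<le> Tits_dist (boundary_map \<eta> m) (boundary_map \<eta> P) + (Tits_dist (boundary_map \<eta> P) m + Tits_dist m ?y)"
        using Tits_dist_triangle[of "boundary_map \<eta> m" ?y "boundary_map \<eta> P"]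
          Tits_dist_triangle[of "boundary_map \<eta> P" ?y m] by (meson add_left_mono order_trans)
      also have "\<dots> \<le> ereal (pi / 2) + (ereal pi + ereal pi)"
        using mP U_near[OF \<eta>P] U_near[OF j] Tits_dist_boundary_map[OF \<eta>, of m P] Tits_dist_commute[of m]
        by (intro add_mono) auto
      also have "\<dots> \<le> ereal (3 * pi)" using pi_gt_zero by simp
      finally show False using z(2) by simp
    qed
    thus "v \<in> boundary_topology closure_of \<Omega>"
      unfolding in_closure_of using v by (auto simp: topspace_boundary)
  qed
  ultimately show ?thesis using m by (auto simp: \<Omega>_def Let_def)
qed

end
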